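(* Let $A\in\mathbb{R}^{n\times n}$, $B,\tilde B\in\mathbb{R}^{n\times m}$, $C\in\mathbb{R}^{m\times n}$ with $\det(CB)\ne0$, let $\Phi:\Delta\to\mathbb{R}^{n\times n}$, $\Delta=\{(t,\tau)\in\mathbb{R}\times\mathbb{R}:t\ge\tau\}$, be measurable and locally essentially bounded, and let $\gamma\in L^\infty(\mathbb{R};\mathbb{R}^m)$, $p\in L^\infty(\mathbb{R};\mathbb{R}^n)$, $t^0\in\mathbb{R}$, $x^0\in\mathbb{R}^n$. Consider the closed-loop system $$\dot x(t)=Ax(t)+B(u(t)+\gamma(t))+p(t)+\int_{t^0}^t\Phi(t,\tau)\tilde B(u(\tau)+\gamma(\tau))\,d\tau,\quad t>t^0,\quad x(t^0)=x^0,$$ $$y(t)=Cx(t),\qquad u(t)=-\rho(CB)^{-1}\frac{y(t)}{\|y(t)\|_P},\qquad\rho>0.$$ Suppose $CA=\Lambda C$ with $\Lambda\in\mathbb{R}^{m\times m}$ such that $\Lambda^\top P+P\Lambda\preceq0$, $0\prec P=P^\top\in\mathbb{R}^{m\times m}$, and that for some constants $M$ and $\delta>0$ $$\operatorname*{ess\,sup}_{t\ge t^0}\int_{t^0}^t\|C\Phi(t,\tau)\tilde B(CB)^{-1}\|_P\,d\tau\le M<1,$$ $$\rho\ge\frac{\|C(B\gamma(t)+p(t))\|_P+\int_{t^0}^t\|C\Phi(t,\tau)\tilde B\gamma(\tau)\|_P\,d\tau+\delta}{1-M}\quad\text{for almost all }t\ge t^0.$$ Then the closed-loop system has a unique Utkin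 solution, with (almost everywhere) $$u_{\rm eq}(t)=\begin{cases}-\rho\dfrac{(CB)^{-1}y(t)}{\|y(t)\|_P},& t^0\le t<T,\\ \tilde u_{\rm eq}(t)-\gamma(t),& t\ge T,\end{cases}\qquad \tilde u_{\rm eq}=\sum_{i=0}^\infty\mathcal{K}^ig,$$ where $T\in[t^0,t^0+\|Cx^0\|_P/\delta]$ is the reaching time (the instant such that $y(t)\ne0$ for $t^0\le t<T$ and $y(t)=0$ for all $t\ge T$), and, for every $t>T$, the linear bounded operator $\mathcal{K}:L^\infty((T,t);\mathbb{R}^m)\to L^\infty((T,t);\mathbb{R}^m)$ is given for $s\in[T,t]$ by $$(\mathcal{K}g)(s)=-(CB)^{-1}\int_T^sC\Phi(s,\tau)\tilde Bg(\tau)\,d\tau,$$ $$g(t)=-(CB)^{-1}(Cp(t)+\tilde g(t)),\qquad \tilde g(t)=\int_{t^0}^TC\Phi(t,\tau)\tilde B\left(\gamma(\tau)-\tfrac{\rho(CB)^{-1}y(\tau)}{\|y(\tau)\|_P}\right)d\tau.$$ For $t\ge T$ the dynamics of the closed-loop system is governed by $$\dot x(t)=Ax(t)+\Pi p(t)+\int_{t^0}^t\Pi\Phi(t,\tau)\tilde B(u_{\rm eq}(\tau)+\gamma(\tau))\,d\tau,\qquad 0=Cx(t),$$ where $\Pi=I_n-B(CB)^{-1}C$ is a projector on $\{x: Cx=0\}$.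
   Context: $\|y\|_P=\sqrt{y^\top Py}$ for $y\in\mathbb{R}^m$, and $\|Q\|_P=\sup_{y\ne0}\|Qy\|_P/\|y\|_P$ for $Q\in\mathbb{R}^{m\times m}$. $\mathcal{B}(r)\subset\mathbb{R}^n$ is the open ball of radius $r$ centered at $0$. A function is locally essentially bounded on a set if its norm has finite essential supremum over every compact subset of that set. Filippov regularization of a function $g$ of $x$ (or $(t,x)$): $K[g](x)=\bigcap_{\delta>0}\bigcap_{\mu(N)=0}\overline{\mathrm{co}}\,g(x+\mathcal{B}(\delta)\setminus N)$, where $\overline{\mathrm{co}}$ is the convex closure and the intersections are over all $\delta>0$ and all $N\subset\mathbb{R}^n$ of Lebesgue measure zero. Utkin solution (of the first kind) of the closed-loop system on $[t^0,+\infty)$: an absolutely continuous (on compact intervals) $x$ with $x(t^0)=x^0$ for which there is a measurable $u_{\rm eq}:[t^0,+\infty)\to\mathbb{R}^m$ (the equivalent control) with $u_{\rm eq}(t)\in K[\hat u](x(t))$, $\hat u(x)=-\rho(CB)^{-1}Cx/\|Cx\|_P$, and $\dot x(t)=Ax(t)+B(u_{\rm eq}(t)+\gamma(t))+p(t)+\int_{t^0}^t\Phi(t,\tau)\tilde B(u_{\rm eq}(\tau)+\gamma(\tau))\,d\tau$ for almost all $t\ge t^0$. *)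

theory Defs
  imports "HOL-Analysis.Analysis" "HOL-Probability.Essential_Supremum"
begin

subsection \<open>Matrices and weighted norms\<close>

definition pos_definite :: "real^'m^'m \<Rightarrow> bool" where
  "pos_definite P \<longleftrightarrow> transpose P = P \<and> (\<forall>y. y \<noteq> 0 \<longrightarrow> y \<bullet> (P *v y) > 0)"

definition neg_semidefinite :: "real^'m^'m \<Rightarrow> bool" where
  "neg_semidefinite Q \<longleftrightarrow> transpose Q = Q \<and> (\<forall>y. y \<bullet> (Q *v y) \<le> 0)"

definition weighted_norm :: "real^'m^'m \<Rightarrow> real^'m \<Rightarrow> real" where
  "weighted_norm P y = sqrt (y \<bullet> (P *v y))"

definition weighted_onorm :: "real^'m^'m \<Rightarrow> real^'m^'m \<Rightarrow> real" where
  "weighted_onorm P Q = (SUP y\<in>-{0}. weighted_norm P (Q *v y) / weighted_norm P y)"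

definition projector_onto :: "real^'n^'n \<Rightarrow> (real^'n) set \<Rightarrow> bool" where
  "projector_onto Q V \<longleftrightarrow> Q ** Q = Q \<and> range (\<lambda>x. Q *v x) = V"

subsection \<open>Essentially bounded functions\<close>

text \<open>Elements of the spaces below are functions rather than equivalence classes; equalities
  between them are therefore stated almost everywhere. Note that the library's \<^const>\<open>esssup\<close>
  of a non-measurable function is infinite, and that it is \<open>-\<infinity>\<close> over a null set.\<close>

definition Linf_norm :: "'a::euclidean_space set \<Rightarrow> ('a \<Rightarrow> 'b::real_normed_vector) \<Rightarrow> ereal" where
  "Linf_norm S f = esssup (lebesgue_on S) (\<lambda>s. ereal (norm (f s)))"

definition Linf :: "'a::euclidean_space set \<Rightarrow> ('a \<Rightarrow> 'b::real_normed_vector) set" where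
  "Linf S = {f. f \<in> borel_measurable (lebesgue_on S) \<and> Linf_norm S f < \<infinity>}"

definition locally_ess_bounded_on ::
    "'a::euclidean_space set \<Rightarrow> ('a \<Rightarrow> 'b::real_normed_vector) \<Rightarrow> bool" where
  "locally_ess_bounded_on D f \<longleftrightarrow> (\<forall>S. compact S \<and> S \<subseteq> D \<longrightarrow> Linf_norm S f < \<infinity>)"

definition Linf_bounded_linear ::
    "'a::euclidean_space set \<Rightarrow> (('a \<Rightarrow> 'b::real_normed_vector) \<Rightarrow> 'a \<Rightarrow> 'b) \<Rightarrow> bool" where
  "Linf_bounded_linear S K \<longleftrightarrow>
     (\<forall>f\<in>Linf S. K f \<in> Linf S) \<and>
     (\<forall>f\<in>Linf S. \<forall>h\<in>Linf S. AE s in lebesgue_on S. K (\<lambda>r. f r + h r) s = K f s + K h s) \<and>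
     (\<forall>a. \<forall>f\<in>Linf S. AE s in lebesgue_on S. K (\<lambda>r. a *\<^sub>R f r) s = a *\<^sub>R K f s) \<and>
     (\<exists>c::real. \<forall>f\<in>Linf S. Linf_norm S (K f) \<le> ereal c * Linf_norm S f)"

definition Linf_sums ::
    "'a::euclidean_space set \<Rightarrow> (nat \<Rightarrow> 'a \<Rightarrow> 'b::real_normed_vector) \<Rightarrow> ('a \<Rightarrow> 'b) \<Rightarrow> bool" where
  "Linf_sums S F f \<longleftrightarrow> (\<forall>i. F i \<in> Linf S) \<and> f \<in> Linf S \<and>
     (\<lambda>N. Linf_norm S (\<lambda>s. f s - (\<Sum>i<N. F i s))) \<longlonglongrightarrow> 0"

subsection \<open>Absolute continuity and Filippov regularization\<close>

text \<open>\<^term>\<open>d division_of \<Union>d\<close> says that \<^term>\<open>d\<close> is a finite set of nonempty compact intervals with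
  pairwise disjoint interiors; \<^term>\<open>Inf k\<close> and \<^term>\<open>Sup k\<close> are the end points of such an interval.\<close>

definition absolutely_continuous_on :: "real set \<Rightarrow> (real \<Rightarrow> 'a::metric_space) \<Rightarrow> bool" where
  "absolutely_continuous_on S f \<longleftrightarrow>
     (\<forall>\<epsilon>>0. \<exists>\<delta>>0. \<forall>d. d division_of \<Union>d \<and> \<Union>d \<subseteq> S \<and> (\<Sum>k\<in>d. Sup k - Inf k) < \<delta> \<longrightarrow>
        (\<Sum>k\<in>d. dist (f (Inf k)) (f (Sup k))) < \<epsilon>)"

definition filippov :: "(real^'n \<Rightarrow> real^'m) \<Rightarrow> real^'n \<Rightarrow> (real^'m) set" where
  "filippov g x = (\<Inter>\<delta>\<in>{0<..}. \<Inter>N\<in>null_sets lebesgue. closure (convex hull (g ` (ball x \<delta> - N))))"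

subsection \<open>The closed-loop system\<close>

text \<open>Where \<^term>\<open>C *v x = 0\<close>, division by zero gives the feedback the value \<open>0\<close>. If \<^term>\<open>C ** B\<close> is
  invertible, this set is Lebesgue null, so the value there does not affect \<^const>\<open>filippov\<close>.\<close>

definition feedback ::
    "real^'m^'m \<Rightarrow> real \<Rightarrow> real^'m^'n \<Rightarrow> real^'n^'m \<Rightarrow> real^'n \<Rightarrow> real^'m" where
  "feedback P \<rho> B C x =
     (- \<rho> / weighted_norm P (C *v x)) *\<^sub>R (matrix_inv (C ** B) *v (C *v x))"

definition equivalent_control ::
    "real^'n^'n \<Rightarrow> real^'m^'n \<Rightarrow> real^'m^'n \<Rightarrow> (real \<Rightarrow> real \<Rightarrow> real^'n^'n) \<Rightarrow>
     (real \<Rightarrow> real^'m) \<Rightarrow> (real \<Rightarrow> real^'n) \<Rightarrow> (real^'n \<Rightarrow> real^'m) \<Rightarrow> real \<Rightarrow>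
     (real \<Rightarrow> real^'n) \<Rightarrow> (real \<Rightarrow> real^'m) \<Rightarrow> bool" where
  "equivalent_control A B Bt \<Phi> \<gamma> p uhat t0 x ueq \<longleftrightarrow>
     ueq \<in> borel_measurable (lebesgue_on {t0..}) \<and>
     (AE t in lebesgue_on {t0..}. ueq t \<in> filippov uhat (x t)) \<and>
     (AE t in lebesgue_on {t0..}.
        (x has_vector_derivative
          (A *v x t + B *v (ueq t + \<gamma> t) + p t
            + (LINT \<tau>:{t0..t}|lebesgue. (\<Phi> t \<tau> ** Bt) *v (ueq \<tau> + \<gamma> \<tau>)))) (at t))"

definition utkin_solution ::
    "real^'n^'n \<Rightarrow> real^'m^'n \<Rightarrow> real^'m^'n \<Rightarrow> (real \<Rightarrow> real \<Rightarrow> real^'n^'n) \<Rightarrow>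
     (real \<Rightarrow> real^'m) \<Rightarrow> (real \<Rightarrow> real^'n) \<Rightarrow> (real^'n \<Rightarrow> real^'m) \<Rightarrow> real \<Rightarrow> real^'n \<Rightarrow>
     (real \<Rightarrow> real^'n) \<Rightarrow> bool" where
  "utkin_solution A B Bt \<Phi> \<gamma> p uhat t0 x0 x \<longleftrightarrow>
     x t0 = x0 \<and> (\<forall>b\<ge>t0. absolutely_continuous_on {t0..b} x) \<and>
     (\<exists>ueq. equivalent_control A B Bt \<Phi> \<gamma> p uhat t0 x ueq)"

definition reaching_time :: "real \<Rightarrow> (real \<Rightarrow> real^'m) \<Rightarrow> real \<Rightarrow> bool" where
  "reaching_time t0 y T \<longleftrightarrow> t0 \<le> T \<and> (\<forall>t. t0 \<le> t \<and> t < T \<longrightarrow> y t \<noteq> 0) \<and> (\<forall>t\<ge>T. y t = 0)"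

text \<open>The value of \<open>volterra_op C B Bt \<Phi> T f\<close> at \<open>s\<close> only involves \<open>f\<close> on \<open>[T, s]\<close>, so the same
  formula acts on the essentially bounded functions over \<open>(T, t)\<close> for every \<open>t > T\<close>.\<close>

definition volterra_op ::
    "real^'n^'m \<Rightarrow> real^'m^'n \<Rightarrow> real^'m^'n \<Rightarrow> (real \<Rightarrow> real \<Rightarrow> real^'n^'n) \<Rightarrow> real \<Rightarrow>
     (real \<Rightarrow> real^'m) \<Rightarrow> real \<Rightarrow> real^'m" where
  "volterra_op C B Bt \<Phi> T f s =
     - (matrix_inv (C ** B) *v (LINT \<tau>:{T..s}|lebesgue. (C ** \<Phi> s \<tau> ** Bt) *v f \<tau>))"

definition free_term ::
    "real^'n^'m \<Rightarrow> real^'m^'n \<Rightarrow> real^'m^'n \<Rightarrow> (real \<Rightarrow> real \<Rightarrow> real^'n^'n) \<Rightarrow>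
     (real \<Rightarrow> real^'m) \<Rightarrow> (real \<Rightarrow> real^'n) \<Rightarrow> (real^'n \<Rightarrow> real^'m) \<Rightarrow> real \<Rightarrow> real \<Rightarrow>
     (real \<Rightarrow> real^'n) \<Rightarrow> real \<Rightarrow> real^'m" where
  "free_term C B Bt \<Phi> \<gamma> p uhat t0 T x t =
     - (matrix_inv (C ** B) *v
          (C *v p t + (LINT \<tau>:{t0..T}|lebesgue. (C ** \<Phi> t \<tau> ** Bt) *v (\<gamma> \<tau> + uhat (x \<tau>)))))"

definition sliding_projector :: "real^'m^'n \<Rightarrow> real^'n^'m \<Rightarrow> real^'n^'n" where
  "sliding_projector B C = mat 1 - B ** matrix_inv (C ** B) ** C"

end

theory Submission
  imports Defs
begin

text \<open>Along a solution the output \<open>y = C x\<close> satisfies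
  \<open>y' = \<Lambda> y + C B u + C (B \<gamma> + p) + memory\<close>. In the norm of \<open>P\<close> the relay makes \<open>C B u\<close> the vector
  of length \<open>\<rho>\<close> that points from \<open>y\<close> to the origin, the Lyapunov inequality says that \<open>\<Lambda>\<close> does not push
  outwards, and the gain condition says that disturbances and memory leave a margin \<open>\<delta>\<close>. Hence the
  norm of \<open>y\<close> falls at rate at least \<open>\<delta>\<close> wherever it is positive (\<open>output_norm_rate\<close>). It
  therefore vanishes no later than \<open>t0 + N (C x0) / \<delta>\<close>, where \<open>N\<close> is the norm of \<open>P\<close>,
  and it cannot become positive again (\<open>sliding_solution_reaches\<close>).

  The memory is controlled by a single estimate: if inputs are measured by \<open>N (C B u)\<close>, then the
  Volterra operator is a contraction with factor \<open>M\<close> (\<open>conv_contraction\<close>). On the sliding surface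
  \<open>y' = 0\<close> is a Volterra equation of the second kind for \<open>u + \<gamma>\<close>
  (\<open>sliding_identity_iff\<close>), so the contraction yields its Neumann series and the uniqueness of
  its solution (\<open>neumann_series\<close>, \<open>volterra_equation_zero\<close>). The same estimate shows that this
  solution never asks for more than the gain \<open>\<rho>\<close> (\<open>sliding_control_within_gain\<close>), and the ball of
  radius \<open>\<rho>\<close> is exactly the Filippov set of the relay on the surface
  (\<open>filippov_feedback_bounded\<close>, \<open>filippov_feedback_sliding\<close>).

  The state equation is singular only at \<open>y = 0\<close>. Where the norm of \<open>y\<close> is at least \<open>\<epsilon>\<close>, the relay
  agrees with a globally Lipschitz feedback, for which the state equation is a causal Lipschitz
  integral equation and uniquely solvable (\<open>solves_exists\<close>, \<open>solves_unique\<close>). Two Utkin solutions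
  thus agree until one of them reaches the surface; so both reach it at the same instant, from then on
  they have the same equivalent control, and with a given control the state equation is linear
  (\<open>sliding_solution_unique\<close>). For existence, the solutions for \<open>\<epsilon> = 1 / (k + 1)\<close> agree with each other
  as long as their outputs stay above the threshold. They define the control up to an instant \<open>T\<close>;
  after \<open>T\<close> the control is taken from the Neumann series. The state driven by this control
  has output \<open>0\<close> at \<open>T\<close>, because otherwise one of the Lipschitz solutions would stay above its
  threshold beyond \<open>T\<close>, and the output remains \<open>0\<close> since it now satisfies \<open>y' = \<Lambda> y\<close>
  (\<open>regular_phase_exists\<close>, \<open>sliding_solution_exists\<close>).

  Solutions are absolutely continuous and satisfy their equations almost everywhere. The translation to
  and from integral equations rests on the fundamental theorem of calculus for absolutely continuous
  functions (\<open>absolutely_continuous_has_integral\<close>) and on Lebesgue's differentiation theorem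
  (\<open>indefinite_integral_has_vector_derivative_AE\<close>).\<close>

section \<open>Essentially bounded functions\<close>

lemma AE_lebesgue_on_iff:
  "S \<in> sets lebesgue \<Longrightarrow> (AE x in lebesgue_on S. Q x) \<longleftrightarrow> (AE x in lebesgue. x \<in> S \<longrightarrow> Q x)"
  by (subst AE_restrict_space_iff) auto

lemma AE_Icc_mem: "AE t in lebesgue_on {a..b::real}. t \<in> {a..b}"
  by (simp add: AE_lebesgue_on_iff)

lemma AE_Icc_gt: "AE t in lebesgue_on {a..b::real}. a < t \<and> t \<le> b"
proof -
  have "AE t in lebesgue. t \<notin> {a}" by (rule AE_not_in) auto
  then show ?thesis by (subst AE_lebesgue_on_iff) (simp, rule eventually_mono, auto)
qed

lemma AE_Icc_lt: "AE t in lebesgue_on {a..b::real}. a \<le> t \<and> t < b"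
proof -
  have "AE t in lebesgue. t \<notin> {b}" by (rule AE_not_in) auto
  then show ?thesis by (subst AE_lebesgue_on_iff) (simp, rule eventually_mono, auto)
qed

lemma AE_lebesgue_on_mono:
  assumes "AE x in lebesgue_on S. Q x" "R \<subseteq> S" "R \<in> sets lebesgue" "S \<in> sets lebesgue"
  shows "AE x in lebesgue_on R. Q x"
  using assms by (auto simp: AE_lebesgue_on_iff elim: eventually_mono)

lemma measurable_lebesgue_on_indicator:
  fixes f :: "'a::euclidean_space \<Rightarrow> 'b::real_normed_vector"
  assumes "S \<in> sets lebesgue"
  shows "f \<in> borel_measurable (lebesgue_on S) \<longleftrightarrow> (\<lambda>x. indicator S x *\<^sub>R f x) \<in> borel_measurable lebesgue"
  using assms by (intro borel_measurable_restrict_space_iff) auto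

text \<open>The extended real essential supremum is replaced by a real bound that holds almost everywhere; this
  is the form in which membership in \<^const>\<open>Linf\<close> is established and used below.\<close>

lemma Linf_iff:
  fixes f :: "'a::euclidean_space \<Rightarrow> 'b::euclidean_space"
  shows "f \<in> Linf S \<longleftrightarrow> f \<in> borel_measurable (lebesgue_on S) \<and> (\<exists>c. AE x in lebesgue_on S. norm (f x) \<le> c)"
proof (intro iffI conjI)
  assume f: "f \<in> Linf S"
  show "f \<in> borel_measurable (lebesgue_on S)" using f by (simp add: Linf_def)
  have "Linf_norm S f < \<infinity>" using f by (simp add: Linf_def)
  then obtain c :: real where c: "Linf_norm S f \<le> ereal c"
    by (cases "Linf_norm S f") auto
  have "AE x in lebesgue_on S. ereal (norm (f x)) \<le> Linf_norm S f"
    unfolding Linf_norm_def by (rule esssup_AE)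
  then have "AE x in lebesgue_on S. norm (f x) \<le> c"
  proof (eventually_elim)
    case (elim x)
    then have "ereal (norm (f x)) \<le> ereal c" using c by (rule order_trans)
    then show ?case by simp
  qed
  then show "\<exists>c. AE x in lebesgue_on S. norm (f x) \<le> c" ..
next
  assume "f \<in> borel_measurable (lebesgue_on S) \<and> (\<exists>c. AE x in lebesgue_on S. norm (f x) \<le> c)"
  then obtain c where f: "f \<in> borel_measurable (lebesgue_on S)" and c: "AE x in lebesgue_on S. norm (f x) \<le> c"
    by auto
  have "Linf_norm S f \<le> ereal c"
    unfolding Linf_norm_def using f c by (intro esssup_I) auto
  then show "f \<in> Linf S" using f by (auto simp: Linf_def)
qed

lemma Linf_norm_le:
  fixes f :: "'a::euclidean_space \<Rightarrow> 'b::euclidean_space"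
  assumes "f \<in> borel_measurable (lebesgue_on S)" "AE x in lebesgue_on S. norm (f x) \<le> c"
  shows "Linf_norm S f \<le> ereal c"
  unfolding Linf_norm_def using assms by (intro esssup_I) auto

lemma LinfI:
  fixes f :: "'a::euclidean_space \<Rightarrow> 'b::euclidean_space"
  assumes "f \<in> borel_measurable (lebesgue_on S)" "AE x in lebesgue_on S. norm (f x) \<le> c"
  shows "f \<in> Linf S"
  using assms Linf_iff by blast

lemma LinfE:
  fixes f :: "'a::euclidean_space \<Rightarrow> 'b::euclidean_space"
  assumes "f \<in> Linf S"
  obtains c where "c \<ge> 0" "AE x in lebesgue_on S. norm (f x) \<le> c"
proof -
  obtain c where c: "AE x in lebesgue_on S. norm (f x) \<le> c"
    using assms Linf_iff by blast
  have "AE x in lebesgue_on S. norm (f x) \<le> max c 0"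
    using c by eventually_elim auto
  then show ?thesis using that[of "max c 0"] by auto
qed

lemma Linf_measurable: "f \<in> Linf S \<Longrightarrow> f \<in> borel_measurable (lebesgue_on S)"
  by (simp add: Linf_def)

lemma Linf_mono:
  fixes f :: "'a::euclidean_space \<Rightarrow> 'b::euclidean_space"
  assumes "f \<in> Linf S" "R \<subseteq> S" "R \<in> sets lebesgue" "S \<in> sets lebesgue"
  shows "f \<in> Linf R"
proof -
  obtain c where c: "AE x in lebesgue_on S. norm (f x) \<le> c" using assms(1) by (rule LinfE)
  show ?thesis
    using measurable_restrict_mono[OF Linf_measurable[OF assms(1)] assms(2)]
      AE_lebesgue_on_mono[OF c assms(2-4)] by (rule LinfI)
qed

lemma measurable_lebesgue_on_AE_cong:
  fixes f g :: "'a::euclidean_space \<Rightarrow> 'b::euclidean_space"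
  assumes f: "f \<in> borel_measurable (lebesgue_on S)" and S: "S \<in> sets lebesgue"
    and "AE x in lebesgue_on S. f x = g x"
  shows "g \<in> borel_measurable (lebesgue_on S)"
proof -
  have "AE x in lebesgue. indicator S x *\<^sub>R f x = indicator S x *\<^sub>R g x"
    using assms(3) unfolding AE_lebesgue_on_iff[OF S]
    by eventually_elim (auto simp: indicator_def)
  from borel_measurable_AE[OF f[unfolded measurable_lebesgue_on_indicator[OF S]] this]
  show ?thesis unfolding measurable_lebesgue_on_indicator[OF S] .
qed

lemma Linf_AE_cong:
  fixes f g :: "'a::euclidean_space \<Rightarrow> 'b::euclidean_space"
  assumes f: "f \<in> Linf S" and S: "S \<in> sets lebesgue"
    and eq: "AE x in lebesgue_on S. f x = g x"
  shows "g \<in> Linf S"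
proof -
  obtain c where c: "AE x in lebesgue_on S. norm (f x) \<le> c" using f by (rule LinfE)
  have "AE x in lebesgue_on S. norm (g x) \<le> c" using c eq by eventually_elim auto
  then show ?thesis
    using measurable_lebesgue_on_AE_cong[OF Linf_measurable[OF f] S eq] by (rule LinfI[rotated])
qed

lemma Linf_bilinear:
  fixes f :: "'a::euclidean_space \<Rightarrow> 'b::euclidean_space" and g :: "'a \<Rightarrow> 'c::euclidean_space"
    and h :: "'b \<Rightarrow> 'c \<Rightarrow> 'd::euclidean_space"
  assumes h: "bounded_bilinear h" and f: "f \<in> Linf S" and g: "g \<in> Linf S"
  shows "(\<lambda>x. h (f x) (g x)) \<in> Linf S"
proof -
  obtain c where c: "c \<ge> 0" "AE x in lebesgue_on S. norm (f x) \<le> c" using f by (rule LinfE)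
  obtain d where d: "d \<ge> 0" "AE x in lebesgue_on S. norm (g x) \<le> d" using g by (rule LinfE)
  obtain K where K: "K \<ge> 0" "\<And>a b. norm (h a b) \<le> norm a * norm b * K"
    using bounded_bilinear.nonneg_bounded[OF h] by auto
  have "AE x in lebesgue_on S. norm (h (f x) (g x)) \<le> c * d * K"
    using c(2) d(2)
  proof eventually_elim
    case (elim x)
    have "norm (h (f x) (g x)) \<le> norm (f x) * norm (g x) * K" by (rule K)
    also have "\<dots> \<le> c * d * K" using elim K c d by (intro mult_right_mono mult_mono) auto
    finally show ?case .
  qed
  moreover have "(\<lambda>x. h (f x) (g x)) \<in> borel_measurable (lebesgue_on S)"
    using Linf_measurable[OF f] Linf_measurable[OF g]
    by (rule borel_measurable_continuous_Pair)
      (intro bounded_bilinear.continuous_on[OF h] continuous_intros)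
  ultimately show ?thesis by (intro LinfI)
qed

lemma Linf_bounded_linear_image:
  fixes f :: "'a::euclidean_space \<Rightarrow> 'b::euclidean_space" and h :: "'b \<Rightarrow> 'd::euclidean_space"
  assumes h: "bounded_linear h" and f: "f \<in> Linf S"
  shows "(\<lambda>x. h (f x)) \<in> Linf S"
proof -
  obtain c where c: "c \<ge> 0" "AE x in lebesgue_on S. norm (f x) \<le> c" using f by (rule LinfE)
  obtain K where K: "K \<ge> 0" "\<And>a. norm (h a) \<le> norm a * K"
    using bounded_linear.nonneg_bounded[OF h] by auto
  have "AE x in lebesgue_on S. norm (h (f x)) \<le> c * K"
    using c(2) by eventually_elim (meson K mult_right_mono order_trans)
  moreover have "(\<lambda>x. h (f x)) \<in> borel_measurable (lebesgue_on S)"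
    using borel_measurable_continuous_on[OF linear_continuous_on[OF h] Linf_measurable[OF f]] .
  ultimately show ?thesis by (intro LinfI)
qed

lemma Linf_add:
  fixes f g :: "'a::euclidean_space \<Rightarrow> 'b::euclidean_space"
  assumes f: "f \<in> Linf S" and g: "g \<in> Linf S"
  shows "(\<lambda>x. f x + g x) \<in> Linf S"
proof -
  obtain c where c: "c \<ge> 0" "AE x in lebesgue_on S. norm (f x) \<le> c" using f by (rule LinfE)
  obtain d where d: "d \<ge> 0" "AE x in lebesgue_on S. norm (g x) \<le> d" using g by (rule LinfE)
  have "AE x in lebesgue_on S. norm (f x + g x) \<le> c + d"
    using c(2) d(2) by eventually_elim (meson norm_triangle_mono)
  then show ?thesis
    using Linf_measurable[OF f] Linf_measurable[OF g] by (intro LinfI) auto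
qed

lemma Linf_uminus:
  fixes f :: "'a::euclidean_space \<Rightarrow> 'b::euclidean_space"
  shows "f \<in> Linf S \<Longrightarrow> (\<lambda>x. - f x) \<in> Linf S"
  by (rule Linf_bounded_linear_image[OF bounded_linear_minus[OF bounded_linear_ident]])

lemma Linf_diff:
  fixes f g :: "'a::euclidean_space \<Rightarrow> 'b::euclidean_space"
  assumes f: "f \<in> Linf S" and g: "g \<in> Linf S"
  shows "(\<lambda>x. f x - g x) \<in> Linf S"
  using Linf_add[OF f Linf_uminus[OF g]] by simp

lemma Linf_scaleR:
  fixes f :: "'a::euclidean_space \<Rightarrow> 'b::euclidean_space"
  shows "f \<in> Linf S \<Longrightarrow> (\<lambda>x. a *\<^sub>R f x) \<in> Linf S"
  by (rule Linf_bounded_linear_image[OF bounded_linear_scaleR_right])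

lemma Linf_matrix_vector:
  fixes f :: "'a::euclidean_space \<Rightarrow> real^'m" and Q :: "real^'m^'n"
  shows "f \<in> Linf S \<Longrightarrow> (\<lambda>x. Q *v f x) \<in> Linf S"
  by (rule Linf_bounded_linear_image[OF matrix_vector_mul_bounded_linear])

lemma Linf_zero: "(\<lambda>x. 0 :: 'b::euclidean_space) \<in> Linf S"
  by (intro LinfI[of _ _ 0]) auto

lemma Linf_sum:
  fixes f :: "'i \<Rightarrow> 'a::euclidean_space \<Rightarrow> 'b::euclidean_space"
  shows "(\<And>i. i \<in> I \<Longrightarrow> f i \<in> Linf S) \<Longrightarrow> (\<lambda>x. \<Sum>i\<in>I. f i x) \<in> Linf S"
  by (induction I rule: infinite_finite_induct) (auto simp: Linf_zero intro!: Linf_add)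

lemma Linf_continuous:
  fixes f :: "'a::euclidean_space \<Rightarrow> 'b::euclidean_space"
  assumes "compact S" "continuous_on S f"
  shows "f \<in> Linf S"
proof -
  have S: "S \<in> sets lebesgue" using assms(1) by (simp add: borel_compact)
  obtain c where "\<And>x. x \<in> S \<Longrightarrow> norm (f x) \<le> c"
    using compact_imp_bounded[OF compact_continuous_image[OF assms(2,1)]] by (auto simp: bounded_iff)
  then show ?thesis
    using continuous_imp_measurable_on_sets_lebesgue[OF assms(2) S] S
    by (intro LinfI[of _ _ c]) (auto simp: AE_lebesgue_on_iff)
qed

lemma Linf_extend_by_zero:
  fixes f :: "'a::euclidean_space \<Rightarrow> 'b::euclidean_space"
  assumes f: "f \<in> Linf S" and S: "S \<in> sets lebesgue" and R: "R \<in> sets lebesgue"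
  shows "(\<lambda>x. if x \<in> S then f x else 0) \<in> Linf R"
proof -
  obtain c where c: "c \<ge> 0" "AE x in lebesgue_on S. norm (f x) \<le> c" using f by (rule LinfE)
  have eq: "(\<lambda>x. if x \<in> S then f x else 0) = (\<lambda>x. indicator S x *\<^sub>R f x)"
    by (auto simp: indicator_def)
  have "(\<lambda>x. if x \<in> S then f x else 0) \<in> borel_measurable lebesgue"
    unfolding eq using Linf_measurable[OF f] by (simp only: measurable_lebesgue_on_indicator[OF S])
  moreover have "AE x in lebesgue_on R. norm (if x \<in> S then f x else 0) \<le> c"
    using c(2) c(1) unfolding AE_lebesgue_on_iff[OF S] AE_lebesgue_on_iff[OF R]
    by (auto elim: eventually_mono)
  ultimately show ?thesis
    by (intro LinfI measurable_restrict_space1)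
qed

lemma Linf_if:
  fixes f g :: "'a::euclidean_space \<Rightarrow> 'b::euclidean_space"
  assumes f: "f \<in> Linf (S \<inter> R)" and g: "g \<in> Linf (S - R)"
    and S: "S \<in> sets lebesgue" and R: "R \<in> sets lebesgue"
  shows "(\<lambda>x. if x \<in> R then f x else g x) \<in> Linf S"
proof -
  have "(\<lambda>x. (if x \<in> S \<inter> R then f x else 0) + (if x \<in> S - R then g x else 0)) \<in> Linf S"
    using assms by (intro Linf_add Linf_extend_by_zero) auto
  then show ?thesis
    by (rule Linf_AE_cong) (auto simp: S AE_lebesgue_on_iff)
qed

lemma Linf_set_integrable:
  fixes f :: "'a::euclidean_space \<Rightarrow> 'b::euclidean_space"
  assumes f: "f \<in> Linf S" and S: "S \<in> lmeasurable"
  shows "set_integrable lebesgue S f"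
proof -
  have S': "S \<in> sets lebesgue" using S by (rule fmeasurableD)
  obtain c where c: "c \<ge> 0" "AE x in lebesgue_on S. norm (f x) \<le> c" using f by (rule LinfE)
  show ?thesis
    unfolding set_integrable_def
  proof (rule Bochner_Integration.integrable_bound)
    show "integrable lebesgue (\<lambda>x. indicator S x *\<^sub>R c)"
      using S by (intro integrable_scaleR_left integrable_real_indicator) (auto simp: fmeasurable_def)
    show "(\<lambda>x. indicat_real S x *\<^sub>R f x) \<in> borel_measurable lebesgue"
      using Linf_measurable[OF f] by (simp only: measurable_lebesgue_on_indicator[OF S'])
    show "AE x in lebesgue. norm (indicat_real S x *\<^sub>R f x) \<le> norm (indicat_real S x *\<^sub>R c)"
      using c unfolding AE_lebesgue_on_iff[OF S'] by (auto elim!: eventually_mono simp: indicator_def)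
  qed
qed

text \<open>The system is stated with Lebesgue integrals, whereas the fundamental theorem of calculus is
  proved for the gauge integral; essentially bounded functions may pass from one to the other.\<close>

lemma Linf_has_integral:
  fixes f :: "'a::euclidean_space \<Rightarrow> 'b::euclidean_space"
  assumes "f \<in> Linf S" "S \<in> lmeasurable"
  shows "(f has_integral (LINT x:S|lebesgue. f x)) S"
  using has_integral_set_lebesgue[OF Linf_set_integrable[OF assms]] .

lemma norm_integral_le_AE:
  fixes f :: "'a::euclidean_space \<Rightarrow> 'b::euclidean_space"
  assumes f: "f integrable_on S" and g: "g integrable_on S" and S: "S \<in> sets lebesgue"
    and le: "AE x in lebesgue_on S. norm (f x) \<le> g x"
  shows "norm (integral S f) \<le> integral S g"
proof -
  have "AE x in lebesgue. x \<in> S \<longrightarrow> norm (f x) \<le> g x"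
    using le by (simp add: AE_lebesgue_on_iff[OF S])
  then obtain N where N: "negligible N" "\<And>x. x \<in> S - N \<Longrightarrow> norm (f x) \<le> g x"
    unfolding eventually_ae_filter_negligible by blast
  have "norm (integral S (\<lambda>x. if x \<in> N then 0 else f x)) \<le> integral S (\<lambda>x. if x \<in> N then 0 else g x)"
    using N by (intro integral_norm_bound_integral integrable_spike[OF f N(1)] integrable_spike[OF g N(1)]) auto
  moreover have "integral S (\<lambda>x. if x \<in> N then 0 else f x) = integral S f"
    by (rule integral_spike[OF N(1)]) auto
  moreover have "integral S (\<lambda>x. if x \<in> N then 0 else g x) = integral S g"
    by (rule integral_spike[OF N(1)]) auto
  ultimately show ?thesis by simp
qed

lemma integral_cong_AE_Icc:
  fixes F G :: "real \<Rightarrow> 'a::euclidean_space"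
  assumes "AE s in lebesgue_on {a..b}. F s = G s" "t \<le> b"
  shows "integral {a..t} F = integral {a..t} G"
proof -
  have "AE s in lebesgue_on {a..t}. F s = G s" using assms(2) by (intro AE_lebesgue_on_mono[OF assms(1)]) auto
  then have "AE s in lebesgue. s \<in> {a..t} \<longrightarrow> F s = G s" by (simp add: AE_lebesgue_on_iff)
  then obtain N where N: "negligible N" "\<And>s. s \<in> {a..t} - N \<Longrightarrow> F s = G s"
    unfolding eventually_ae_filter_negligible by blast
  show ?thesis by (rule integral_spike[OF N(1)]) (use N(2) in auto)
qed

section \<open>Absolute continuity and indefinite integrals\<close>

lemma integral_extend_zero_Icc:
  fixes F :: "real \<Rightarrow> 'b::euclidean_space"
  assumes "a \<le> s" "s \<le> t" "t \<le> b"
  shows "integral {s..t} (\<lambda>r. if r \<in> {a..b} then F r else 0) = integral {s..t} F"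
  using assms by (intro integral_cong) auto

text \<open>Almost everywhere the means of \<open>F\<close> over short intervals to the right of \<open>t\<close> converge to \<open>F t\<close>. Applied to
  the reflected function, the same fact covers the intervals to the left, and both together give the
  two-sided derivative.\<close>

theorem indefinite_integral_has_vector_derivative_AE:
  fixes F :: "real \<Rightarrow> 'b::euclidean_space"
  assumes F: "F integrable_on {a..b}"
  shows "AE t in lebesgue_on {a..b}. ((\<lambda>s. integral {a..s} F) has_vector_derivative F t) (at t)"
proof -
  define G where "G = (\<lambda>r. if r \<in> {a..b} then F r else 0)"
  have "G integrable_on UNIV" using F unfolding G_def by (simp only: integrable_restrict_UNIV)
  then have G: "G integrable_on {c..d}" for c d by (rule integrable_on_subinterval) auto
  have Gr: "(\<lambda>t. G (- t)) integrable_on {c..d}" for c d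
    using Henstock_Kurzweil_Integration.integrable_reflect_real[where f=G and a="-d" and b="-c"] G by simp
  obtain N1 where N1: "negligible N1"
    "\<And>t e. t \<notin> N1 \<Longrightarrow> 0 < e \<Longrightarrow> \<exists>d>0. \<forall>h. 0 < h \<and> h < d \<longrightarrow> norm (integral {t..t+h} G /\<^sub>R h - G t) < e"
    using integrable_ccontinuous_explicit[of G] G by (auto simp: cbox_interval)
  obtain N2 where N2: "negligible N2"
    "\<And>t e. t \<notin> N2 \<Longrightarrow> 0 < e \<Longrightarrow> \<exists>d>0. \<forall>h. 0 < h \<and> h < d \<longrightarrow>
        norm (integral {t..t+h} (\<lambda>r. G (- r)) /\<^sub>R h - G (- t)) < e"
    using integrable_ccontinuous_explicit[of "\<lambda>r. G (- r)"] Gr by (auto simp: cbox_interval)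
  have negl: "negligible (N1 \<union> uminus ` N2 \<union> {a,b})"
    using N1(1) N2(1) by (intro negligible_Un negligible_differentiable_image_negligible)
      (auto intro!: derivative_intros)
  have der: "((\<lambda>s. integral {a..s} F) has_vector_derivative F t) (at t)"
    if t: "t \<in> {a..b}" "t \<notin> N1 \<union> uminus ` N2 \<union> {a,b}" for t
    unfolding has_vector_derivative_def has_derivative_at'
  proof (intro conjI allI impI)
    show "bounded_linear (\<lambda>h. h *\<^sub>R F t)" by (rule bounded_linear_scaleR_left)
    fix e :: real assume e: "e > 0"
    have t': "a < t" "t < b" "t \<notin> N1" "- t \<notin> N2" using t by force+
    have Gt: "G t = F t" using t by (simp add: G_def)
    obtain d1 where d1: "d1 > 0" "\<And>h. 0 < h \<Longrightarrow> h < d1 \<Longrightarrow> norm (integral {t..t+h} G /\<^sub>R h - F t) < e"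
      using N1(2)[OF t'(3) e] Gt by auto
    obtain d2 where d2: "d2 > 0"
      "\<And>h. 0 < h \<Longrightarrow> h < d2 \<Longrightarrow> norm (integral {-t..-t+h} (\<lambda>r. G (- r)) /\<^sub>R h - F t) < e"
      using N2(2)[OF t'(4) e] Gt by auto
    define d where "d = min (min d1 d2) (min (t - a) (b - t))"
    have quot: "norm (I - h *\<^sub>R v) / h < e" if "norm (I /\<^sub>R h - v) < e" "h > 0" for I v :: 'b and h :: real
    proof -
      have "I - h *\<^sub>R v = h *\<^sub>R (I /\<^sub>R h - v)" using that(2) by (simp add: algebra_simps)
      then show ?thesis using that by simp
    qed
    show "\<exists>d>0. \<forall>s. 0 < norm (s - t) \<and> norm (s - t) < d \<longrightarrow>
       norm (integral {a..s} F - integral {a..t} F - (s - t) *\<^sub>R F t) / norm (s - t) < e"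
    proof (intro exI[of _ d] conjI allI impI)
      show "d > 0" using d1 d2 t' by (auto simp: d_def)
      fix s assume s: "0 < norm (s - t) \<and> norm (s - t) < d"
      show "norm (integral {a..s} F - integral {a..t} F - (s - t) *\<^sub>R F t) / norm (s - t) < e"
      proof (cases "s > t")
        case True
        then have sb: "s < b" "s - t < d1" using s by (auto simp: d_def)
        have "integral {a..t} F + integral {t..s} F = integral {a..s} F"
          using True t' sb by (intro Henstock_Kurzweil_Integration.integral_combine integrable_on_subinterval[OF F]) auto
        from this[symmetric] have "integral {a..s} F - integral {a..t} F = integral {t..t + (s - t)} G"
          using integral_extend_zero_Icc[of a t s b F] True t' sb by (simp add: G_def)
        then show ?thesis using quot[OF d1(2)[of "s - t"]] True sb by simp
      next
        case False
        then have sb: "a < s" "t - s < d2" "s < t" using s by (auto simp: d_def)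
        have "integral {a..s} F + integral {s..t} F = integral {a..t} F"
          using t' sb by (intro Henstock_Kurzweil_Integration.integral_combine integrable_on_subinterval[OF F]) auto
        moreover have "integral {-t..-t + (t - s)} (\<lambda>r. G (- r)) = integral {s..t} F"
          using integral_extend_zero_Icc[of a s t b F] t' sb Henstock_Kurzweil_Integration.integral_reflect_real[where f=G and a=s and b=t] by (simp add: G_def)
        ultimately have "integral {a..s} F - integral {a..t} F - (s - t) *\<^sub>R F t
            = - (integral {-t..-t + (t - s)} (\<lambda>r. G (- r)) - (t - s) *\<^sub>R F t)"
          by (simp add: algebra_simps)
        moreover have "norm (integral {-t..-t + (t - s)} (\<lambda>r. G (- r)) - (t - s) *\<^sub>R F t) / (t - s) < e"
          using quot[OF d2(2)[of "t - s"]] sb by simp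
        ultimately show ?thesis using sb by (simp only: norm_minus_cancel) simp
      qed
    qed
  qed
  show ?thesis
    unfolding AE_lebesgue_on_iff[of "{a..b}", simplified] eventually_ae_filter_negligible
    using negl der by (intro exI[of _ "N1 \<union> uminus ` N2 \<union> {a,b}"]) auto
qed

lemma lipschitz_imp_absolutely_continuous_on:
  fixes x :: "real \<Rightarrow> 'a::metric_space"
  assumes L: "L-lipschitz_on {a..b} x"
  shows "absolutely_continuous_on {a..b} x"
  unfolding absolutely_continuous_on_def
proof (intro allI impI)
  fix e :: real assume e: "e > 0"
  have L0: "L \<ge> 0" using L by (rule lipschitz_on_nonneg)
  show "\<exists>\<delta>>0. \<forall>d. d division_of \<Union> d \<and> \<Union> d \<subseteq> {a..b} \<and> (\<Sum>k\<in>d. Sup k - Inf k) < \<delta> \<longrightarrow>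
       (\<Sum>k\<in>d. dist (x (Inf k)) (x (Sup k))) < e"
  proof (intro exI[of _ "e / (L + 1)"] conjI allI impI)
    show "e / (L + 1) > 0" using e L0 by simp
    fix d :: "real set set" assume d: "d division_of \<Union> d \<and> \<Union> d \<subseteq> {a..b} \<and> (\<Sum>k\<in>d. Sup k - Inf k) < e / (L + 1)"
    have k: "Inf k \<in> {a..b} \<and> Sup k \<in> {a..b} \<and> Inf k \<le> Sup k" if kd: "k \<in> d" for k
    proof -
      obtain u v where "k = cbox u v" "k \<noteq> {}" using division_ofD(3,4)[OF conjunct1[OF d] kd] by blast
      moreover have "k \<subseteq> {a..b}" using d kd by auto
      ultimately show ?thesis by auto
    qed
    have "(\<Sum>k\<in>d. dist (x (Inf k)) (x (Sup k))) \<le> (\<Sum>k\<in>d. L * (Sup k - Inf k))"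
    proof (rule sum_mono)
      fix k assume kd: "k \<in> d"
      have "dist (x (Inf k)) (x (Sup k)) \<le> L * dist (Inf k) (Sup k)"
        using k[OF kd] by (intro lipschitz_onD[OF L]) auto
      then show "dist (x (Inf k)) (x (Sup k)) \<le> L * (Sup k - Inf k)"
        using k[OF kd] by (simp add: dist_real_def)
    qed
    also have "\<dots> = L * (\<Sum>k\<in>d. Sup k - Inf k)" by (simp add: sum_distrib_left)
    also have "\<dots> \<le> L * (e / (L + 1))" using d L0 by (intro mult_left_mono) auto
    also have "\<dots> < e" using e L0 by (simp add: field_simps)
    finally show "(\<Sum>k\<in>d. dist (x (Inf k)) (x (Sup k))) < e" .
  qed
qed

lemma absolutely_continuous_imp_continuous_on:
  fixes x :: "real \<Rightarrow> 'a::metric_space"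
  assumes "absolutely_continuous_on {a..b} x"
  shows "continuous_on {a..b} x"
  unfolding continuous_on_iff
proof (intro ballI allI impI)
  fix t e :: real assume t: "t \<in> {a..b}" and e: "e > 0"
  obtain \<delta> where \<delta>: "\<delta> > 0" "\<And>d. d division_of \<Union> d \<and> \<Union> d \<subseteq> {a..b} \<and> (\<Sum>k\<in>d. Sup k - Inf k) < \<delta> \<Longrightarrow>
       (\<Sum>k\<in>d. dist (x (Inf k)) (x (Sup k))) < e"
    using assms e unfolding absolutely_continuous_on_def by meson
  have *: "dist (x u) (x v) < e" if "u \<in> {a..b}" "v \<in> {a..b}" "u \<le> v" "v - u < \<delta>" for u v
    using \<delta>(2)[of "{{u..v}}"] that division_of_self[of u v] by (auto simp: cbox_interval)
  show "\<exists>d>0. \<forall>s\<in>{a..b}. dist s t < d \<longrightarrow> dist (x s) (x t) < e"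
  proof (intro exI[of _ \<delta>] conjI ballI impI)
    fix s assume s: "s \<in> {a..b}" "dist s t < \<delta>"
    show "dist (x s) (x t) < e"
      using *[of s t] *[of t s] s t by (cases "s \<le> t") (auto simp: dist_real_def dist_commute)
  qed (rule \<delta>(1))
qed

text \<open>The gauge integral allows a direct proof. At a tag where the derivative exists, the gauge is chosen such
  that the increment over a tagged interval is close to derivative times length. At a tag in the
  exceptional null set, the gauge forces the interval into an open superset of small measure, and absolute
  continuity makes the increments over all these intervals small in total.\<close>

theorem absolutely_continuous_has_integral:
  fixes x :: "real \<Rightarrow> 'a::banach"
  assumes ac: "absolutely_continuous_on {a..b} x" and ab: "a \<le> b"
    and der: "AE t in lebesgue_on {a..b}. (x has_vector_derivative f t) (at t)"
  shows "(f has_integral (x b - x a)) {a..b}"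
proof -
  obtain N where N: "negligible N"
    and derN: "\<And>t. t \<in> {a..b} \<Longrightarrow> t \<notin> N \<Longrightarrow> (x has_vector_derivative f t) (at t)"
    using der unfolding AE_lebesgue_on_iff[of "{a..b}", simplified] eventually_ae_filter_negligible by auto
  define f0 where "f0 = (\<lambda>t. if t \<in> N then 0 else f t)"
  have "(f0 has_integral (x b - x a)) (cbox a b)"
    unfolding has_integral
  proof (intro allI impI)
    fix e :: real assume e: "e > 0"
    obtain \<delta> where \<delta>: "\<delta> > 0" "\<And>d. d division_of \<Union> d \<and> \<Union> d \<subseteq> {a..b} \<and> (\<Sum>k\<in>d. Sup k - Inf k) < \<delta> \<Longrightarrow>
         (\<Sum>k\<in>d. dist (x (Inf k)) (x (Sup k))) < e / 2"
      using ac e unfolding absolutely_continuous_on_def by (meson half_gt_zero)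
    have "N \<in> sets lebesgue" using N by (rule negligible_imp_sets)
    then obtain T where T: "open T" "N \<subseteq> T" "emeasure lebesgue (T - N) < ennreal \<delta>"
      using sets_lebesgue_outer_open[OF _ \<delta>(1)] by metis
    have mT: "T \<in> lmeasurable" "measure lebesgue T < \<delta>"
    proof -
      have null: "N \<in> null_sets lebesgue" using N negligible_iff_null_sets by blast
      have Tb: "T \<in> sets lebesgue" using T(1) by auto
      have "emeasure lebesgue T < ennreal \<delta>" using T(3) emeasure_Diff_null_set[OF null Tb] by simp
      then have fin: "emeasure lebesgue T < \<infinity>" by (rule order_less_trans) simp
      then show "T \<in> lmeasurable" using Tb by (rule fmeasurableI[rotated])
      have "emeasure lebesgue T = ennreal (measure lebesgue T)"
        using fin by (intro emeasure_eq_ennreal_measure) auto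
      then show "measure lebesgue T < \<delta>"
        using \<open>emeasure lebesgue T < ennreal \<delta>\<close> by (simp add: ennreal_less_iff)
    qed
    \<comment> \<open>The error per unit length at good tags; the summand 1 avoids division by zero for a = b.\<close>
    define \<eta> where "\<eta> = e / (2 * (b - a + 1))"
    have \<eta>: "\<eta> > 0" using e ab by (simp add: \<eta>_def)
    have "\<exists>d>0. \<forall>s. norm (s - t) < d \<longrightarrow> norm (x s - x t - (s - t) *\<^sub>R f t) \<le> \<eta> * norm (s - t)"
      if "t \<in> {a..b}" "t \<notin> N" for t
      using derN[OF that] \<eta> unfolding has_vector_derivative_def has_derivative_at_alt by blast
    then obtain d where d: "\<And>t. t \<in> {a..b} \<Longrightarrow> t \<notin> N \<Longrightarrow> d t > 0"
      "\<And>t s. t \<in> {a..b} \<Longrightarrow> t \<notin> N \<Longrightarrow> norm (s - t) < d t \<Longrightarrow> norm (x s - x t - (s - t) *\<^sub>R f t) \<le> \<eta> * norm (s - t)"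
      by metis
    define \<gamma> where "\<gamma> = (\<lambda>t. if t \<in> N then T else if t \<in> {a..b} then ball t (d t) else ball t 1)"
    show "\<exists>\<gamma>. gauge \<gamma> \<and> (\<forall>\<D>. \<D> tagged_division_of cbox a b \<and> \<gamma> fine \<D> \<longrightarrow>
         norm ((\<Sum>(t, K)\<in>\<D>. measure lborel K *\<^sub>R f0 t) - (x b - x a)) < e)"
    proof (intro exI[of _ \<gamma>] conjI allI impI)
      show "gauge \<gamma>" unfolding gauge_def \<gamma>_def using d(1) T by auto
      fix \<D> assume D: "\<D> tagged_division_of cbox a b \<and> \<gamma> fine \<D>"
      note td = tagged_division_ofD[OF conjunct1[OF D]]
      define E where "E = (\<lambda>K. x (Sup K) - x (Inf K))"
      have split_int: "\<exists>u v. K = {u..v} \<and> u \<le> t \<and> t \<le> v \<and> t \<in> {a..b} \<and> K \<subseteq> {a..b} \<and> measure lborel K = v - u \<and>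
          Sup K = v \<and> Inf K = u \<and> K \<subseteq> \<gamma> t" if tK: "(t, K) \<in> \<D>" for t K
      proof -
        obtain u v where K: "K = cbox u v" using td(4)[OF tK] by blast
        have "t \<in> K" "K \<subseteq> cbox a b" using td(2,3)[OF tK] by auto
        moreover have "K \<subseteq> \<gamma> t" using D tK by (auto simp: fine_def)
        ultimately show ?thesis using K by (intro exI[of _ u] exI[of _ v]) auto
      qed
      define D1 D2 where "D1 = {p \<in> \<D>. fst p \<notin> N}" and "D2 = {p \<in> \<D>. fst p \<in> N}"
      have fin: "finite D1" "finite D2" and un: "\<D> = D1 \<union> D2" "D1 \<inter> D2 = {}"
        using td(1) by (auto simp: D1_def D2_def)
      have "(\<Sum>(t, K)\<in>\<D>. measure lborel K *\<^sub>R f0 t) - (x b - x a) = (\<Sum>p\<in>\<D>. measure lborel (snd p) *\<^sub>R f0 (fst p) - E (snd p))"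
        using additive_tagged_division_1[OF ab, of \<D> x] D by (simp add: E_def split_def sum_subtractf)
      also have "norm \<dots> \<le> (\<Sum>p\<in>\<D>. norm (measure lborel (snd p) *\<^sub>R f0 (fst p) - E (snd p)))" by (rule norm_sum)
      also have "\<dots> = (\<Sum>p\<in>D1. norm (measure lborel (snd p) *\<^sub>R f0 (fst p) - E (snd p)))
          + (\<Sum>p\<in>D2. norm (measure lborel (snd p) *\<^sub>R f0 (fst p) - E (snd p)))"
        unfolding un(1) by (rule sum.union_disjoint[OF fin un(2)])
      finally have bound: "norm ((\<Sum>(t, K)\<in>\<D>. measure lborel K *\<^sub>R f0 t) - (x b - x a)) \<le> \<dots>" .
      have "(\<Sum>p\<in>D1. norm (measure lborel (snd p) *\<^sub>R f0 (fst p) - E (snd p))) \<le> (\<Sum>p\<in>D1. \<eta> * measure lborel (snd p))"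
      proof (rule sum_mono)
        fix p assume p: "p \<in> D1"
        obtain t K where [simp]: "p = (t, K)" by (cases p)
        have tK: "(t, K) \<in> \<D>" "t \<notin> N" using p by (auto simp: D1_def)
        obtain u v where uv: "K = {u..v}" "u \<le> t" "t \<le> v" "t \<in> {a..b}" "measure lborel K = v - u"
          "Sup K = v" "Inf K = u" "K \<subseteq> \<gamma> t" using split_int[OF tK(1)] by blast
        have "K \<subseteq> ball t (d t)" "u \<in> K" "v \<in> K" using uv tK(2) unfolding \<gamma>_def by (simp_all del: mem_ball)
        then have "u \<in> ball t (d t)" "v \<in> ball t (d t)" by blast+
        then have 1: "norm (x u - x t - (u - t) *\<^sub>R f t) \<le> \<eta> * (t - u)" "norm (x v - x t - (v - t) *\<^sub>R f t) \<le> \<eta> * (v - t)"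
          using d(2)[OF uv(4) tK(2), of u] d(2)[OF uv(4) tK(2), of v] uv by (auto simp: dist_real_def)
        have "measure lborel (snd p) *\<^sub>R f0 (fst p) - E (snd p)
            = (x u - x t - (u - t) *\<^sub>R f t) - (x v - x t - (v - t) *\<^sub>R f t)"
          using tK uv by (simp add: E_def f0_def algebra_simps)
        also have "norm \<dots> \<le> \<eta> * (t - u) + \<eta> * (v - t)"
          using 1 norm_triangle_ineq4 by (meson add_mono order_trans)
        finally show "norm (measure lborel (snd p) *\<^sub>R f0 (fst p) - E (snd p)) \<le> \<eta> * measure lborel (snd p)"
          using uv by (simp add: algebra_simps)
      qed
      also have "\<dots> \<le> (\<Sum>p\<in>\<D>. \<eta> * measure lborel (snd p))"
        using \<eta> by (intro sum_mono2 td(1)) (auto simp: D1_def)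
      also have "\<dots> = \<eta> * (b - a)"
        using additive_content_tagged_division[OF conjunct1[OF D]] ab by (simp add: split_def sum_distrib_left[symmetric])
      also have "\<dots> < e / 2" using e ab by (simp add: \<eta>_def field_simps)
      finally have part1: "(\<Sum>p\<in>D1. norm (measure lborel (snd p) *\<^sub>R f0 (fst p) - E (snd p))) < e / 2" .
      have D2p: "D2 tagged_partial_division_of cbox a b"
        using D by (auto simp: D2_def tagged_division_of_def intro: tagged_partial_division_subset)
      define dd where "dd = snd ` D2"
      have ddiv: "dd division_of \<Union>dd"
        unfolding dd_def by (rule partial_division_of_tagged_division[OF D2p])
      have "(\<Sum>p\<in>D2. norm (measure lborel (snd p) *\<^sub>R f0 (fst p) - E (snd p))) = (\<Sum>p\<in>D2. norm (E (snd p)))"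
        by (intro sum.cong) (auto simp: D2_def f0_def)
      also have "\<dots> = (\<Sum>K\<in>dd. norm (E K))"
        unfolding dd_def
      \<comment> \<open>Two tags can share an interval only if it is degenerate, and then the increment is zero.\<close>
      proof (rule sum.reindex_nontrivial[symmetric, unfolded o_def])
        show "finite D2" by (rule fin)
        fix p q assume pq: "p \<in> D2" "q \<in> D2" "p \<noteq> q" "snd p = snd q"
        obtain t K where [simp]: "p = (t, K)" by (cases p)
        obtain t' where [simp]: "q = (t', K)" using pq by (cases q) auto
        have tK: "(t, K) \<in> \<D>" "(t', K) \<in> \<D>" using pq by (auto simp: D2_def)
        have "interior K = {}" using td(5)[OF tK] pq by auto
        moreover obtain u v where "K = {u..v}" "u \<le> t" "t \<le> v" "Sup K = v" "Inf K = u"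
          using split_int[OF tK(1)] by blast
        ultimately have "u = v" "Sup K = v" "Inf K = u" by (auto simp: interior_atLeastAtMost_real)
        then show "norm (E (snd p)) = 0" by (simp add: E_def)
      qed
      also have "\<dots> = (\<Sum>K\<in>dd. dist (x (Inf K)) (x (Sup K)))" by (simp add: E_def dist_norm norm_minus_commute)
      also have "\<dots> < e / 2"
      proof (rule \<delta>(2), intro conjI)
        show "dd division_of \<Union> dd" by (rule ddiv)
        have K: "K \<subseteq> {a..b} \<and> K \<subseteq> T \<and> Sup K - Inf K = measure lebesgue K" if Kd: "K \<in> dd" for K
        proof -
          obtain t where "(t, K) \<in> \<D>" "t \<in> N" using Kd by (auto simp: dd_def D2_def)
          moreover from split_int[OF this(1)] obtain u v where "K = {u..v}" "u \<le> t" "t \<le> v" "K \<subseteq> {a..b}"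
            "Sup K = v" "Inf K = u" "K \<subseteq> \<gamma> t" by blast
          ultimately show ?thesis by (simp add: \<gamma>_def)
        qed
        then show "\<Union> dd \<subseteq> {a..b}" by auto
        have "(\<Sum>K\<in>dd. Sup K - Inf K) = (\<Sum>K\<in>dd. measure lebesgue K)" using K by (intro sum.cong) auto
        also have "\<dots> = measure lebesgue (\<Union>dd)" by (rule content_division[OF ddiv])
        also have "\<dots> \<le> measure lebesgue T"
          using K mT(1) ddiv by (intro measure_mono_fmeasurable) (auto intro: lmeasurable_division fmeasurableD)
        finally show "(\<Sum>K\<in>dd. Sup K - Inf K) < \<delta>" using mT by simp
      qed
      finally show "norm ((\<Sum>(t, K)\<in>\<D>. measure lborel K *\<^sub>R f0 t) - (x b - x a)) < e"
        using bound part1 by linarith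
    qed
  qed
  then have "(f0 has_integral (x b - x a)) {a..b}" by simp
  then show ?thesis by (rule has_integral_spike[OF N, rotated]) (auto simp: f0_def)
qed

text \<open>A one-sided bound on the derivative may be integrated even though the derivative is only known to
  exist almost everywhere.\<close>

lemma absolutely_continuous_increment_le:
  fixes V :: "real \<Rightarrow> real"
  assumes ac: "absolutely_continuous_on {a..b} V" and ab: "a \<le> b"
    and der: "AE t in lebesgue_on {a..b}. \<exists>v\<le>c. (V has_vector_derivative v) (at t)"
  shows "V b - V a \<le> c * (b - a)"
proof -
  define f where "f = (\<lambda>t. min c (vector_derivative V (at t)))"
  have "AE t in lebesgue_on {a..b}. (V has_vector_derivative f t) (at t)"
    using der by eventually_elim (auto simp: f_def vector_derivative_at min_absorb2)
  then have "(f has_integral (V b - V a)) {a..b}"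
    by (rule absolutely_continuous_has_integral[OF ac ab])
  moreover have "((\<lambda>t. c) has_integral c * (b - a)) {a..b}"
    using has_integral_const_real[of c a b] ab by (simp add: mult.commute)
  ultimately show ?thesis by (rule has_integral_le) (auto simp: f_def)
qed

lemma integral_lipschitz_on:
  fixes F :: "real \<Rightarrow> 'a::euclidean_space"
  assumes F: "F \<in> Linf {a..b}" and x: "\<And>t. t \<in> {a..b} \<Longrightarrow> x t = x0 + integral {a..t} F"
  obtains L where "L-lipschitz_on {a..b} x"
proof -
  obtain c where c: "c \<ge> 0" "AE t in lebesgue_on {a..b}. norm (F t) \<le> c" using F by (rule LinfE)
  have int: "F integrable_on {a..b}" using Linf_has_integral[OF F] by (auto simp: integrable_on_def)
  have *: "norm (x t - x s) \<le> c * (t - s)" if st: "s \<in> {a..b}" "t \<in> {a..b}" "s \<le> t" for s t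
  proof -
    have "integral {a..s} F + integral {s..t} F = integral {a..t} F"
      using st by (intro Henstock_Kurzweil_Integration.integral_combine integrable_on_subinterval[OF int]) auto
    then have "x t - x s = integral {s..t} F" using x[of s] x[of t] st by (simp add: algebra_simps)
    also have "norm \<dots> \<le> integral {s..t} (\<lambda>_. c)"
      using st by (intro norm_integral_le_AE integrable_on_subinterval[OF int] AE_lebesgue_on_mono[OF c(2)]) auto
    finally show ?thesis using st by (simp add: mult.commute)
  qed
  have "c-lipschitz_on {a..b} x"
  proof (rule lipschitz_onI)
    fix s t assume "s \<in> {a..b}" "t \<in> {a..b}"
    then show "dist (x s) (x t) \<le> c * dist s t"
      using *[of s t] *[of t s] by (cases "s \<le> t") (auto simp: dist_norm norm_minus_commute)
  qed (rule c)
  then show ?thesis by (rule that)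
qed

section \<open>Volterra kernels that are locally essentially bounded\<close>

lemma AE_lebesgue_on_atLeast:
  fixes a :: real
  assumes "\<And>b. AE t in lebesgue_on {a..b}. Q t"
  shows "AE t in lebesgue_on {a..}. Q t"
proof -
  have "AE t in lebesgue. \<forall>n::nat. t \<in> {a..real n} \<longrightarrow> Q t"
    unfolding AE_all_countable using assms by (auto simp: AE_lebesgue_on_iff)
  then have "AE t in lebesgue. t \<in> {a..} \<longrightarrow> Q t"
    by eventually_elim (auto intro: real_arch_simple)
  then show ?thesis by (simp add: AE_lebesgue_on_iff)
qed

lemma measurable_lebesgue_on_atLeast:
  fixes a :: real and f :: "real \<Rightarrow> 'b::euclidean_space"
  assumes "\<And>b. f \<in> borel_measurable (lebesgue_on {a..b})"
  shows "f \<in> borel_measurable (lebesgue_on {a..})"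
proof -
  have "(\<lambda>t. indicator {a..} t *\<^sub>R f t) \<in> borel_measurable lebesgue"
  proof (rule borel_measurable_LIMSEQ_metric)
    show "(\<lambda>t. indicator {a..real n} t *\<^sub>R f t) \<in> borel_measurable lebesgue" for n
      using assms[of "real n"] by (simp add: measurable_lebesgue_on_indicator)
    show "(\<lambda>n. indicator {a..real n} t *\<^sub>R f t) \<longlonglongrightarrow> indicator {a..} t *\<^sub>R f t" for t
    proof (rule tendsto_eventually)
      obtain n0 :: nat where n0: "t \<le> real n0" using real_arch_simple by blast
      show "\<forall>\<^sub>F n in sequentially. indicat_real {a..real n} t *\<^sub>R f t = indicat_real {a..} t *\<^sub>R f t"
        using eventually_ge_at_top[of n0] by eventually_elim (use n0 in \<open>auto simp: indicator_def\<close>)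
    qed
  qed
  then show ?thesis by (simp add: measurable_lebesgue_on_indicator)
qed

lemma bounded_bilinear_matrix_vector_mult:
  "bounded_bilinear (\<lambda>(Q :: real^'k^'n) v. Q *v v)"
proof -
  have "bilinear (\<lambda>(Q :: real^'k^'n) v. Q *v v)"
    unfolding bilinear_def
    by (auto intro!: linearI simp: matrix_vector_mult_add_rdistrib matrix_vector_right_distrib
        scaleR_matrix_vector_assoc matrix_vector_mult_scaleR)
  then show ?thesis by (simp add: bilinear_conv_bounded_bilinear)
qed

lemma LINT_Icc_eq_integral:
  fixes f :: "real \<Rightarrow> 'a::euclidean_space"
  assumes "f \<in> Linf {a..b}"
  shows "(LINT t:{a..b}|lebesgue. f t) = integral {a..b} f"
  using Linf_has_integral[OF assms] by (simp add: integral_unique)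

lemma Linf_integrable_on_Icc:
  fixes f :: "real \<Rightarrow> 'a::euclidean_space"
  shows "f \<in> Linf {a..b} \<Longrightarrow> f integrable_on {a..b}"
  using Linf_has_integral[of f "{a..b}"] by (auto simp: integrable_on_def)

lemma Linf_Icc_mono:
  fixes f :: "real \<Rightarrow> 'a::euclidean_space"
  shows "f \<in> Linf {a..b} \<Longrightarrow> a \<le> c \<Longrightarrow> d \<le> b \<Longrightarrow> f \<in> Linf {c..d}"
  by (erule Linf_mono) auto

lemma norm_LINT_le:
  fixes f :: "real \<Rightarrow> 'a::euclidean_space"
  assumes "f \<in> Linf {a..b}" "g \<in> Linf {a..b}" "AE t in lebesgue_on {a..b}. norm (f t) \<le> g t"
  shows "norm (LINT t:{a..b}|lebesgue. f t) \<le> (LINT t:{a..b}|lebesgue. g t)"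
  unfolding LINT_Icc_eq_integral[OF assms(1)] LINT_Icc_eq_integral[OF assms(2)]
  using assms by (intro norm_integral_le_AE Linf_integrable_on_Icc) auto

lemma Linf_const_Icc: "(\<lambda>t::real. c :: 'a::euclidean_space) \<in> Linf {a..b}"
  by (rule Linf_continuous) auto

lemma norm_LINT_le_const:
  fixes f :: "real \<Rightarrow> 'a::euclidean_space"
  assumes "f \<in> Linf {a..b}" "a \<le> b" "AE t in lebesgue_on {a..b}. norm (f t) \<le> c"
  shows "norm (LINT t:{a..b}|lebesgue. f t) \<le> c * (b - a)"
  using norm_LINT_le[OF assms(1) Linf_const_Icc assms(3)] assms(2)
  by (simp add: LINT_Icc_eq_integral[OF Linf_const_Icc] mult.commute)

lemma LINT_mono_AE:
  fixes f g :: "real \<Rightarrow> real"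
  assumes "f \<in> Linf {a..b}" "g \<in> Linf {a..b}" "AE t in lebesgue_on {a..b}. f t \<le> g t"
  shows "(LINT t:{a..b}|lebesgue. f t) \<le> (LINT t:{a..b}|lebesgue. g t)"
proof -
  have "set_integrable lebesgue {a..b} f" "set_integrable lebesgue {a..b} g"
    using assms by (auto intro: Linf_set_integrable)
  then show ?thesis
    using assms(3) by (intro set_integral_mono_AE) (auto simp: AE_lebesgue_on_iff)
qed

lemma LINT_cong_AE_Icc:
  fixes f g :: "real \<Rightarrow> 'a::euclidean_space"
  assumes "f \<in> Linf {a..b}" "AE t in lebesgue_on {a..b}. f t = g t"
  shows "(LINT t:{a..b}|lebesgue. f t) = (LINT t:{a..b}|lebesgue. g t)"
proof -
  have g: "g \<in> Linf {a..b}" by (rule Linf_AE_cong[OF assms(1) _ assms(2)]) auto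
  have "AE t in lebesgue. indicator {a..b} t *\<^sub>R f t = indicator {a..b} t *\<^sub>R g t"
    using assms(2) by (auto simp: AE_lebesgue_on_iff indicator_def elim: eventually_mono)
  then show ?thesis
    unfolding set_lebesgue_integral_def
    using Linf_measurable[OF assms(1)] Linf_measurable[OF g]
    by (intro integral_cong_AE) (simp_all add: measurable_lebesgue_on_indicator)
qed

lemma LINT_bounded_linear:
  fixes f :: "real \<Rightarrow> 'a::euclidean_space" and h :: "'a \<Rightarrow> 'b::euclidean_space"
  assumes f: "f \<in> Linf {a..b}" and h: "bounded_linear h"
  shows "(LINT t:{a..b}|lebesgue. h (f t)) = h (LINT t:{a..b}|lebesgue. f t)"
  using has_integral_linear[OF Linf_has_integral[OF f] h]
    Linf_has_integral[OF Linf_bounded_linear_image[OF h f]]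
  by (auto simp: o_def intro: has_integral_unique)

lemma LINT_combine_Icc:
  fixes f :: "real \<Rightarrow> 'a::euclidean_space"
  assumes f: "f \<in> Linf {a..b}" and "a \<le> c" "c \<le> b"
  shows "(LINT t:{a..b}|lebesgue. f t) = (LINT t:{a..c}|lebesgue. f t) + (LINT t:{c..b}|lebesgue. f t)"
  using Henstock_Kurzweil_Integration.integral_combine[OF assms(2,3) Linf_integrable_on_Icc[OF f]] assms
  by (simp add: LINT_Icc_eq_integral[OF f] LINT_Icc_eq_integral[OF Linf_Icc_mono[OF f]])

lemma LINT_add_Icc:
  fixes f g :: "real \<Rightarrow> 'a::euclidean_space"
  assumes "f \<in> Linf {a..b}" "g \<in> Linf {a..b}"
  shows "(LINT t:{a..b}|lebesgue. f t + g t) = (LINT t:{a..b}|lebesgue. f t) + (LINT t:{a..b}|lebesgue. g t)"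
  using assms by (intro set_integral_add Linf_set_integrable) auto

lemma LINT_diff_Icc:
  fixes f g :: "real \<Rightarrow> 'a::euclidean_space"
  assumes "f \<in> Linf {a..b}" "g \<in> Linf {a..b}"
  shows "(LINT t:{a..b}|lebesgue. f t - g t) = (LINT t:{a..b}|lebesgue. f t) - (LINT t:{a..b}|lebesgue. g t)"
  using assms by (intro set_integral_diff Linf_set_integrable) auto

text \<open>Fubini's theorem requires measurability with respect to the product sigma-algebra, which Lebesgue
  measurable functions on the plane may lack. Borel representatives have it.\<close>

lemma lebesgue_measurable_borel_representative:
  fixes f :: "'a::euclidean_space \<Rightarrow> 'b::euclidean_space"
  assumes f: "f \<in> borel_measurable lebesgue"
  obtains g where "g \<in> borel_measurable borel" "AE x in lebesgue. f x = g x"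
proof -
  have "\<exists>h\<in>borel_measurable lborel. AE x in lborel. f x \<bullet> i = h x" for i
    using f by (intro completion_ex_borel_measurable_real) auto
  then obtain h where h: "\<And>i. h i \<in> borel_measurable lborel" "\<And>i. AE x in lborel. f x \<bullet> i = h i x"
    by metis
  show ?thesis
  proof (rule that[of "\<lambda>x. \<Sum>i\<in>Basis. h i x *\<^sub>R i"])
    show "(\<lambda>x. \<Sum>i\<in>Basis. h i x *\<^sub>R i) \<in> borel_measurable borel" using h(1) by auto
    have "AE x in lborel. \<forall>i\<in>Basis. f x \<bullet> i = h i x"
      using h(2) by (intro AE_finite_allI) auto
    then have "AE x in lborel. f x = (\<Sum>i\<in>Basis. h i x *\<^sub>R i)"
      by eventually_elim (metis (no_types, lifting) euclidean_representation sum.cong)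
    then show "AE x in lebesgue. f x = (\<Sum>i\<in>Basis. h i x *\<^sub>R i)" by (rule AE_completion)
  qed
qed

lemma AE_lebesgue_slices:
  fixes Q :: "real \<times> real \<Rightarrow> bool"
  assumes "AE z in lebesgue. Q z"
  shows "AE t in lebesgue. AE \<tau> in lebesgue. Q (t, \<tau>)"
proof -
  have "AE z in lborel \<Otimes>\<^sub>M lborel. Q z"
    using assms unfolding AE_completion_iff lborel_prod .
  then have "AE t in lborel. AE \<tau> in lborel. Q (t, \<tau>)"
    by (rule lborel_pair.AE_pair)
  then show ?thesis by (simp add: AE_completion_iff)
qed

locale volterra_kernel =
  fixes \<Phi> :: "real \<Rightarrow> real \<Rightarrow> real^'k^'n"
  assumes kernel_measurable: "(\<lambda>(t, \<tau>). \<Phi> t \<tau>) \<in> borel_measurable (lebesgue_on {(t, \<tau>). t \<ge> \<tau>})"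
    and kernel_bounded: "locally_ess_bounded_on {(t, \<tau>). t \<ge> \<tau>} (\<lambda>(t, \<tau>). \<Phi> t \<tau>)"
begin

lemma closed_triangle: "closed {(t, \<tau>). t \<ge> (\<tau>::real)}"
  unfolding case_prod_beta by (intro closed_Collect_le continuous_intros)

text \<open>For almost every \<open>t\<close> the kernel and its representative agree at almost every \<open>\<tau>\<close>, which is all that the
  integrals over \<open>\<tau>\<close> can see.\<close>

lemma kernel_borel_representative:
  obtains \<Psi> where "\<Psi> \<in> borel_measurable borel"
    "AE t in lebesgue. AE \<tau> in lebesgue. \<tau> \<le> t \<longrightarrow> \<Phi> t \<tau> = \<Psi> (t, \<tau>)"
proof -
  have \<Delta>: "{(t, \<tau>). t \<ge> (\<tau>::real)} \<in> sets lebesgue"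
    using closed_triangle by (simp add: borel_closed)
  obtain \<Psi> where \<Psi>: "\<Psi> \<in> borel_measurable borel"
    "AE z in lebesgue. indicator {(t, \<tau>). t \<ge> (\<tau>::real)} z *\<^sub>R (\<lambda>(t, \<tau>). \<Phi> t \<tau>) z = \<Psi> z"
    using lebesgue_measurable_borel_representative
      kernel_measurable[unfolded measurable_lebesgue_on_indicator[OF \<Delta>]] by blast
  have "AE t in lebesgue. AE \<tau> in lebesgue.
      indicator {(t, \<tau>). t \<ge> (\<tau>::real)} (t, \<tau>) *\<^sub>R (\<lambda>(t, \<tau>). \<Phi> t \<tau>) (t, \<tau>) = \<Psi> (t, \<tau>)"
    by (rule AE_lebesgue_slices[OF \<Psi>(2)])
  then have "AE t in lebesgue. AE \<tau> in lebesgue. \<tau> \<le> t \<longrightarrow> \<Phi> t \<tau> = \<Psi> (t, \<tau>)"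
    by (auto elim!: eventually_mono simp: indicator_def)
  with \<Psi>(1) show ?thesis by (rule that)
qed

text \<open>The triangle \<open>a \<le> \<tau> \<le> s \<le> b\<close> is a compact part of the domain of the kernel, so one constant bounds almost
  all of its slices.\<close>

lemma kernel_slices_bounded:
  obtains c where "c \<ge> 0"
    "AE s in lebesgue_on {a..b}. \<Phi> s \<in> Linf {a..s} \<and> (AE \<tau> in lebesgue_on {a..s}. norm (\<Phi> s \<tau>) \<le> c)"
proof -
  define S where "S = {(t, \<tau>). a \<le> \<tau> \<and> \<tau> \<le> t \<and> t \<le> (b::real)}"
  have "closed S"
    unfolding S_def case_prod_beta by (intro closed_Collect_conj closed_Collect_le continuous_intros)
  moreover have "bounded S"
    by (rule bounded_subset[of "cbox (a, a) (b, b)"]) (auto simp: S_def)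
  ultimately have cS: "compact S" by (simp add: compact_eq_bounded_closed)
  have SD: "S \<subseteq> {(t, \<tau>). t \<ge> \<tau>}" by (auto simp: S_def)
  have Sm: "S \<in> sets lebesgue" using cS by (simp add: borel_compact)
  have "(\<lambda>(t, \<tau>). \<Phi> t \<tau>) \<in> Linf S"
    using kernel_bounded cS SD measurable_restrict_mono[OF kernel_measurable SD]
    by (auto simp: Linf_def locally_ess_bounded_on_def)
  then obtain c where c: "c \<ge> 0" "AE z in lebesgue_on S. norm ((\<lambda>(t, \<tau>). \<Phi> t \<tau>) z) \<le> c"
    by (rule LinfE)
  obtain \<Psi> where \<Psi>: "\<Psi> \<in> borel_measurable borel"
    "AE t in lebesgue. AE \<tau> in lebesgue. \<tau> \<le> t \<longrightarrow> \<Phi> t \<tau> = \<Psi> (t, \<tau>)"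
    by (rule kernel_borel_representative)
  have "AE s in lebesgue. AE \<tau> in lebesgue. (s, \<tau>) \<in> S \<longrightarrow> norm (\<Phi> s \<tau>) \<le> c"
    using AE_lebesgue_slices[OF c(2)[unfolded AE_lebesgue_on_iff[OF Sm]]] by simp
  then have "AE s in lebesgue. s \<in> {a..b} \<longrightarrow>
      \<Phi> s \<in> Linf {a..s} \<and> (AE \<tau> in lebesgue_on {a..s}. norm (\<Phi> s \<tau>) \<le> c)"
    using \<Psi>(2)
  proof eventually_elim
    case (elim s)
    show ?case
    proof
      assume s: "s \<in> {a..b}"
      have bd: "AE \<tau> in lebesgue_on {a..s}. norm (\<Phi> s \<tau>) \<le> c"
        using elim(1) s by (auto simp: AE_lebesgue_on_iff S_def elim!: eventually_mono)
      have "(\<lambda>\<tau>. \<Psi> (s, \<tau>)) \<in> borel_measurable lebesgue"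
        using \<Psi>(1) by (intro measurable_completion) (auto intro!: measurable_compose[OF _ \<Psi>(1)])
      then have "(\<lambda>\<tau>. \<Psi> (s, \<tau>)) \<in> borel_measurable (lebesgue_on {a..s})"
        by (rule measurable_restrict_space1)
      then have "\<Phi> s \<in> borel_measurable (lebesgue_on {a..s})"
        by (rule measurable_lebesgue_on_AE_cong)
          (use elim(2) in \<open>auto simp: AE_lebesgue_on_iff elim!: eventually_mono\<close>)
      then show "\<Phi> s \<in> Linf {a..s} \<and> (AE \<tau> in lebesgue_on {a..s}. norm (\<Phi> s \<tau>) \<le> c)"
        using bd by (auto intro: LinfI)
    qed
  qed
  then show ?thesis using c(1) by (intro that[of c]) (auto simp: AE_lebesgue_on_iff)
qed

lemma kernel_slices: "AE s in lebesgue_on {a..b}. \<Phi> s \<in> Linf {a..s}"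
proof -
  obtain c where "AE s in lebesgue_on {a..b}. \<Phi> s \<in> Linf {a..s} \<and> (AE \<tau> in lebesgue_on {a..s}. norm (\<Phi> s \<tau>) \<le> c)"
    by (rule kernel_slices_bounded)
  then show ?thesis by eventually_elim auto
qed

lemma slice_product_Linf:
  assumes "\<Phi> s \<in> Linf {a..s}" "w \<in> Linf {a..s}"
  shows "(\<lambda>\<tau>. \<Phi> s \<tau> *v w \<tau>) \<in> Linf {a..s}"
  using assms by (rule Linf_bilinear[OF bounded_bilinear_matrix_vector_mult])

text \<open>The value at \<open>s\<close> is an integral whose domain and integrand both depend on \<open>s\<close>; it is measurable
  in \<open>s\<close> by Fubini's theorem for Borel representatives of kernel and input.\<close>

theorem kernel_convolution_Linf:
  assumes w: "w \<in> Linf {a..b}"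
  shows "(\<lambda>s. LINT \<tau>:{a..s}|lebesgue. \<Phi> s \<tau> *v w \<tau>) \<in> Linf {a..b}"
proof -
  obtain \<Psi> where \<Psi>: "\<Psi> \<in> borel_measurable borel"
    "AE t in lebesgue. AE \<tau> in lebesgue. \<tau> \<le> t \<longrightarrow> \<Phi> t \<tau> = \<Psi> (t, \<tau>)"
    by (rule kernel_borel_representative)
  have "(\<lambda>t. indicator {a..b} t *\<^sub>R w t) \<in> borel_measurable lebesgue"
    using Linf_measurable[OF w] by (simp add: measurable_lebesgue_on_indicator)
  then obtain v where v: "v \<in> borel_measurable borel" "AE t in lebesgue. indicator {a..b} t *\<^sub>R w t = v t"
    by (rule lebesgue_measurable_borel_representative)
  obtain c where c: "c \<ge> 0"
    "AE s in lebesgue_on {a..b}. \<Phi> s \<in> Linf {a..s} \<and> (AE \<tau> in lebesgue_on {a..s}. norm (\<Phi> s \<tau>) \<le> c)"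
    by (rule kernel_slices_bounded)
  obtain d where d: "d \<ge> 0" "AE t in lebesgue_on {a..b}. norm (w t) \<le> d" using w by (rule LinfE)
  obtain K where K: "K \<ge> 0" "\<And>(Q :: real^'k^'n) x. norm (Q *v x) \<le> norm Q * norm x * K"
    using bounded_bilinear.nonneg_bounded[OF bounded_bilinear_matrix_vector_mult] by blast
  define H where "H = (\<lambda>s \<tau>. indicator {z. a \<le> snd z \<and> snd z \<le> fst z} (s, \<tau>) *\<^sub>R (\<Psi> (s, \<tau>) *v v \<tau>))"
  have mv: "(\<lambda>z. \<Psi> z *v v (snd z)) \<in> borel_measurable (lborel \<Otimes>\<^sub>M lborel :: (real \<times> real) measure)"
  proof (rule borel_measurable_continuous_Pair[where H="(*v)" and f=\<Psi> and g="\<lambda>z. v (snd z)"])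
    show "\<Psi> \<in> borel_measurable (lborel \<Otimes>\<^sub>M lborel)" using \<Psi>(1) by (simp add: lborel_prod)
    show "(\<lambda>z. v (snd z)) \<in> borel_measurable (lborel \<Otimes>\<^sub>M lborel :: (real \<times> real) measure)"
      using v(1) by (intro measurable_compose[OF measurable_snd]) auto
    show "continuous_on UNIV (\<lambda>z. fst z *v snd z :: real^'n)"
      by (intro bounded_bilinear.continuous_on[OF bounded_bilinear_matrix_vector_mult] continuous_intros)
  qed
  have "closed {z::real \<times> real. a \<le> snd z \<and> snd z \<le> fst z}"
    by (intro closed_Collect_conj closed_Collect_le continuous_intros)
  then have triangle: "{z::real \<times> real. a \<le> snd z \<and> snd z \<le> fst z} \<in> sets (lborel \<Otimes>\<^sub>M lborel)"
    unfolding lborel_prod by (simp add: borel_closed)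
  have "case_prod H = (\<lambda>z. indicator {z. a \<le> snd z \<and> snd z \<le> fst z} z *\<^sub>R (\<Psi> z *v v (snd z)))"
    by (auto simp: H_def fun_eq_iff)
  then have H: "case_prod H \<in> borel_measurable (lborel \<Otimes>\<^sub>M lborel)"
    by (simp only:) (intro borel_measurable_scaleR borel_measurable_indicator mv triangle)

  have meas: "(\<lambda>s. \<integral>\<tau>. H s \<tau> \<partial>lborel) \<in> borel_measurable lborel"
    by (rule lborel.borel_measurable_lebesgue_integral[OF H])
  have Hs: "H s \<in> borel_measurable lborel" for s
    using measurable_Pair2[OF H, of s] by simp
  have ae: "AE s in lebesgue_on {a..b}. (\<integral>\<tau>. H s \<tau> \<partial>lborel) = (LINT \<tau>:{a..s}|lebesgue. \<Phi> s \<tau> *v w \<tau>)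
      \<and> norm (LINT \<tau>:{a..s}|lebesgue. \<Phi> s \<tau> *v w \<tau>) \<le> (c * d * K) * (b - a)"
  proof -
    have "AE s in lebesgue_on {a..b}. AE \<tau> in lebesgue. \<tau> \<le> s \<longrightarrow> \<Phi> s \<tau> = \<Psi> (s, \<tau>)"
      using \<Psi>(2) by (subst AE_lebesgue_on_iff) (simp, rule eventually_mono, auto)
    moreover have "AE s in lebesgue_on {a..b}. s \<in> {a..b}" by (rule AE_Icc_mem)
    ultimately show ?thesis using c(2)
    proof eventually_elim
      case (elim s)
      have ws: "w \<in> Linf {a..s}" using elim by (intro Linf_Icc_mono[OF w]) auto
      have pr: "(\<lambda>\<tau>. \<Phi> s \<tau> *v w \<tau>) \<in> Linf {a..s}" using slice_product_Linf elim ws by auto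
      have "AE \<tau> in lebesgue. H s \<tau> = indicator {a..s} \<tau> *\<^sub>R (\<Phi> s \<tau> *v w \<tau>)"
        using elim(1) v(2)
      proof eventually_elim
        case (elim \<tau>)
        then show ?case using \<open>s \<in> {a..b}\<close> by (auto simp: H_def indicator_def split: if_splits)
      qed
      then have "(\<integral>\<tau>. H s \<tau> \<partial>lebesgue) = (LINT \<tau>:{a..s}|lebesgue. \<Phi> s \<tau> *v w \<tau>)"
        unfolding set_lebesgue_integral_def using Linf_measurable[OF pr] measurable_completion[OF Hs[of s]]
        by (intro integral_cong_AE) (simp_all add: measurable_lebesgue_on_indicator)
      moreover have "(\<integral>\<tau>. H s \<tau> \<partial>lebesgue) = (\<integral>\<tau>. H s \<tau> \<partial>lborel)"
        by (rule integral_completion[OF Hs])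
      moreover have "norm (LINT \<tau>:{a..s}|lebesgue. \<Phi> s \<tau> *v w \<tau>) \<le> (c * d * K) * (s - a)"
      proof (rule norm_LINT_le_const[OF pr])
        have "AE \<tau> in lebesgue_on {a..s}. norm (w \<tau>) \<le> d"
          using elim by (intro AE_lebesgue_on_mono[OF d(2)]) auto
        then show "AE \<tau> in lebesgue_on {a..s}. norm (\<Phi> s \<tau> *v w \<tau>) \<le> c * d * K"
          using conjunct2[OF elim(3)]
        proof eventually_elim
          case (elim \<tau>)
          have "norm (\<Phi> s \<tau> *v w \<tau>) \<le> norm (\<Phi> s \<tau>) * norm (w \<tau>) * K" by (rule K)
          also have "\<dots> \<le> c * d * K" using elim K c d by (intro mult_right_mono mult_mono) auto
          finally show ?case .
        qed
      qed (use elim in auto)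
      moreover have "(c * d * K) * (s - a) \<le> (c * d * K) * (b - a)"
        using elim c d K by (intro mult_left_mono) auto
      ultimately show ?case by (metis order_trans)
    qed
  qed
  have "(\<lambda>s. \<integral>\<tau>. H s \<tau> \<partial>lborel) \<in> borel_measurable (lebesgue_on {a..b})"
    by (intro measurable_restrict_space1 measurable_completion[OF meas])
  then have "(\<lambda>s. LINT \<tau>:{a..s}|lebesgue. \<Phi> s \<tau> *v w \<tau>) \<in> borel_measurable (lebesgue_on {a..b})"
    by (rule measurable_lebesgue_on_AE_cong) (use ae in \<open>auto elim: eventually_mono\<close>)
  then show ?thesis
    by (rule LinfI) (use ae in \<open>auto elim: eventually_mono\<close>)
qed

end

section \<open>Causal Lipschitz integral equations\<close>

text \<open>Equations \<open>x t = x0 + integral {a..t} (F x)\<close> in which \<open>F x s\<close> depends only on the past of \<open>x\<close>. The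
  Lipschitz condition compares with the supremum over the past instead of with the present value, as a
  memory term requires.\<close>

locale causal_lipschitz =
  fixes F :: "(real \<Rightarrow> 'a::euclidean_space) \<Rightarrow> real \<Rightarrow> 'a" and a b L :: real and x0 :: 'a
  assumes ab: "a \<le> b" and L: "L \<ge> 0"
    and F_Linf: "\<And>x. continuous_on {a..b} x \<Longrightarrow> F x \<in> Linf {a..b}"
    and F_lipschitz: "\<And>x z. continuous_on {a..b} x \<Longrightarrow> continuous_on {a..b} z \<Longrightarrow>
      AE s in lebesgue_on {a..b}. \<forall>d. (\<forall>r\<in>{a..s}. norm (x r - z r) \<le> d) \<longrightarrow> norm (F x s - F z s) \<le> L * d"
begin

text \<open>Curves on \<^term>\<open>{a..b}\<close> are stored as bounded continuous functions on the whole line, constant outside the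
  interval and damped by \<open>exp (- rate * (t - a))\<close>. In this weighted supremum norm the Picard operator is
  a contraction on the entire interval, however long.\<close>

definition "rate = 2 * L + 1"
definition "clip t = max a (min b t)"
definition "unweight z t = exp (rate * (t - a)) *\<^sub>R (apply_bcontfun z t :: 'a)"
definition "weighted x t = exp (- rate * (clip t - a)) *\<^sub>R (x (clip t) :: 'a)"
definition "picard x t = x0 + integral {a..t} (F x)"
definition "weighted_picard z = Bcontfun (weighted (picard (unweight z)))"

lemma rate_pos: "rate > 0" using L by (simp add: rate_def)

lemma clip_in: "clip t \<in> {a..b}" using ab by (auto simp: clip_def)

lemma clip_id: "t \<in> {a..b} \<Longrightarrow> clip t = t" by (auto simp: clip_def)

lemma F_integrable:
  assumes "continuous_on {a..b} x" "t \<in> {a..b}"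
  shows "F x integrable_on {a..t}"
  using Linf_Icc_mono[OF F_Linf[OF assms(1)], of a t] assms(2) by (intro Linf_integrable_on_Icc) auto

lemma continuous_unweight: "continuous_on S (unweight z)"
  unfolding unweight_def by (intro continuous_intros continuous_on_apply_bcontfun)

lemma continuous_picard:
  assumes "continuous_on {a..b} x"
  shows "continuous_on {a..b} (picard x)"
  unfolding picard_def using F_integrable[OF assms, of b] ab
  by (intro continuous_intros indefinite_integral_continuous_1) auto

lemma weighted_bcontfun:
  assumes x: "continuous_on {a..b} x"
  shows "weighted x \<in> bcontfun"
proof -
  have g: "continuous_on {a..b} (\<lambda>t. exp (- rate * (t - a)) *\<^sub>R x t)"
    by (intro continuous_intros x)
  have "continuous_on UNIV (\<lambda>t. exp (- rate * (clip t - a)) *\<^sub>R x (clip t))"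
    by (rule continuous_on_compose2[OF g]) (auto simp: clip_def intro!: continuous_intros clip_in[unfolded clip_def] ab)
  moreover have "bounded (range (weighted x))"
  proof (rule bounded_subset)
    show "bounded ((\<lambda>t. exp (- rate * (t - a)) *\<^sub>R x t) ` {a..b})"
      by (intro compact_imp_bounded compact_continuous_image g) auto
    show "range (weighted x) \<subseteq> (\<lambda>t. exp (- rate * (t - a)) *\<^sub>R x t) ` {a..b}"
      using clip_in by (auto simp: weighted_def)
  qed
  ultimately show ?thesis by (simp add: bcontfun_def weighted_def)
qed

lemma apply_weighted:
  "continuous_on {a..b} x \<Longrightarrow> apply_bcontfun (Bcontfun (weighted x)) = weighted x"
  by (rule Bcontfun_inverse[OF weighted_bcontfun])

lemma unweight_weighted:
  assumes "continuous_on {a..b} x" "t \<in> {a..b}"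
  shows "unweight (Bcontfun (weighted x)) t = x t"
  using assms by (simp add: unweight_def apply_weighted weighted_def clip_id exp_minus)

text \<open>The integral of \<open>L * exp (rate * (s - a))\<close> over \<^term>\<open>{a..t}\<close> is at most \<open>L / rate\<close> times the weight at \<open>t\<close>, and
  \<open>L / rate \<le> 1 / 2\<close>.\<close>

lemma weighted_picard_contraction:
  "dist (weighted_picard z) (weighted_picard z') \<le> 1 / 2 * dist z z'"
proof (rule dist_bound)
  fix t
  define D where "D = dist z z'"
  define c where "c = clip t"
  have c: "c \<in> {a..b}" unfolding c_def by (rule clip_in)
  let ?x = "unweight z" and ?x' = "unweight z'"
  have int: "F ?x integrable_on {a..c}" "F ?x' integrable_on {a..c}"
    using c by (auto intro: F_integrable continuous_unweight)
  have "norm (integral {a..c} (\<lambda>s. F ?x s - F ?x' s)) \<le> integral {a..c} (\<lambda>s. L * (exp (rate * (s - a)) * D))"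
  proof (rule norm_integral_le_AE)
    show "(\<lambda>s. F ?x s - F ?x' s) integrable_on {a..c}" using int by (rule integrable_diff)
    show "(\<lambda>s. L * (exp (rate * (s - a)) * D)) integrable_on {a..c}"
      by (intro integrable_continuous_interval continuous_intros)
    have "AE s in lebesgue_on {a..c}. \<forall>d. (\<forall>r\<in>{a..s}. norm (?x r - ?x' r) \<le> d) \<longrightarrow> norm (F ?x s - F ?x' s) \<le> L * d"
      using c by (intro AE_lebesgue_on_mono[OF F_lipschitz] continuous_unweight) auto
    then show "AE s in lebesgue_on {a..c}. norm (F ?x s - F ?x' s) \<le> L * (exp (rate * (s - a)) * D)"
    proof eventually_elim
      case (elim s)
      have "norm (?x r - ?x' r) \<le> exp (rate * (s - a)) * D" if "r \<in> {a..s}" for r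
      proof -
        have "norm (?x r - ?x' r) = exp (rate * (r - a)) * dist (z r) (z' r)"
          by (simp add: unweight_def dist_norm scaleR_diff_right[symmetric])
        also have "\<dots> \<le> exp (rate * (s - a)) * D"
          using that rate_pos unfolding D_def by (intro mult_mono dist_bounded) auto
        finally show ?thesis .
      qed
      then show ?case using elim by blast
    qed
  qed auto
  also have "integral {a..c} (\<lambda>s. L * (exp (rate * (s - a)) * D))
      = L * D * exp (rate * (c - a)) / rate - L * D * exp (rate * (a - a)) / rate"
  proof (rule integral_unique, rule fundamental_theorem_of_calculus)
    fix s assume "s \<in> {a..c}"
    show "((\<lambda>s. L * D * exp (rate * (s - a)) / rate) has_vector_derivative L * (exp (rate * (s - a)) * D)) (at s within {a..c})"
      using rate_pos by (auto intro!: derivative_eq_intros simp: has_real_derivative_iff_has_vector_derivative[symmetric])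
  qed (use c in auto)
  also have "\<dots> \<le> exp (rate * (c - a)) * (L * D / rate)"
    using rate_pos L by (simp add: D_def mult.commute)
  finally have bound: "norm (integral {a..c} (\<lambda>s. F ?x s - F ?x' s)) \<le> exp (rate * (c - a)) * (L * D / rate)" .
  have "dist (weighted_picard z t) (weighted_picard z' t)
      = exp (- rate * (c - a)) * norm (integral {a..c} (\<lambda>s. F ?x s - F ?x' s))"
    using int by (simp add: weighted_picard_def apply_weighted[OF continuous_picard[OF continuous_unweight]]
        weighted_def c_def[symmetric] dist_norm scaleR_diff_right[symmetric] picard_def
        Henstock_Kurzweil_Integration.integral_diff)
  also have "\<dots> \<le> exp (- rate * (c - a)) * (exp (rate * (c - a)) * (L * D / rate))"
    using bound by (intro mult_left_mono) auto
  also have "\<dots> = L * D / rate" by (simp add: exp_minus)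
  also have "\<dots> \<le> 1 / 2 * D"
  proof -
    have "L * D * 2 \<le> D * rate" using L by (simp add: rate_def D_def algebra_simps)
    then show ?thesis using rate_pos by (simp add: field_simps)
  qed
  finally show "dist (weighted_picard z t) (weighted_picard z' t) \<le> 1 / 2 * dist z z'" by (simp add: D_def)
qed

lemma ex1_fixpoint: "\<exists>!z. weighted_picard z = z"
  using weighted_picard_contraction by (intro banach_fix_type[of "1/2"]) auto

theorem solution_exists:
  obtains x where "continuous_on {a..b} x" "\<And>t. t \<in> {a..b} \<Longrightarrow> x t = x0 + integral {a..t} (F x)"
proof -
  obtain z where z: "weighted_picard z = z" using ex1_fixpoint by auto
  show ?thesis
  proof (rule that)
    show "continuous_on {a..b} (unweight z)" by (rule continuous_unweight)
    fix t assume t: "t \<in> {a..b}"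
    have "unweight z t = unweight (weighted_picard z) t" by (simp add: z)
    also have "\<dots> = picard (unweight z) t"
      unfolding weighted_picard_def by (rule unweight_weighted[OF continuous_picard[OF continuous_unweight] t])
    finally show "unweight z t = x0 + integral {a..t} (F (unweight z))" by (simp add: picard_def)
  qed
qed

lemma solution_is_fixpoint:
  assumes x: "continuous_on {a..b} x" and eq: "\<And>t. t \<in> {a..b} \<Longrightarrow> x t = x0 + integral {a..t} (F x)"
  shows "weighted_picard (Bcontfun (weighted x)) = Bcontfun (weighted x)"
proof -
  let ?y = "unweight (Bcontfun (weighted x))"
  have y: "continuous_on {a..b} ?y" by (rule continuous_unweight)
  have ae: "AE s in lebesgue_on {a..b}. F x s = F ?y s"
  proof -
    have "AE s in lebesgue_on {a..b}. s \<in> {a..b}" by (rule AE_Icc_mem)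
    with F_lipschitz[OF x y] show ?thesis
    proof eventually_elim
      case (elim s)
      have "\<forall>r\<in>{a..s}. norm (x r - ?y r) \<le> 0" using elim(2) unweight_weighted[OF x] by auto
      then have "norm (F x s - F ?y s) \<le> L * 0" using elim(1) by blast
      then show ?case by simp
    qed
  qed
  have "picard ?y t = x t" if t: "t \<in> {a..b}" for t
  proof -
    have "integral {a..t} (F ?y) = integral {a..t} (F x)"
      using t by (intro integral_cong_AE_Icc[OF ae, symmetric]) auto
    then show ?thesis using eq[OF t] by (simp add: picard_def)
  qed
  then have "weighted (picard ?y) = weighted x"
    using clip_in by (auto simp: weighted_def fun_eq_iff)
  then show ?thesis by (simp add: weighted_picard_def)
qed

theorem solution_unique:
  assumes "continuous_on {a..b} x" "\<And>t. t \<in> {a..b} \<Longrightarrow> x t = x0 + integral {a..t} (F x)"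
    and "continuous_on {a..b} z" "\<And>t. t \<in> {a..b} \<Longrightarrow> z t = x0 + integral {a..t} (F z)"
    and t: "t \<in> {a..b}"
  shows "x t = z t"
proof -
  have "Bcontfun (weighted x) = Bcontfun (weighted z)"
    using ex1_fixpoint solution_is_fixpoint[OF assms(1,2)] solution_is_fixpoint[OF assms(3,4)] by blast
  then show ?thesis
    using unweight_weighted[OF assms(1) t] unweight_weighted[OF assms(3) t] by simp
qed

end

section \<open>Norms weighted by a positive definite matrix\<close>

lemma Linf_continuous_image:
  fixes f :: "'a::euclidean_space \<Rightarrow> 'b::euclidean_space" and h :: "'b \<Rightarrow> 'c::euclidean_space"
  assumes f: "f \<in> Linf S" and h: "continuous_on UNIV h"
  shows "(\<lambda>x. h (f x)) \<in> Linf S"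
proof -
  obtain c where c: "AE x in lebesgue_on S. norm (f x) \<le> c" using f by (rule LinfE)
  have "bounded (h ` cball 0 c)"
    by (intro compact_imp_bounded compact_continuous_image continuous_on_subset[OF h]) auto
  then obtain d where "\<forall>z \<in> h ` cball 0 c. norm z \<le> d" unfolding bounded_iff by blast
  then have d: "\<And>y. norm y \<le> c \<Longrightarrow> norm (h y) \<le> d" by auto
  show ?thesis
  proof (rule LinfI)
    show "(\<lambda>x. h (f x)) \<in> borel_measurable (lebesgue_on S)"
      by (rule borel_measurable_continuous_on[OF h Linf_measurable[OF f]])
    show "AE x in lebesgue_on S. norm (h (f x)) \<le> d"
      using c by eventually_elim (rule d)
  qed
qed

locale weighted_space =
  fixes P :: "real^'m^'m"
  assumes pos_definite: "pos_definite P"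
begin

abbreviation "N \<equiv> weighted_norm P"

lemma form_commute: "y \<bullet> (P *v z) = z \<bullet> (P *v y)"
proof -
  have "y \<bullet> (P *v z) = (transpose P *v y) \<bullet> z" by (simp add: dot_lmul_matrix transpose_matrix_vector)
  also have "\<dots> = z \<bullet> (P *v y)" using pos_definite by (simp add: pos_definite_def inner_commute)
  finally show ?thesis .
qed

lemma form_nonneg: "0 \<le> y \<bullet> (P *v y)"
  using pos_definite by (cases "y = 0") (auto simp: pos_definite_def less_imp_le)

lemma weighted_norm_sq: "N y * N y = y \<bullet> (P *v y)"
  using form_nonneg by (simp add: weighted_norm_def)

lemma weighted_norm_nonneg [simp]: "0 \<le> N y"
  using form_nonneg by (simp add: weighted_norm_def)

lemma weighted_norm_eq_0 [simp]: "N y = 0 \<longleftrightarrow> y = 0"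
  using pos_definite by (auto simp: weighted_norm_def pos_definite_def)

lemma weighted_norm_0 [simp]: "N 0 = 0" by simp

lemma weighted_norm_pos [simp]: "0 < N y \<longleftrightarrow> y \<noteq> 0"
  using weighted_norm_nonneg[of y] weighted_norm_eq_0[of y] by linarith

lemma weighted_norm_scaleR [simp]: "N (c *\<^sub>R y) = \<bar>c\<bar> * N y"
  by (simp add: weighted_norm_def matrix_vector_mult_scaleR real_sqrt_mult mult.assoc[symmetric]
      flip: power2_eq_square)

lemma weighted_norm_minus [simp]: "N (- y) = N y"
  using weighted_norm_scaleR[of "-1" y] by simp

text \<open>Evaluate the positive form at \<open>N z *\<^sub>R y - N y *\<^sub>R z\<close>.\<close>

lemma weighted_Cauchy_Schwarz: "y \<bullet> (P *v z) \<le> N y * N z"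
proof (cases "y = 0 \<or> z = 0")
  case True
  then show ?thesis by auto
next
  case False
  let ?a = "N y" and ?b = "N z"
  have "0 \<le> (?b *\<^sub>R y - ?a *\<^sub>R z) \<bullet> (P *v (?b *\<^sub>R y - ?a *\<^sub>R z))" by (rule form_nonneg)
  also have "\<dots> = ?b * ?b * (y \<bullet> (P *v y)) - 2 * (?a * ?b) * (y \<bullet> (P *v z)) + ?a * ?a * (z \<bullet> (P *v z))"
    using form_commute[of z y]
    by (simp add: matrix_vector_mult_diff_distrib matrix_vector_mult_scaleR inner_diff_left inner_diff_right algebra_simps)
  also have "\<dots> = 2 * (?a * ?b) * (?a * ?b - y \<bullet> (P *v z))"
    by (simp add: weighted_norm_sq[symmetric] algebra_simps)
  finally have "0 \<le> 2 * (?a * ?b) * (?a * ?b - y \<bullet> (P *v z))" .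
  moreover have "0 < 2 * (?a * ?b)" using False by simp
  ultimately show ?thesis by (simp add: zero_le_mult_iff)
qed

lemma weighted_norm_triangle: "N (y + z) \<le> N y + N z"
proof (rule power2_le_imp_le)
  have "(N (y + z))\<^sup>2 = y \<bullet> (P *v y) + 2 * (y \<bullet> (P *v z)) + z \<bullet> (P *v z)"
    using form_commute[of z y] weighted_norm_sq[of "y + z"]
    by (simp add: power2_eq_square matrix_vector_right_distrib inner_add_left inner_add_right)
  also have "\<dots> \<le> N y * N y + 2 * (N y * N z) + N z * N z"
    using weighted_Cauchy_Schwarz[of y z] by (simp add: weighted_norm_sq)
  finally show "(N (y + z))\<^sup>2 \<le> (N y + N z)\<^sup>2" by (simp add: power2_eq_square algebra_simps)
qed simp

lemma weighted_norm_diff: "\<bar>N y - N z\<bar> \<le> N (y - z)"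
  using weighted_norm_triangle[of "y - z" z] weighted_norm_triangle[of "z - y" y]
    weighted_norm_minus[of "y - z"] by simp

lemma weighted_norm_le_norm: obtains K where "K > 0" "\<And>y. N y \<le> K * norm y"
proof -
  obtain K where K: "K > 0" "\<And>y. norm (P *v y) \<le> norm y * K"
    using bounded_linear.pos_bounded[OF matrix_vector_mul_bounded_linear[of P]] by blast
  have "N y \<le> sqrt K * norm y" for y
  proof -
    have "y \<bullet> (P *v y) \<le> norm y * norm (P *v y)" by (rule norm_cauchy_schwarz)
    also have "\<dots> \<le> norm y * (norm y * K)" using K by (intro mult_left_mono) auto
    finally have "N y \<le> sqrt (norm y * (norm y * K))" unfolding weighted_norm_def by simp
    also have "\<dots> = sqrt K * norm y" by (simp add: real_sqrt_mult mult.assoc[symmetric])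
    finally show ?thesis .
  qed
  then show ?thesis using that[of "sqrt K"] K by auto
qed

lemma continuous_weighted_norm: "continuous_on S N"
  unfolding weighted_norm_def by (intro continuous_intros)

lemma norm_le_weighted_norm: obtains c where "c > 0" "\<And>y. norm y \<le> c * N y"
proof -
  have "sphere 0 1 \<noteq> ({} :: (real^'m) set)" by simp
  then obtain y0 where y0: "norm y0 = 1" "\<And>y. norm y = 1 \<Longrightarrow> N y0 \<le> N y"
    using continuous_attains_inf[OF compact_sphere _ continuous_weighted_norm, of 0 1] by auto
  have pos: "N y0 > 0" using y0(1) by auto
  have "norm y \<le> (1 / N y0) * N y" for y
  proof (cases "y = 0")
    case False
    then have "N y0 \<le> N ((1 / norm y) *\<^sub>R y)" by (intro y0) simp
    also have "\<dots> = N y / norm y" by (subst weighted_norm_scaleR) simp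
    finally show ?thesis using False pos by (simp add: field_simps)
  qed simp
  then show ?thesis using that[of "1 / N y0"] pos by auto
qed

lemma Linf_weighted_norm: "f \<in> Linf S \<Longrightarrow> (\<lambda>x. N (f x)) \<in> Linf S"
  by (rule Linf_continuous_image[OF _ continuous_weighted_norm])

text \<open>The triangle inequality for integrals follows by duality: test the integral against itself
  and use the Cauchy--Schwarz inequality under the integral sign.\<close>

lemma weighted_norm_LINT_le:
  fixes f :: "real \<Rightarrow> real^'m"
  assumes f: "f \<in> Linf {a..b}"
  shows "N (LINT t:{a..b}|lebesgue. f t) \<le> (LINT t:{a..b}|lebesgue. N (f t))"
proof (cases "(LINT t:{a..b}|lebesgue. f t) = 0")
  case True
  then show ?thesis
    by (simp add: set_lebesgue_integral_def integral_nonneg_AE)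
next
  case False
  define z where "z = (LINT t:{a..b}|lebesgue. f t)"
  have bl: "bounded_linear (\<lambda>v. v \<bullet> (P *v z))" by (rule bounded_linear_inner_left)
  have bl': "bounded_linear (\<lambda>r. r * N z)" by (rule bounded_linear_mult_left)
  have "N z * N z = (LINT t:{a..b}|lebesgue. f t) \<bullet> (P *v z)" by (simp add: weighted_norm_sq z_def)
  also have "\<dots> = (LINT t:{a..b}|lebesgue. f t \<bullet> (P *v z))"
    by (rule LINT_bounded_linear[OF f bl, symmetric])
  also have "\<dots> \<le> (LINT t:{a..b}|lebesgue. N (f t) * N z)"
    using f by (intro LINT_mono_AE Linf_bounded_linear_image[OF bl] Linf_bounded_linear_image[OF bl']
        Linf_weighted_norm) (auto intro: weighted_Cauchy_Schwarz)
  also have "\<dots> = (LINT t:{a..b}|lebesgue. N (f t)) * N z"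
    by (rule LINT_bounded_linear[OF Linf_weighted_norm[OF f] bl'])
  finally show ?thesis using False by (simp add: z_def)
qed

lemma weighted_quotient_bounded:
  obtains K where "K \<ge> 0" "\<And>Q y. y \<noteq> 0 \<Longrightarrow> N (Q *v y) / N y \<le> K * norm Q"
proof -
  obtain K where K: "K > 0" "\<And>y. N y \<le> K * norm y" by (rule weighted_norm_le_norm) (blast intro: that)+
  obtain c where c: "c > 0" "\<And>y. norm y \<le> c * N y" by (rule norm_le_weighted_norm) (blast intro: that)+
  obtain k where k: "k \<ge> 0" "\<And>(Q :: real^'m^'m) x. norm (Q *v x) \<le> norm Q * norm x * k"
    using bounded_bilinear.nonneg_bounded[OF bounded_bilinear_matrix_vector_mult] by blast
  have "N (Q *v y) / N y \<le> (K * k * c) * norm Q" if "y \<noteq> 0" for Q y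
  proof -
    have "N (Q *v y) \<le> K * norm (Q *v y)" by (rule K)
    also have "\<dots> \<le> K * (norm Q * norm y * k)" using K k by (intro mult_left_mono) auto
    also have "\<dots> \<le> K * (norm Q * (c * N y) * k)"
      using K k c by (intro mult_left_mono mult_right_mono) auto
    finally show ?thesis using that by (simp add: field_simps)
  qed
  then show ?thesis using that[of "K * k * c"] K k c by auto
qed

lemma weighted_onorm_bdd: "bdd_above ((\<lambda>y. N (Q *v y) / N y) ` (- {0}))"
proof -
  obtain K where "\<And>Q y. y \<noteq> 0 \<Longrightarrow> N (Q *v y) / N y \<le> K * norm Q" by (rule weighted_quotient_bounded) (blast intro: that)+
  then show ?thesis by (intro bdd_aboveI[of _ "K * norm Q"]) auto
qed

lemma nonzero_vector_exists: "- {0} \<noteq> ({} :: (real^'m) set)"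
  using nonzero_Basis SOME_Basis by auto

lemma weighted_norm_mult_le: "N (Q *v y) \<le> weighted_onorm P Q * N y"
proof (cases "y = 0")
  case False
  have "N (Q *v y) / N y \<le> weighted_onorm P Q"
    unfolding weighted_onorm_def using False by (intro cSUP_upper weighted_onorm_bdd) auto
  then show ?thesis using False by (simp add: field_simps)
qed simp

lemma weighted_onorm_nonneg: "0 \<le> weighted_onorm P Q"
proof -
  obtain y :: "real^'m" where y: "y \<noteq> 0" using nonzero_vector_exists by auto
  have "0 \<le> N (Q *v y) / N y" by simp
  also have "\<dots> \<le> weighted_onorm P Q"
    unfolding weighted_onorm_def using y by (intro cSUP_upper weighted_onorm_bdd) auto
  finally show ?thesis .
qed

lemma weighted_onorm_leI:
  assumes "\<And>y. N (Q *v y) \<le> c * N y"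
  shows "weighted_onorm P Q \<le> c"
  unfolding weighted_onorm_def
  by (intro cSUP_least nonzero_vector_exists) (use assms in \<open>auto simp: field_simps\<close>)

lemma weighted_onorm_triangle: "weighted_onorm P (Q + R) \<le> weighted_onorm P Q + weighted_onorm P R"
proof (rule weighted_onorm_leI)
  fix y
  have "N ((Q + R) *v y) \<le> N (Q *v y) + N (R *v y)"
    by (simp add: matrix_vector_mult_add_rdistrib weighted_norm_triangle)
  also have "\<dots> \<le> (weighted_onorm P Q + weighted_onorm P R) * N y"
    using weighted_norm_mult_le[of Q y] weighted_norm_mult_le[of R y] by (simp add: distrib_right)
  finally show "N ((Q + R) *v y) \<le> (weighted_onorm P Q + weighted_onorm P R) * N y" .
qed

text \<open>Continuity makes the operator norm of a measurable kernel measurable, so that the integral in the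
  smallness condition is one to which monotonicity applies.\<close>

lemma continuous_weighted_onorm: "continuous_on UNIV (weighted_onorm P)"
proof -
  obtain K where K: "K \<ge> 0" "\<And>Q y. y \<noteq> 0 \<Longrightarrow> N (Q *v y) / N y \<le> K * norm Q"
    by (rule weighted_quotient_bounded) (blast intro: that)+
  have le: "weighted_onorm P Q \<le> K * norm Q" for Q
    unfolding weighted_onorm_def using K by (intro cSUP_least nonzero_vector_exists) auto
  have "K-lipschitz_on UNIV (weighted_onorm P)"
  proof (rule lipschitz_onI)
    fix Q R
    have "weighted_onorm P Q \<le> weighted_onorm P R + K * norm (Q - R)"
      using weighted_onorm_triangle[of R "Q - R"] le[of "Q - R"] by simp
    moreover have "weighted_onorm P R \<le> weighted_onorm P Q + K * norm (Q - R)"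
      using weighted_onorm_triangle[of Q "R - Q"] le[of "R - Q"] by (simp add: norm_minus_commute)
    ultimately show "dist (weighted_onorm P Q) (weighted_onorm P R) \<le> K * dist Q R"
      by (auto simp: dist_norm abs_le_iff)
  qed (rule K)
  then show ?thesis by (rule lipschitz_on_continuous_on)
qed

lemma weighted_norm_has_vector_derivative:
  assumes y: "(y has_vector_derivative y') (at t)" and nz: "y t \<noteq> 0"
  shows "((\<lambda>s. N (y s)) has_vector_derivative (y t \<bullet> (P *v y')) / N (y t)) (at t)"
proof -
  have Py: "((\<lambda>s. P *v y s) has_vector_derivative P *v y') (at t)"
    by (rule bounded_linear.has_vector_derivative[OF matrix_vector_mul_bounded_linear y])
  have "((\<lambda>s. y s \<bullet> (P *v y s)) has_vector_derivative (y t \<bullet> (P *v y') + y' \<bullet> (P *v y t))) (at t)"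
    by (rule bounded_bilinear.has_vector_derivative[OF bounded_bilinear_inner y Py])
  then have "((\<lambda>s. y s \<bullet> (P *v y s)) has_real_derivative 2 * (y t \<bullet> (P *v y'))) (at t)"
    by (simp add: has_real_derivative_iff_has_vector_derivative form_commute[of y' "y t"])
  moreover have "0 < y t \<bullet> (P *v y t)" using pos_definite nz by (simp add: pos_definite_def)
  ultimately have "((\<lambda>s. sqrt (y s \<bullet> (P *v y s))) has_real_derivative
      inverse (sqrt (y t \<bullet> (P *v y t))) / 2 * (2 * (y t \<bullet> (P *v y')))) (at t)"
    by (intro DERIV_chain2[OF DERIV_real_sqrt])
  moreover have "inverse (sqrt (y t \<bullet> (P *v y t))) / 2 * (2 * (y t \<bullet> (P *v y'))) = (y t \<bullet> (P *v y')) / sqrt (y t \<bullet> (P *v y t))"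
    by (simp add: field_simps)
  ultimately show ?thesis
    unfolding weighted_norm_def by (simp only: has_real_derivative_iff_has_vector_derivative)
qed

end

section \<open>Filippov regularization of the relay feedback\<close>

lemma matrix_inv_cancel:
  fixes Q :: "real^'m^'m"
  assumes "det Q \<noteq> 0"
  shows "Q ** matrix_inv Q = mat 1" "matrix_inv Q ** Q = mat 1"
proof -
  have "\<exists>R. Q ** R = mat 1 \<and> R ** Q = mat 1"
    using assms by (simp add: invertible_det_nz[symmetric] invertible_def)
  then have "Q ** matrix_inv Q = mat 1 \<and> matrix_inv Q ** Q = mat 1"
    unfolding matrix_inv_def by (rule someI_ex)
  then show "Q ** matrix_inv Q = mat 1" "matrix_inv Q ** Q = mat 1" by auto
qed

lemma ball_minus_null_set_nonempty:
  fixes x :: "'a::euclidean_space"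
  assumes "d > 0" "N \<in> null_sets lebesgue"
  obtains z where "z \<in> ball x d" "z \<notin> N"
proof -
  have "negligible N" using assms(2) by (simp add: negligible_iff_null_sets)
  moreover have "\<not> negligible (ball x d)" using assms(1) by (intro open_not_negligible) auto
  ultimately have "\<not> ball x d \<subseteq> N" using negligible_subset by blast
  then show ?thesis using that by blast
qed

text \<open>Removing a null set from a neighbourhood of \<open>z\<close> leaves points arbitrarily close to \<open>z\<close>, and at these
  the values of \<open>g\<close> approach \<open>g z\<close>.\<close>

lemma filippov_contains_continuity_value:
  fixes g :: "real^'n \<Rightarrow> real^'m"
  assumes g: "isCont g z" and z: "z \<in> ball x \<delta>" and N: "N \<in> null_sets lebesgue"
  shows "g z \<in> closure (convex hull (g ` (ball x \<delta> - N)))"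
proof -
  have "g z \<in> closure (g ` (ball x \<delta> - N))"
    unfolding closure_approachable
  proof (intro allI impI)
    fix e :: real assume e: "e > 0"
    obtain d where d: "d > 0" "\<And>w. dist w z < d \<Longrightarrow> dist (g w) (g z) < e"
      using g e unfolding continuous_at_eps_delta by blast
    have pos: "min d (\<delta> - dist x z) > 0" using d z by auto
    obtain w where w: "w \<in> ball z (min d (\<delta> - dist x z))" "w \<notin> N"
      using ball_minus_null_set_nonempty[OF pos N] by blast
    have "dist x w \<le> dist x z + dist z w" by (rule dist_triangle)
    then have "w \<in> ball x \<delta> - N" using w by auto
    moreover have "dist (g w) (g z) < e" using w by (intro d) (auto simp: dist_commute)
    ultimately show "\<exists>y\<in>g ` (ball x \<delta> - N). dist y (g z) < e" by blast
  qed
  then show ?thesis using closure_mono[OF hull_subset] by blast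
qed

lemma filippov_subset:
  assumes "\<delta> > 0" "g ` ball x \<delta> \<subseteq> S" "closed S" "convex S"
  shows "filippov g x \<subseteq> S"
proof -
  have "filippov g x \<subseteq> closure (convex hull (g ` (ball x \<delta> - {})))"
    unfolding filippov_def using assms(1) by (intro INF_lower2[of \<delta>] INF_lower2[of "{}"]) auto
  also have "\<dots> \<subseteq> S" using assms by (intro closure_minimal hull_minimal) auto
  finally show ?thesis .
qed

theorem filippov_isCont:
  assumes g: "isCont g x"
  shows "filippov g x = {g x}"
proof
  show "{g x} \<subseteq> filippov g x"
    using filippov_contains_continuity_value[OF g] by (auto simp: filippov_def)
  show "filippov g x \<subseteq> {g x}"
  proof
    fix v assume v: "v \<in> filippov g x"
    have "dist (g x) v \<le> e" if e: "e > 0" for e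
    proof -
      obtain d where d: "d > 0" "\<And>w. dist w x < d \<Longrightarrow> dist (g w) (g x) < e"
        using g e unfolding continuous_at_eps_delta by blast
      have "g ` ball x d \<subseteq> cball (g x) e"
        using d(2) by (auto simp: dist_commute less_imp_le)
      then have "filippov g x \<subseteq> cball (g x) e" by (rule filippov_subset[OF d(1)]) auto
      then show ?thesis using v by auto
    qed
    then have "dist (g x) v \<le> 0" using field_le_epsilon[of "dist (g x) v" 0] by simp
    then show "v \<in> {g x}" by simp
  qed
qed

locale relay_feedback = weighted_space P for P :: "real^'m^'m" +
  fixes B :: "real^'m^'n" and C :: "real^'n^'m" and \<rho> :: real
  assumes CB_invertible: "det (C ** B) \<noteq> 0" and gain_pos: "\<rho> > 0"
begin

abbreviation "D \<equiv> matrix_inv (C ** B)"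
abbreviation "uhat \<equiv> feedback P \<rho> B C"

text \<open>The norm on the control space in which the relay takes values of length \<open>\<rho>\<close> off the surface and the Volterra
  operator is a contraction.\<close>

definition "gauge_norm u = N (C *v (B *v u))"

lemma CB_D [simp]: "C *v (B *v (D *v y)) = y"
  using matrix_inv_cancel(1)[OF CB_invertible] by (simp add: matrix_vector_mul_assoc matrix_mul_assoc)

lemma D_CB [simp]: "D *v (C *v (B *v u)) = u"
  using matrix_inv_cancel(2)[OF CB_invertible] by (simp add: matrix_vector_mul_assoc matrix_mul_assoc[symmetric])

lemma gauge_norm_D [simp]: "gauge_norm (D *v y) = N y"
  by (simp add: gauge_norm_def)

lemma gauge_norm_nonneg [simp]: "0 \<le> gauge_norm u" by (simp add: gauge_norm_def)

lemma CB_eq_0_iff: "C *v (B *v u) = 0 \<longleftrightarrow> u = 0"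
proof
  assume "C *v (B *v u) = 0"
  then show "u = 0" using D_CB[of u] by simp
qed simp

lemma gauge_norm_eq_0 [simp]: "gauge_norm u = 0 \<longleftrightarrow> u = 0"
  by (simp add: gauge_norm_def CB_eq_0_iff)

lemma gauge_norm_0 [simp]: "gauge_norm 0 = 0" by simp

lemma gauge_norm_scaleR [simp]: "gauge_norm (c *\<^sub>R u) = \<bar>c\<bar> * gauge_norm u"
  by (simp add: gauge_norm_def matrix_vector_mult_scaleR)

lemma gauge_norm_minus [simp]: "gauge_norm (- u) = gauge_norm u"
  using gauge_norm_scaleR[of "-1" u] by simp

lemma gauge_norm_triangle: "gauge_norm (u + v) \<le> gauge_norm u + gauge_norm v"
  by (simp add: gauge_norm_def matrix_vector_right_distrib weighted_norm_triangle)

lemma norm_le_gauge_norm: obtains c where "c > 0" "\<And>u. norm u \<le> c * gauge_norm u"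
proof -
  obtain c where c: "c > 0" "\<And>y. norm y \<le> c * N y"
    by (rule norm_le_weighted_norm) (blast intro: that)+
  obtain K where K: "K > 0" "\<And>y. norm (D *v y) \<le> norm y * K"
    using bounded_linear.pos_bounded[OF matrix_vector_mul_bounded_linear[of D]] by blast
  have "norm u \<le> (c * K) * gauge_norm u" for u
  proof -
    have "norm u \<le> norm (C *v (B *v u)) * K" using K(2)[of "C *v (B *v u)"] by simp
    also have "\<dots> \<le> (c * gauge_norm u) * K"
      unfolding gauge_norm_def using c K by (intro mult_right_mono) auto
    finally show ?thesis by (simp add: mult_ac)
  qed
  then show ?thesis using that[of "c * K"] c K by auto
qed

lemma gauge_norm_le_norm: obtains c where "c > 0" "\<And>u. gauge_norm u \<le> c * norm u"
proof -
  obtain c where c: "c > 0" "\<And>y. N y \<le> c * norm y"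
    by (rule weighted_norm_le_norm) (blast intro: that)+
  obtain K where K: "K > 0" "\<And>y. norm ((C ** B) *v y) \<le> norm y * K"
    using bounded_linear.pos_bounded[OF matrix_vector_mul_bounded_linear[of "C ** B"]] by blast
  have "gauge_norm u \<le> (c * K) * norm u" for u
  proof -
    have "gauge_norm u \<le> c * norm ((C ** B) *v u)"
      unfolding gauge_norm_def by (simp add: matrix_vector_mul_assoc c)
    also have "\<dots> \<le> c * (norm u * K)" using c K by (intro mult_left_mono) auto
    finally show ?thesis by (simp add: mult_ac)
  qed
  then show ?thesis using that[of "c * K"] c K by auto
qed

lemma continuous_gauge_norm: "continuous_on S gauge_norm"
  unfolding gauge_norm_def matrix_vector_mul_assoc
  by (rule continuous_on_compose2[OF continuous_weighted_norm[of UNIV]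
        matrix_vector_mult_linear_continuous_on]) auto

lemma Linf_gauge_norm: "f \<in> Linf S \<Longrightarrow> (\<lambda>x. gauge_norm (f x)) \<in> Linf S"
  by (rule Linf_continuous_image[OF _ continuous_gauge_norm])

lemma gauge_norm_feedback: "gauge_norm (uhat x) = (if C *v x = 0 then 0 else \<rho>)"
  using gain_pos by (simp add: feedback_def)

lemma isCont_feedback:
  assumes "C *v x \<noteq> 0"
  shows "isCont uhat x"
proof -
  have N: "isCont (\<lambda>x. N (C *v x)) x"
    by (rule isCont_o2[OF matrix_vector_mult_linear_continuous_at])
      (use continuous_weighted_norm[of UNIV] in \<open>simp add: continuous_on_eq_continuous_at\<close>)
  have "isCont (\<lambda>x. - \<rho> / N (C *v x)) x"
    using assms by (intro continuous_at_within_divide continuous_const N) auto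
  moreover have "isCont (\<lambda>x. D *v (C *v x)) x"
    unfolding matrix_vector_mul_assoc by (rule matrix_vector_mult_linear_continuous_at)
  ultimately have "isCont (\<lambda>x. (- \<rho> / N (C *v x)) *\<^sub>R (D *v (C *v x))) x"
    by (rule bounded_bilinear.isCont[OF bounded_bilinear_scaleR])
  then show ?thesis by (simp add: feedback_def[abs_def])
qed

lemma feedback_borel_measurable: "uhat \<in> borel_measurable borel"
proof -
  have "(\<lambda>x. N (C *v x)) \<in> borel_measurable borel"
    by (rule borel_measurable_continuous_onI, rule continuous_on_compose2[OF continuous_weighted_norm[of UNIV]
          matrix_vector_mult_linear_continuous_on]) auto
  moreover have "(\<lambda>x. D *v (C *v x)) \<in> borel_measurable borel"
    unfolding matrix_vector_mul_assoc
    by (intro borel_measurable_continuous_onI matrix_vector_mult_linear_continuous_on)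
  ultimately show ?thesis unfolding feedback_def[abs_def] by measurable
qed

lemma filippov_feedback_regular: "C *v x \<noteq> 0 \<Longrightarrow> filippov uhat x = {uhat x}"
  by (rule filippov_isCont[OF isCont_feedback])

lemma convex_gauge_ball: "convex {v. gauge_norm v \<le> \<rho>}"
proof (rule convexI)
  fix u v and s t :: real
  assume uv: "u \<in> {v. gauge_norm v \<le> \<rho>}" "v \<in> {v. gauge_norm v \<le> \<rho>}" "0 \<le> s" "0 \<le> t" "s + t = 1"
  have "gauge_norm (s *\<^sub>R u + t *\<^sub>R v) \<le> s * gauge_norm u + t * gauge_norm v"
    using gauge_norm_triangle[of "s *\<^sub>R u" "t *\<^sub>R v"] uv by simp
  also have "\<dots> \<le> s * \<rho> + t * \<rho>" using uv by (intro add_mono mult_left_mono) auto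
  also have "\<dots> = \<rho>" using uv by (simp add: distrib_right[symmetric])
  finally show "s *\<^sub>R u + t *\<^sub>R v \<in> {v. gauge_norm v \<le> \<rho>}" by simp
qed

lemma filippov_feedback_bounded: "filippov uhat x \<subseteq> {v. gauge_norm v \<le> \<rho>}"
proof (rule filippov_subset[of 1])
  show "uhat ` ball x 1 \<subseteq> {v. gauge_norm v \<le> \<rho>}" using gauge_norm_feedback gain_pos by auto
  show "closed {v. gauge_norm v \<le> \<rho>}"
    by (intro closed_Collect_le continuous_gauge_norm continuous_intros)
qed (use convex_gauge_ball in auto)

text \<open>On the sliding surface every unit direction of the output is attained arbitrarily close by, so
  the regularization contains the sphere of radius \<open>\<rho>\<close> of \<^const>\<open>gauge_norm\<close>, hence by
  convexity the ball.\<close>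

lemma filippov_feedback_sliding:
  assumes x: "C *v x = 0" and v: "gauge_norm v \<le> \<rho>"
  shows "v \<in> filippov uhat x"
  unfolding filippov_def
proof (intro INT_I)
  fix \<delta> :: real and S :: "(real^'n) set" assume \<delta>: "\<delta> \<in> {0<..}" and S: "S \<in> null_sets lebesgue"
  let ?H = "closure (convex hull (uhat ` (ball x \<delta> - S)))"
  have sphere: "u \<in> ?H" if u: "gauge_norm u = \<rho>" for u
  proof -
    have u0: "u \<noteq> 0" using u gain_pos by auto
    \<comment> \<open>The point z = x - s B u has the output - s C B u, at which the relay returns u.\<close>
    define s where "s = \<delta> / (2 * (norm (B *v u) + 1))"
    have s: "s > 0" using \<delta> by (auto simp: s_def intro!: divide_pos_pos add_nonneg_pos)
    define z where "z = x - s *\<^sub>R (B *v u)"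
    have Cz: "C *v z = - (s *\<^sub>R (C *v (B *v u)))"
      by (simp add: z_def x matrix_vector_mult_diff_distrib matrix_vector_mult_scaleR)
    have Nz: "N (C *v z) = s * \<rho>" using u s by (simp add: Cz gauge_norm_def)
    then have nz: "C *v z \<noteq> 0" using s gain_pos by auto
    have "D *v (C *v z) = - (s *\<^sub>R u)"
    proof -
      have "C *v z = C *v (B *v (- (s *\<^sub>R u)))"
        unfolding Cz by (simp add: matrix_vector_mult_scaleR flip: scaleR_minus_left)
      then show ?thesis by simp
    qed
    then have "uhat z = u" using s gain_pos by (simp add: feedback_def Nz)
    moreover have "uhat z \<in> ?H"
    proof (rule filippov_contains_continuity_value[OF isCont_feedback[OF nz] _ S])
      have "s * norm (B *v u) < \<delta>"
      proof -
        have "s * norm (B *v u) \<le> s * (norm (B *v u) + 1)" using s by simp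
        also have "\<dots> = \<delta> / 2" by (simp add: s_def field_simps add_nonneg_eq_0_iff)
        finally show ?thesis using \<delta> by auto
      qed
      then show "z \<in> ball x \<delta>" using s by (simp add: z_def dist_norm)
    qed
    ultimately show ?thesis by simp
  qed
  obtain e where e: "gauge_norm e = \<rho>" "\<exists>r. 0 \<le> r \<and> r \<le> 1 \<and> v = r *\<^sub>R e"
  proof (cases "v = 0")
    case True
    obtain w :: "real^'m" where "w \<noteq> 0" using nonzero_vector_exists by auto
    then have "gauge_norm ((\<rho> / gauge_norm w) *\<^sub>R w) = \<rho>" using gain_pos by simp
    then show ?thesis using True by (intro that[of "(\<rho> / gauge_norm w) *\<^sub>R w"]) (auto intro: exI[of _ 0])
  next
    case False
    then have pos: "gauge_norm v > 0" using gauge_norm_nonneg[of v] gauge_norm_eq_0[of v] by linarith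
    show ?thesis
    proof (rule that[of "(\<rho> / gauge_norm v) *\<^sub>R v"])
      show "gauge_norm ((\<rho> / gauge_norm v) *\<^sub>R v) = \<rho>" using False pos gain_pos by simp
      show "\<exists>r. 0 \<le> r \<and> r \<le> 1 \<and> v = r *\<^sub>R (\<rho> / gauge_norm v) *\<^sub>R v"
        using False pos gain_pos v by (intro exI[of _ "gauge_norm v / \<rho>"]) auto
    qed
  qed
  then obtain r where r: "0 \<le> r" "r \<le> 1" "v = r *\<^sub>R e" by blast
  \<comment> \<open>v lies on the segment between the antipodal points e and - e of the sphere.\<close>
  have "((1 + r) / 2) *\<^sub>R e + ((1 - r) / 2) *\<^sub>R (- e) \<in> ?H"
    using e r by (intro convexD[of ?H] convex_closure convex_convex_hull sphere) (auto simp: field_simps)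
  also have "((1 + r) / 2) *\<^sub>R e + ((1 - r) / 2) *\<^sub>R (- e) = v"
    by (simp add: r(3) scaleR_diff_left[symmetric] diff_divide_distrib[symmetric])
  finally show "v \<in> ?H" .
qed

lemma filippov_feedback_self: "C *v x \<noteq> 0 \<Longrightarrow> uhat x \<in> filippov uhat x"
  using filippov_feedback_regular by auto

end

section \<open>Contraction of the memory term and the Neumann series\<close>

lemma Linf_Ioo_iff:
  fixes f :: "real \<Rightarrow> 'b::euclidean_space"
  shows "f \<in> Linf {a<..<b} \<longleftrightarrow> f \<in> Linf {a..b}"
proof
  assume "f \<in> Linf {a..b}"
  then show "f \<in> Linf {a<..<b}" by (rule Linf_mono) auto
next
  assume f: "f \<in> Linf {a<..<b}"
  have ext: "(\<lambda>x. if x \<in> {a<..<b} then f x else 0) \<in> Linf {a..b}"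
    by (rule Linf_extend_by_zero[OF f]) auto
  have eq: "AE x in lebesgue_on {a..b}. (if x \<in> {a<..<b} then f x else 0) = f x"
  proof -
    have "AE x in lebesgue. x \<notin> {a, b}" by (rule AE_not_in) auto
    then have "AE x in lebesgue. x \<in> {a..b} \<longrightarrow> (if x \<in> {a<..<b} then f x else 0) = f x"
      by (rule eventually_mono) auto
    then show ?thesis by (subst AE_lebesgue_on_iff) auto
  qed
  show "f \<in> Linf {a..b}" by (rule Linf_AE_cong[OF ext _ eq]) simp
qed

lemma AE_lebesgue_on_Ioo_iff:
  fixes a b :: real
  shows "(AE x in lebesgue_on {a<..<b}. Q x) \<longleftrightarrow> (AE x in lebesgue_on {a..b}. Q x)"
proof
  assume Q: "AE x in lebesgue_on {a<..<b}. Q x"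
  have "AE x in lebesgue. x \<notin> {a, b}" by (rule AE_not_in) auto
  moreover have "AE x in lebesgue. x \<in> {a<..<b} \<longrightarrow> Q x" using Q by (simp add: AE_lebesgue_on_iff)
  ultimately have "AE x in lebesgue. x \<in> {a..b} \<longrightarrow> Q x" by eventually_elim auto
  then show "AE x in lebesgue_on {a..b}. Q x" by (simp add: AE_lebesgue_on_iff)
next
  assume "AE x in lebesgue_on {a..b}. Q x"
  then show "AE x in lebesgue_on {a<..<b}. Q x" by (rule AE_lebesgue_on_mono) auto
qed

lemma Linf_norm_nonneg_Ioo:
  fixes f :: "real \<Rightarrow> 'b::euclidean_space"
  assumes "a < b" and f: "f \<in> Linf {a<..<b}"
  shows "0 \<le> Linf_norm {a<..<b} f"
proof -
  have "emeasure (lebesgue_on {a<..<b}) (space (lebesgue_on {a<..<b})) \<noteq> 0"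
    using assms(1) by (simp add: emeasure_restrict_space)
  then have "esssup (lebesgue_on {a<..<b}) (\<lambda>x. 0 :: ereal) = 0" by (rule esssup_const)
  moreover have "esssup (lebesgue_on {a<..<b}) (\<lambda>x. 0 :: ereal) \<le> Linf_norm {a<..<b} f"
    unfolding Linf_norm_def by (rule esssup_mono) auto
  ultimately show ?thesis by simp
qed

lemma AE_lebesgue_on_Icc_False:
  fixes a b :: real
  assumes "AE x in lebesgue_on {a..b}. False" "a < b"
  shows False
proof -
  obtain N where "negligible N" "\<And>x. x \<in> {a..b} \<Longrightarrow> x \<in> N"
    using assms(1) by (auto simp: AE_lebesgue_on_iff eventually_ae_filter_negligible)
  then have "negligible {a..b}" using negligible_subset[of N "{a..b}"] by blast
  then show False using assms(2) negligible_interval(1)[of a b] by (simp add: box_real)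
qed

locale sliding_mode_system = relay_feedback P B C \<rho> + volterra_kernel \<Phi>
  for P :: "real^'m^'m" and B :: "real^'m^'n" and C :: "real^'n^'m" and \<rho> :: real
    and \<Phi> :: "real \<Rightarrow> real \<Rightarrow> real^'n^'n" +
  fixes A :: "real^'n^'n" and Bt :: "real^'m^'n" and \<gamma> :: "real \<Rightarrow> real^'m"
    and p :: "real \<Rightarrow> real^'n" and t0 M \<delta> :: real and \<Lambda> :: "real^'m^'m"
  assumes matching_disturbance: "\<gamma> \<in> Linf UNIV" and disturbance: "p \<in> Linf UNIV"
    and CA: "C ** A = \<Lambda> ** C"
    and Lyapunov: "neg_semidefinite (transpose \<Lambda> ** P + P ** \<Lambda>)"
    and margin_pos: "\<delta> > 0"
    and memory_bound: "esssup (lebesgue_on {t0..})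
           (\<lambda>t. ereal (LINT \<tau>:{t0..t}|lebesgue. weighted_onorm P (C ** \<Phi> t \<tau> ** Bt ** D))) \<le> ereal M"
    and memory_small: "M < 1"
    and gain_condition: "AE t in lebesgue_on {t0..}.
           \<rho> \<ge> (N (C *v (B *v \<gamma> t + p t))
                 + (LINT \<tau>:{t0..t}|lebesgue. N ((C ** \<Phi> t \<tau> ** Bt) *v \<gamma> \<tau>)) + \<delta>) / (1 - M)"
begin

definition "conv a w s = (LINT \<tau>:{a..s}|lebesgue. (\<Phi> s \<tau> ** Bt) *v w \<tau>)"

abbreviation "volterra \<equiv> volterra_op C B Bt \<Phi>"

abbreviation "memory s \<equiv> (LINT \<tau>:{t0..s}|lebesgue. weighted_onorm P (C ** \<Phi> s \<tau> ** Bt ** D))"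

lemma memory_bound_AE:
  "AE s in lebesgue_on {t0..}. memory s \<le> M"
proof -
  have "AE s in lebesgue_on {t0..}. ereal (memory s)
      \<le> esssup (lebesgue_on {t0..}) (\<lambda>t. ereal (memory t))"
    by (rule esssup_AE)
  then show ?thesis
  proof eventually_elim
    case (elim s)
    from order_trans[OF elim memory_bound] show ?case by simp
  qed
qed

lemma LINT_onorm_nonneg: "0 \<le> (LINT \<tau>:{a..s}|lebesgue. weighted_onorm P (Q \<tau>))"
  unfolding set_lebesgue_integral_def
  by (rule integral_nonneg_AE) (auto simp: weighted_onorm_nonneg)

lemma memory_nonneg: "0 \<le> M"
proof (rule ccontr)
  assume "\<not> 0 \<le> M"
  have "AE s in lebesgue_on {t0..}. False"
    using memory_bound_AE
  proof eventually_elim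
    case (elim s)
    then show False
      using LINT_onorm_nonneg[of t0 s "\<lambda>\<tau>. C ** \<Phi> s \<tau> ** Bt ** D"] \<open>\<not> 0 \<le> M\<close> by simp
  qed
  then have "AE s in lebesgue_on {t0..t0 + 1}. False" by (rule AE_lebesgue_on_mono) auto
  then show False by (rule AE_lebesgue_on_Icc_False) simp
qed

lemma slice_integrand_Linf:
  fixes Q :: "real^'n^'l"
  assumes "\<Phi> s \<in> Linf {a..s}" "w \<in> Linf {a..s}"
  shows "(\<lambda>\<tau>. (Q ** \<Phi> s \<tau> ** Bt) *v w \<tau>) \<in> Linf {a..s}"
proof -
  have "(\<lambda>\<tau>. Q *v (\<Phi> s \<tau> *v (Bt *v w \<tau>))) \<in> Linf {a..s}"
    by (intro Linf_matrix_vector slice_product_Linf assms)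
  then show ?thesis by (simp add: matrix_vector_mul_assoc matrix_mul_assoc)
qed

lemma conv_integrand_Linf:
  assumes "\<Phi> s \<in> Linf {a..s}" "w \<in> Linf {a..s}"
  shows "(\<lambda>\<tau>. (\<Phi> s \<tau> ** Bt) *v w \<tau>) \<in> Linf {a..s}"
  using slice_integrand_Linf[OF assms, of "mat 1"] by simp

lemma LINT_matrix_conv:
  fixes Q :: "real^'n^'l"
  assumes "\<Phi> s \<in> Linf {a..s}" "w \<in> Linf {a..s}"
  shows "(LINT \<tau>:{a..s}|lebesgue. (Q ** \<Phi> s \<tau> ** Bt) *v w \<tau>) = Q *v conv a w s"
  using LINT_bounded_linear[OF conv_integrand_Linf[OF assms] matrix_vector_mul_bounded_linear[of Q]]
  by (simp add: conv_def matrix_vector_mul_assoc matrix_mul_assoc)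

lemma conv_Linf:
  assumes "w \<in> Linf {a..b}"
  shows "conv a w \<in> Linf {a..b}"
  using kernel_convolution_Linf[OF Linf_matrix_vector[OF assms, of Bt]]
  by (simp add: conv_def[abs_def] matrix_vector_mul_assoc)

lemma conv_add:
  assumes "\<Phi> s \<in> Linf {a..s}" "v \<in> Linf {a..s}" "w \<in> Linf {a..s}"
  shows "conv a (\<lambda>\<tau>. v \<tau> + w \<tau>) s = conv a v s + conv a w s"
  using LINT_add_Icc[OF conv_integrand_Linf[OF assms(1,2)] conv_integrand_Linf[OF assms(1,3)]]
  by (simp add: conv_def matrix_vector_right_distrib)

lemma conv_diff:
  assumes "\<Phi> s \<in> Linf {a..s}" "v \<in> Linf {a..s}" "w \<in> Linf {a..s}"
  shows "conv a (\<lambda>\<tau>. v \<tau> - w \<tau>) s = conv a v s - conv a w s"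
  using LINT_diff_Icc[OF conv_integrand_Linf[OF assms(1,2)] conv_integrand_Linf[OF assms(1,3)]]
  by (simp add: conv_def matrix_vector_mult_diff_distrib)

lemma conv_scaleR:
  assumes "\<Phi> s \<in> Linf {a..s}" "v \<in> Linf {a..s}"
  shows "conv a (\<lambda>\<tau>. r *\<^sub>R v \<tau>) s = r *\<^sub>R conv a v s"
  using LINT_bounded_linear[OF conv_integrand_Linf[OF assms] bounded_linear_scaleR_right[of r]]
  by (simp add: conv_def matrix_vector_mult_scaleR)

lemma conv_cong_AE:
  assumes "\<Phi> s \<in> Linf {a..s}" "v \<in> Linf {a..s}" "AE \<tau> in lebesgue_on {a..s}. v \<tau> = w \<tau>"
  shows "conv a v s = conv a w s"
  unfolding conv_def
  by (rule LINT_cong_AE_Icc[OF conv_integrand_Linf[OF assms(1,2)]]) (use assms(3) in \<open>auto elim: eventually_mono\<close>)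

text \<open>The derivative of \<open>C x\<close> has no other part than the drift \<open>\<Lambda> C x\<close>; on the surface \<open>C x = 0\<close> this is
  the equation that determines the equivalent control.\<close>

abbreviation "sliding_balance u t \<equiv>
  C *v (B *v (u t + \<gamma> t)) + C *v p t + C *v conv t0 (\<lambda>\<tau>. u \<tau> + \<gamma> \<tau>) t = 0"

lemma good_times: "AE s in lebesgue_on {t0..b}. \<Phi> s \<in> Linf {t0..s} \<and> s \<in> {t0..b} \<and>
    memory s \<le> M"
proof -
  have "AE s in lebesgue_on {t0..b}. memory s \<le> M"
    by (rule AE_lebesgue_on_mono[OF memory_bound_AE]) auto
  moreover have "AE s in lebesgue_on {t0..b}. s \<in> {t0..b}" by (rule AE_Icc_mem)
  ultimately show ?thesis using kernel_slices[of t0 b] by eventually_elim auto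
qed

lemma good_times_from:
  assumes "t0 \<le> a"
  shows "AE s in lebesgue_on {a..b}. \<Phi> s \<in> Linf {t0..s} \<and> \<Phi> s \<in> Linf {a..s} \<and> s \<in> {a..b} \<and>
    memory s \<le> M"
proof -
  have "AE s in lebesgue_on {a..b}. \<Phi> s \<in> Linf {t0..s} \<and> s \<in> {t0..b} \<and>
    memory s \<le> M"
    using assms by (intro AE_lebesgue_on_mono[OF good_times]) auto
  moreover have "AE s in lebesgue_on {a..b}. s \<in> {a..b}" by (rule AE_Icc_mem)
  ultimately show ?thesis
    by eventually_elim (use assms Linf_Icc_mono in blast)
qed

text \<open>The memory term contracts by the factor \<^term>\<open>M\<close> when inputs are measured by
  \<^const>\<open>gauge_norm\<close>, because \<open>C \<Phi> Bt w = (C \<Phi> Bt D) (C B w)\<close>.\<close>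

lemma conv_contraction:
  assumes \<Phi>: "\<Phi> s \<in> Linf {t0..s}" and a: "t0 \<le> a" "a \<le> s"
    and M: "memory s \<le> M"
    and w: "w \<in> Linf {a..s}" and bd: "AE \<tau> in lebesgue_on {a..s}. gauge_norm (w \<tau>) \<le> c" and c: "c \<ge> 0"
  shows "N (C *v conv a w s) \<le> M * c"
proof -
  have \<Phi>a: "\<Phi> s \<in> Linf {a..s}" using a by (intro Linf_Icc_mono[OF \<Phi>]) auto
  define h where "h = (\<lambda>\<tau>. weighted_onorm P (C ** \<Phi> s \<tau> ** Bt ** D))"
  have bl: "bounded_linear (\<lambda>Q :: real^'n^'n. C ** Q ** Bt ** D)"
    unfolding linear_conv_bounded_linear[symmetric]
    by (rule linearI) (simp_all add: matrix_matrix_mult_def vec_eq_iff sum.distrib sum_distrib_left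
        sum_distrib_right algebra_simps)
  have h0: "h \<in> Linf {t0..s}"
    unfolding h_def by (rule Linf_continuous_image[OF Linf_bounded_linear_image[OF bl \<Phi>] continuous_weighted_onorm])
  then have h: "h \<in> Linf {a..s}" using a by (intro Linf_Icc_mono[OF h0]) auto
  have hc: "(\<lambda>\<tau>. h \<tau> * c) \<in> Linf {a..s}"
    by (rule Linf_bounded_linear_image[OF bounded_linear_mult_left h])
  note int = slice_integrand_Linf[OF \<Phi>a w, of C]
  have "N (C *v conv a w s) = N (LINT \<tau>:{a..s}|lebesgue. (C ** \<Phi> s \<tau> ** Bt) *v w \<tau>)"
    by (simp add: LINT_matrix_conv[OF \<Phi>a w])
  also have "\<dots> \<le> (LINT \<tau>:{a..s}|lebesgue. N ((C ** \<Phi> s \<tau> ** Bt) *v w \<tau>))"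
    by (rule weighted_norm_LINT_le[OF int])
  also have "\<dots> \<le> (LINT \<tau>:{a..s}|lebesgue. h \<tau> * c)"
  proof (rule LINT_mono_AE[OF Linf_weighted_norm[OF int] hc])
    show "AE \<tau> in lebesgue_on {a..s}. N ((C ** \<Phi> s \<tau> ** Bt) *v w \<tau>) \<le> h \<tau> * c"
      using bd
    proof eventually_elim
      case (elim \<tau>)
      have "(C ** \<Phi> s \<tau> ** Bt) *v w \<tau> = (C ** \<Phi> s \<tau> ** Bt ** D) *v (C *v (B *v w \<tau>))"
        using D_CB[of "w \<tau>"] by (simp add: matrix_vector_mul_assoc[symmetric])
      then have "N ((C ** \<Phi> s \<tau> ** Bt) *v w \<tau>) \<le> h \<tau> * gauge_norm (w \<tau>)"
        unfolding h_def gauge_norm_def by (simp only: weighted_norm_mult_le)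
      also have "\<dots> \<le> h \<tau> * c" using elim by (intro mult_left_mono) (auto simp: h_def weighted_onorm_nonneg)
      finally show ?case .
    qed
  qed
  also have "\<dots> = (LINT \<tau>:{a..s}|lebesgue. h \<tau>) * c"
    by (rule LINT_bounded_linear[OF h bounded_linear_mult_left])
  also have "\<dots> \<le> M * c"
  proof (rule mult_right_mono[OF _ c])
    have "0 \<le> (LINT \<tau>:{t0..a}|lebesgue. h \<tau>)"
      unfolding h_def by (rule LINT_onorm_nonneg)
    then show "(LINT \<tau>:{a..s}|lebesgue. h \<tau>) \<le> M"
      using LINT_combine_Icc[OF h0 a] M by (simp add: h_def)
  qed
  finally show ?thesis .
qed

lemma volterra_op_eq:
  assumes "\<Phi> s \<in> Linf {T..s}" "f \<in> Linf {T..s}"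
  shows "volterra T f s = - (D *v (C *v conv T f s))"
  unfolding volterra_op_def LINT_matrix_conv[OF assms] ..

lemma volterra_op_Linf:
  assumes f: "f \<in> Linf {T..b}"
  shows "volterra T f \<in> Linf {T..b}"
proof (rule Linf_AE_cong)
  show "(\<lambda>s. - (D *v (C *v conv T f s))) \<in> Linf {T..b}"
    by (intro Linf_uminus Linf_matrix_vector conv_Linf f)
  have "AE s in lebesgue_on {T..b}. s \<in> {T..b}" by (rule AE_Icc_mem)
  then show "AE s in lebesgue_on {T..b}. - (D *v (C *v conv T f s)) = volterra T f s"
    using kernel_slices[of T b]
  proof eventually_elim
    case (elim s)
    then show ?case using volterra_op_eq[OF elim(2) Linf_Icc_mono[OF f]] by simp
  qed
qed simp

lemma volterra_op_diff_AE:
  assumes f: "f \<in> Linf {T..b}" and h: "h \<in> Linf {T..b}"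
  shows "AE s in lebesgue_on {T..b}. volterra T (\<lambda>r. f r - h r) s =
    volterra T f s - volterra T h s"
proof -
  have "AE s in lebesgue_on {T..b}. s \<in> {T..b}" by (rule AE_Icc_mem)
  then show ?thesis using kernel_slices[of T b]
  proof eventually_elim
    case (elim s)
    have "f \<in> Linf {T..s}" "h \<in> Linf {T..s}" using elim f h by (auto intro: Linf_Icc_mono)
    then show ?case using elim
      by (simp add: volterra_op_eq Linf_diff conv_diff matrix_vector_mult_diff_distrib)
  qed
qed

lemma volterra_op_add_AE:
  assumes f: "f \<in> Linf {T..b}" and h: "h \<in> Linf {T..b}"
  shows "AE s in lebesgue_on {T..b}. volterra T (\<lambda>r. f r + h r) s =
    volterra T f s + volterra T h s"
proof -
  have "AE s in lebesgue_on {T..b}. s \<in> {T..b}" by (rule AE_Icc_mem)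
  then show ?thesis using kernel_slices[of T b]
  proof eventually_elim
    case (elim s)
    have "f \<in> Linf {T..s}" "h \<in> Linf {T..s}" using elim f h by (auto intro: Linf_Icc_mono)
    then show ?case using elim
      by (simp add: volterra_op_eq Linf_add conv_add matrix_vector_right_distrib)
  qed
qed

lemma volterra_op_scaleR_AE:
  assumes f: "f \<in> Linf {T..b}"
  shows "AE s in lebesgue_on {T..b}. volterra T (\<lambda>r. c *\<^sub>R f r) s = c *\<^sub>R volterra T f s"
proof -
  have "AE s in lebesgue_on {T..b}. s \<in> {T..b}" by (rule AE_Icc_mem)
  then show ?thesis using kernel_slices[of T b]
  proof eventually_elim
    case (elim s)
    have "f \<in> Linf {T..s}" using elim f by (auto intro: Linf_Icc_mono)
    then show ?case using elim
      by (simp add: volterra_op_eq Linf_scaleR conv_scaleR matrix_vector_mult_scaleR)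
  qed
qed

lemma volterra_op_contraction:
  assumes T: "t0 \<le> T" and f: "f \<in> Linf {T..b}" and c: "c \<ge> 0"
    and bd: "AE s in lebesgue_on {T..b}. gauge_norm (f s) \<le> c"
  shows "AE s in lebesgue_on {T..b}. gauge_norm (volterra T f s) \<le> M * c"
  using good_times_from[OF T]
proof eventually_elim
  case (elim s)
  have fs: "f \<in> Linf {T..s}" using elim by (intro Linf_Icc_mono[OF f]) auto
  have "gauge_norm (volterra T f s) = N (C *v conv T f s)"
    using elim by (simp add: volterra_op_eq[OF _ fs])
  also have "\<dots> \<le> M * c"
    using elim T by (intro conv_contraction fs c AE_lebesgue_on_mono[OF bd]) auto
  finally show ?case .
qed

theorem volterra_op_bounded_linear:
  assumes T: "t0 \<le> T" and Tt: "T < t"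
  shows "Linf_bounded_linear {T<..<t} (volterra T)"
  unfolding Linf_bounded_linear_def AE_lebesgue_on_Ioo_iff
proof (intro conjI ballI allI)
  fix f :: "real \<Rightarrow> real^'m" assume "f \<in> Linf {T<..<t}"
  then show "volterra T f \<in> Linf {T<..<t}"
    by (simp add: Linf_Ioo_iff volterra_op_Linf)
next
  fix f h :: "real \<Rightarrow> real^'m" assume "f \<in> Linf {T<..<t}" "h \<in> Linf {T<..<t}"
  then show "AE s in lebesgue_on {T..t}. volterra T (\<lambda>r. f r + h r) s =
    volterra T f s + volterra T h s"
    by (simp add: Linf_Ioo_iff volterra_op_add_AE)
next
  fix c and f :: "real \<Rightarrow> real^'m" assume "f \<in> Linf {T<..<t}"
  then show "AE s in lebesgue_on {T..t}. volterra T (\<lambda>r. c *\<^sub>R f r) s = c *\<^sub>R volterra T f s"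
    by (simp add: Linf_Ioo_iff volterra_op_scaleR_AE)
next
  obtain k where k: "k > 0" "\<And>u. norm u \<le> k * gauge_norm u"
    by (rule norm_le_gauge_norm) (blast intro: that)+
  obtain l where l: "l > 0" "\<And>u. gauge_norm u \<le> l * norm u"
    by (rule gauge_norm_le_norm) (blast intro: that)+
  show "\<exists>c. \<forall>f\<in>Linf {T<..<t}. Linf_norm {T<..<t} (volterra T f) \<le> ereal c * Linf_norm {T<..<t} f"
  proof (intro exI[of _ "k * (M * l)"] ballI)
    fix f :: "real \<Rightarrow> real^'m" assume f: "f \<in> Linf {T<..<t}"
    have "0 \<le> Linf_norm {T<..<t} f" "Linf_norm {T<..<t} f < \<infinity>"
      using Linf_norm_nonneg_Ioo[OF Tt f] f by (auto simp: Linf_def)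
    then obtain r where r: "Linf_norm {T<..<t} f = ereal r" "r \<ge> 0"
      by (cases "Linf_norm {T<..<t} f") auto
    have "AE s in lebesgue_on {T<..<t}. ereal (norm (f s)) \<le> Linf_norm {T<..<t} f"
      unfolding Linf_norm_def by (rule esssup_AE)
    then have "AE s in lebesgue_on {T..t}. gauge_norm (f s) \<le> l * r"
      unfolding AE_lebesgue_on_Ioo_iff r(1) ereal_less_eq
      by eventually_elim (meson l mult_left_mono less_imp_le order_trans)
    then have "AE s in lebesgue_on {T..t}. gauge_norm (volterra T f s) \<le> M * (l * r)"
      using f l r by (intro volterra_op_contraction[OF T]) (auto simp: Linf_Ioo_iff)
    then have "AE s in lebesgue_on {T<..<t}. norm (volterra T f s) \<le> k * (M * (l * r))"
      unfolding AE_lebesgue_on_Ioo_iff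
      by eventually_elim (meson k mult_left_mono less_imp_le order_trans)
    then have "Linf_norm {T<..<t} (volterra T f) \<le> ereal (k * (M * (l * r)))"
      using f by (intro Linf_norm_le Linf_measurable) (auto simp: Linf_Ioo_iff volterra_op_Linf)
    then show "Linf_norm {T<..<t} (volterra T f) \<le> ereal (k * (M * l)) * Linf_norm {T<..<t} f"
      by (simp add: r mult.assoc)
  qed
qed

text \<open>Applied to a quantity that the contraction reproduces up to a factor \<open>M\<close>, such as the difference of two
  solutions of the Volterra equation.\<close>

lemma AE_gauge_norm_geometric_zero:
  assumes "\<And>n. AE s in R. gauge_norm (e s) \<le> M ^ n * c"
  shows "AE s in R. e s = 0"
proof -
  have "AE s in R. \<forall>n. gauge_norm (e s) \<le> M ^ n * c"
    unfolding AE_all_countable using assms by blast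
  then show ?thesis
  proof eventually_elim
    case (elim s)
    have "(\<lambda>n. M ^ n * c) \<longlonglongrightarrow> 0 * c"
      using memory_nonneg memory_small by (intro tendsto_mult LIMSEQ_power_zero tendsto_const) auto
    then have "gauge_norm (e s) \<le> 0 * c"
      by (rule LIMSEQ_le_const) (use elim in blast)
    then show ?case using gauge_norm_nonneg[of "e s"] gauge_norm_eq_0[of "e s"] by simp
  qed
qed

lemma Linf_gauge_normE:
  assumes "f \<in> Linf S"
  obtains c where "c \<ge> 0" "AE s in lebesgue_on S. gauge_norm (f s) \<le> c"
proof -
  obtain c where c: "c \<ge> 0" "AE s in lebesgue_on S. norm (gauge_norm (f s)) \<le> c"
    by (rule LinfE[OF Linf_gauge_norm[OF assms]])
  then show ?thesis using that[of c] by simp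
qed

lemma volterra_equation_zero:
  assumes T: "t0 \<le> T" and e: "e \<in> Linf {T..b}"
    and eq: "AE s in lebesgue_on {T..b}. e s = volterra T e s"
  shows "AE s in lebesgue_on {T..b}. e s = 0"
proof -
  obtain c where c: "c \<ge> 0" "AE s in lebesgue_on {T..b}. gauge_norm (e s) \<le> c"
    by (rule Linf_gauge_normE[OF e])
  show ?thesis
  proof (rule AE_gauge_norm_geometric_zero[where c=c])
    fix n
    show "AE s in lebesgue_on {T..b}. gauge_norm (e s) \<le> M ^ n * c"
    proof (induction n)
      case 0
      then show ?case using c(2) by simp
    next
      case (Suc n)
      then have "AE s in lebesgue_on {T..b}. gauge_norm (volterra T e s) \<le> M * (M ^ n * c)"
        using c(1) memory_nonneg by (intro volterra_op_contraction[OF T e]) auto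
      then show ?case using eq by eventually_elim (simp add: mult.assoc)
    qed
  qed
qed

text \<open>The geometric bound holds for all terms at once outside a single null set. The series can therefore be
  summed pointwise, and the same sum serves every horizon.\<close>

theorem neumann_series:
  assumes T: "t0 \<le> T" and g: "\<And>b. g \<in> Linf {T..b}"
  obtains ut where "\<And>b. ut \<in> Linf {T..b}"
    and "\<And>t. T < t \<Longrightarrow> Linf_sums {T<..<t} (\<lambda>i. (volterra T ^^ i) g) ut"
    and "\<And>b. AE s in lebesgue_on {T..b}. ut s = g s + volterra T ut s"
proof -
  define K where "K = volterra T"
  define G where "G = (\<lambda>i. (K ^^ i) g)"
  define ut where "ut = (\<lambda>s. \<Sum>i. G i s)"
  have GL: "G i \<in> Linf {T..b}" for i b
    by (induction i) (simp_all add: G_def K_def g volterra_op_Linf)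
  obtain k where k: "k > 0" "\<And>u. norm u \<le> k * gauge_norm u"
    by (rule norm_le_gauge_norm) (blast intro: that)+
  have M01: "0 \<le> M" "M < 1" by (rule memory_nonneg, rule memory_small)
  have tail: "\<exists>c\<ge>0. AE s in lebesgue_on {T..b}. \<forall>n. norm (ut s - (\<Sum>i<n. G i s)) \<le> c * M ^ n" for b
  proof -
    obtain c where c: "c \<ge> 0" "AE s in lebesgue_on {T..b}. gauge_norm (g s) \<le> c"
      by (rule Linf_gauge_normE[OF g])
    have "AE s in lebesgue_on {T..b}. gauge_norm (G i s) \<le> M ^ i * c" for i
    proof (induction i)
      case 0
      then show ?case using c by (simp add: G_def)
    next
      case (Suc i)
      then have "AE s in lebesgue_on {T..b}. gauge_norm (K (G i) s) \<le> M * (M ^ i * c)"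
        unfolding K_def using c(1) M01 by (intro volterra_op_contraction[OF T GL]) auto
      then show ?case by (simp add: G_def mult.assoc)
    qed
    then have "AE s in lebesgue_on {T..b}. \<forall>i. gauge_norm (G i s) \<le> M ^ i * c"
      by (simp add: AE_all_countable)
    then have "AE s in lebesgue_on {T..b}. \<forall>n. norm (ut s - (\<Sum>i<n. G i s)) \<le> (k * c / (1 - M)) * M ^ n"
    proof (eventually_elim, intro allI)
      fix s n assume s: "\<forall>i. gauge_norm (G i s) \<le> M ^ i * c"
      have Gb: "norm (G i s) \<le> (k * c) * M ^ i" for i
      proof -
        have "k * gauge_norm (G i s) \<le> k * (M ^ i * c)" using s k(1) by (intro mult_left_mono) auto
        then show ?thesis using k(2)[of "G i s"] by (simp only: mult_ac)
      qed
      have sm: "summable (\<lambda>i. (k * c) * M ^ i)" using M01 by (intro summable_mult summable_geometric) auto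
      have sG: "summable (\<lambda>i. G i s)" by (rule summable_comparison_test'[OF sm Gb])
      have "ut s - (\<Sum>i<n. G i s) = (\<Sum>i. G (i + n) s)"
        using suminf_minus_initial_segment[OF sG, of n] by (simp add: ut_def)
      also have "norm \<dots> \<le> (\<Sum>i. (k * c) * M ^ (i + n))"
        using Gb sm by (intro norm_suminf_le summable_ignore_initial_segment)
      also have "\<dots> = (k * c) * M ^ n * (\<Sum>i. M ^ i)"
        using M01 by (subst suminf_mult[symmetric]) (auto simp: power_add mult_ac intro: summable_geometric)
      also have "\<dots> = (k * c / (1 - M)) * M ^ n" using M01 by (simp add: suminf_geometric)
      finally show "norm (ut s - (\<Sum>i<n. G i s)) \<le> (k * c / (1 - M)) * M ^ n" .
    qed
    then show ?thesis using k c M01 by (intro exI[of _ "k * c / (1 - M)"]) auto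
  qed
  have utm: "ut \<in> borel_measurable (lebesgue_on {T..b})" for b
    unfolding ut_def using Linf_measurable[OF GL] by (intro borel_measurable_suminf)
  have utL: "ut \<in> Linf {T..b}" for b
  proof -
    obtain c where c: "c \<ge> 0" "AE s in lebesgue_on {T..b}. \<forall>n. norm (ut s - (\<Sum>i<n. G i s)) \<le> c * M ^ n"
      using tail by blast
    have "AE s in lebesgue_on {T..b}. norm (ut s) \<le> c"
      using c(2) by eventually_elim (drule spec[of _ 0], simp)
    then show ?thesis by (rule LinfI[OF utm])
  qed
  have SL: "(\<lambda>s. \<Sum>i<n. G i s) \<in> Linf {T..b}" for n b by (intro Linf_sum GL)
  have sums: "Linf_sums {T<..<t} G ut" if "T < t" for t
    unfolding Linf_sums_def
  proof (intro conjI allI)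
    show "G i \<in> Linf {T<..<t}" for i by (simp add: Linf_Ioo_iff GL)
    show "ut \<in> Linf {T<..<t}" by (simp add: Linf_Ioo_iff utL)
    obtain c where c: "c \<ge> 0" "AE s in lebesgue_on {T..t}. \<forall>n. norm (ut s - (\<Sum>i<n. G i s)) \<le> c * M ^ n"
      using tail by blast
    have dL: "(\<lambda>s. ut s - (\<Sum>i<n. G i s)) \<in> Linf {T<..<t}" for n
      by (simp add: Linf_Ioo_iff Linf_diff utL SL)
    show "(\<lambda>n. Linf_norm {T<..<t} (\<lambda>s. ut s - (\<Sum>i<n. G i s))) \<longlonglongrightarrow> 0"
    proof (rule tendsto_sandwich)
      show "\<forall>\<^sub>F n in sequentially. 0 \<le> Linf_norm {T<..<t} (\<lambda>s. ut s - (\<Sum>i<n. G i s))"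
        using Linf_norm_nonneg_Ioo[OF that dL] by simp
      show "\<forall>\<^sub>F n in sequentially. Linf_norm {T<..<t} (\<lambda>s. ut s - (\<Sum>i<n. G i s)) \<le> ereal (c * M ^ n)"
      proof (rule always_eventually, rule allI, rule Linf_norm_le[OF Linf_measurable[OF dL]])
        fix n
        show "AE s in lebesgue_on {T<..<t}. norm (ut s - (\<Sum>i<n. G i s)) \<le> c * M ^ n"
          unfolding AE_lebesgue_on_Ioo_iff using c(2) by eventually_elim blast
      qed
      have "(\<lambda>n. c * M ^ n) \<longlonglongrightarrow> c * 0"
        using M01 by (intro tendsto_mult LIMSEQ_power_zero tendsto_const) auto
      then show "(\<lambda>n. ereal (c * M ^ n)) \<longlonglongrightarrow> 0" by (simp add: zero_ereal_def)
    qed auto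
  qed
  have fixpoint: "AE s in lebesgue_on {T..b}. ut s = g s + K ut s" for b
  proof -
    obtain c where c: "c \<ge> 0" "AE s in lebesgue_on {T..b}. \<forall>n. norm (ut s - (\<Sum>i<n. G i s)) \<le> c * M ^ n"
      using tail by blast
    obtain l where l: "l > 0" "\<And>u. gauge_norm u \<le> l * norm u"
      by (rule gauge_norm_le_norm) (blast intro: that)+
    have gt: "AE s in lebesgue_on {T..b}. gauge_norm (ut s - (\<Sum>i<n. G i s)) \<le> l * (c * M ^ n)" for n
      using c(2) by eventually_elim (meson l mult_left_mono less_imp_le order_trans)
    have KS: "AE s in lebesgue_on {T..b}. g s + K (\<lambda>s. \<Sum>i<n. G i s) s = (\<Sum>i<Suc n. G i s)" for n
    proof (induction n)
      case 0
      have "AE s in lebesgue_on {T..b}. K (\<lambda>s. 0 *\<^sub>R (g s)) s = 0 *\<^sub>R K g s"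
        unfolding K_def by (rule volterra_op_scaleR_AE[OF g])
      then show ?case by eventually_elim (simp add: G_def)
    next
      case (Suc n)
      have "AE s in lebesgue_on {T..b}. K (\<lambda>s. (\<Sum>i<n. G i s) + G n s) s = K (\<lambda>s. \<Sum>i<n. G i s) s + K (G n) s"
        unfolding K_def by (rule volterra_op_add_AE[OF SL GL])
      then show ?case using Suc
      proof eventually_elim
        case (elim s)
        have "K (G n) s = G (Suc n) s" by (simp add: G_def)
        then show ?case using elim by (simp add: add.assoc)
      qed
    qed
    have "AE s in lebesgue_on {T..b}. ut s - (g s + K ut s) = 0"
    proof (rule AE_gauge_norm_geometric_zero[where c="2 * (l * c)"])
      fix n
      have "AE s in lebesgue_on {T..b}. gauge_norm (K (\<lambda>s. ut s - (\<Sum>i<n. G i s)) s) \<le> M * (l * (c * M ^ n))"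
        unfolding K_def using c l M01 by (intro volterra_op_contraction[OF T] gt Linf_diff utL SL) auto
      moreover have "AE s in lebesgue_on {T..b}. K (\<lambda>s. ut s - (\<Sum>i<n. G i s)) s = K ut s - K (\<lambda>s. \<Sum>i<n. G i s) s"
        unfolding K_def by (rule volterra_op_diff_AE[OF utL SL])
      ultimately show "AE s in lebesgue_on {T..b}. gauge_norm (ut s - (g s + K ut s)) \<le> M ^ n * (2 * (l * c))"
        using gt[of "Suc n"] KS[of n]
      proof eventually_elim
        case (elim s)
        have "ut s - (g s + K ut s) = (ut s - (\<Sum>i<Suc n. G i s)) + (- K (\<lambda>s. ut s - (\<Sum>i<n. G i s)) s)"
          unfolding elim(2) elim(4)[symmetric] by (simp add: algebra_simps)
        then have "gauge_norm (ut s - (g s + K ut s)) \<le> l * (c * M ^ Suc n) + M * (l * (c * M ^ n))"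
          using elim(1,3) gauge_norm_triangle[of "ut s - (\<Sum>i<Suc n. G i s)" "- K (\<lambda>s. ut s - (\<Sum>i<n. G i s)) s"]
          by (simp only: gauge_norm_minus)
        also have "\<dots> = M * (M ^ n * (2 * (l * c)))" by (simp add: algebra_simps)
        also have "\<dots> \<le> 1 * (M ^ n * (2 * (l * c)))" using M01 l c by (intro mult_right_mono) auto
        finally show ?case by simp
      qed
    qed
    then show ?thesis by eventually_elim simp
  qed
  show ?thesis
    using that[of ut] utL sums fixpoint unfolding G_def K_def by blast
qed

end

section \<open>The state equation and the reaching phase\<close>

text \<open>Let \<open>a\<close> be the last zero of \<open>V\<close> before \<open>b\<close>. If it is not \<open>b\<close> itself, then \<open>V\<close> is positive on \<open>(a, b]\<close>,
  hence has not grown since \<open>a\<close>.\<close>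

lemma vanishing_persists:
  fixes V :: "real \<Rightarrow> real"
  assumes cont: "continuous_on {T..b} V" and nonneg: "\<And>t. V t \<ge> 0" and VT: "V T = 0" and Tb: "T \<le> b"
    and dec: "\<And>a c. T \<le> a \<Longrightarrow> a \<le> c \<Longrightarrow> c \<le> b \<Longrightarrow> (\<And>t. a < t \<Longrightarrow> t \<le> c \<Longrightarrow> V t > 0) \<Longrightarrow> V c \<le> V a"
  shows "V b = 0"
proof -
  define Z where "Z = {t \<in> {T..b}. V t = 0}"
  have "closed Z" unfolding Z_def by (intro continuous_closed_preimage_constant cont) auto
  then have "compact Z" by (auto simp: Z_def compact_eq_bounded_closed intro: bounded_subset[of "{T..b}"])
  moreover have "Z \<noteq> {}" using VT Tb by (auto simp: Z_def)
  ultimately obtain a where a: "a \<in> Z" "\<And>t. t \<in> Z \<Longrightarrow> t \<le> a" using compact_attains_sup[of Z] by auto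
  have "V t > 0" if "a < t" "t \<le> b" for t
  proof -
    have "t \<notin> Z" using a(2) that by force
    then have "V t \<noteq> 0" using that a(1) by (auto simp: Z_def)
    then show ?thesis using nonneg[of t] by linarith
  qed
  then have "V b \<le> V a" using a(1) by (intro dec) (auto simp: Z_def)
  then show ?thesis using a(1) nonneg[of b] by (auto simp: Z_def)
qed

context sliding_mode_system
begin

definition "rhs u x t = A *v x t + B *v (u t + \<gamma> t) + p t + conv t0 (\<lambda>\<tau>. u \<tau> + \<gamma> \<tau>) t"

text \<open>The state equation on \<^term>\<open>{t0..b}\<close> for a prescribed control. For \<open>b < t0\<close> it holds vacuously, so
  that quantifying over all \<open>b\<close> expresses a global solution.\<close>

definition "solves x0 b u x \<longleftrightarrow> continuous_on {t0..b} x \<and> (\<forall>t\<in>{t0..b}. x t = x0 + integral {t0..t} (rhs u x))"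

lemma disturbances_Linf: "\<gamma> \<in> Linf {a..b}" "p \<in> Linf {a..b}"
  using Linf_mono[OF matching_disturbance, of "{a..b}"] Linf_mono[OF disturbance, of "{a..b}"] by auto

lemma rhs_Linf:
  assumes "continuous_on {t0..b} x" "u \<in> Linf {t0..b}"
  shows "rhs u x \<in> Linf {t0..b}"
proof -
  have "x \<in> Linf {t0..b}" by (rule Linf_continuous[OF compact_Icc assms(1)])
  then show ?thesis
    unfolding rhs_def[abs_def]
    by (intro Linf_add Linf_matrix_vector disturbances_Linf conv_Linf assms(2))
qed

lemma conv_cong:
  assumes "\<And>\<tau>. \<tau> \<in> {a..s} \<Longrightarrow> v \<tau> = w \<tau>"
  shows "conv a v s = conv a w s"
  unfolding conv_def by (rule set_lebesgue_integral_cong) (use assms in auto)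

lemma rhs_cong:
  assumes "t0 \<le> t" "\<And>\<tau>. \<tau> \<in> {t0..t} \<Longrightarrow> u \<tau> = u' \<tau>" "x t = z t"
  shows "rhs u x t = rhs u' z t"
  using assms conv_cong[of t0 t "\<lambda>\<tau>. u \<tau> + \<gamma> \<tau>" "\<lambda>\<tau>. u' \<tau> + \<gamma> \<tau>"] by (simp add: rhs_def)

lemma rhs_cong_AE:
  assumes u: "u \<in> Linf {t0..b}" and eq: "AE t in lebesgue_on {t0..b}. u t = u' t"
  shows "AE t in lebesgue_on {t0..b}. rhs u x t = rhs u' x t"
  using eq good_times
proof eventually_elim
  case (elim t)
  have "u \<in> Linf {t0..t}" using elim by (intro Linf_Icc_mono[OF u]) auto
  moreover have "AE \<tau> in lebesgue_on {t0..t}. u \<tau> = u' \<tau>" using elim by (intro AE_lebesgue_on_mono[OF eq]) auto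
  ultimately have "conv t0 (\<lambda>\<tau>. u \<tau> + \<gamma> \<tau>) t = conv t0 (\<lambda>\<tau>. u' \<tau> + \<gamma> \<tau>) t"
    using elim by (intro conv_cong_AE Linf_add disturbances_Linf) (auto elim: eventually_mono)
  then show ?case using elim by (simp add: rhs_def)
qed

lemma solves_cong_AE:
  assumes "u \<in> Linf {t0..b}" "AE t in lebesgue_on {t0..b}. u t = u' t" "solves x0 b u x"
  shows "solves x0 b u' x"
  using assms(3) integral_cong_AE_Icc[OF rhs_cong_AE[OF assms(1,2)]] by (auto simp: solves_def)

lemma solves_mono: "solves x0 b u x \<Longrightarrow> c \<le> b \<Longrightarrow> solves x0 c u x"
  by (auto simp: solves_def intro: continuous_on_subset)

lemma solves_cong:
  assumes "solves x0 b u x" "\<And>t. t \<in> {t0..b} \<Longrightarrow> u t = u' t" "\<And>t. t \<in> {t0..b} \<Longrightarrow> x t = z t"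
  shows "solves x0 b u' z"
proof -
  have "integral {t0..t} (rhs u x) = integral {t0..t} (rhs u' z)" if "t \<in> {t0..b}" for t
    using that assms by (intro integral_cong rhs_cong) auto
  then show ?thesis
    using assms continuous_on_cong[of "{t0..b}" "{t0..b}" x z] by (auto simp: solves_def)
qed

lemma conv_bound:
  obtains \<kappa> where "\<kappa> \<ge> 0" "AE s in lebesgue_on {t0..b}. \<forall>w e. w \<in> Linf {t0..s} \<longrightarrow> 0 \<le> e \<longrightarrow>
    (AE \<tau> in lebesgue_on {t0..s}. norm (w \<tau>) \<le> e) \<longrightarrow> norm (conv t0 w s) \<le> \<kappa> * e"
proof -
  obtain c where c: "c \<ge> 0"
    "AE s in lebesgue_on {t0..b}. \<Phi> s \<in> Linf {t0..s} \<and> (AE \<tau> in lebesgue_on {t0..s}. norm (\<Phi> s \<tau>) \<le> c)"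
    by (rule kernel_slices_bounded)
  obtain K where K: "K \<ge> 0" "\<And>(Q :: real^'n^'n) x. norm (Q *v x) \<le> norm Q * norm x * K"
    using bounded_bilinear.nonneg_bounded[OF bounded_bilinear_matrix_vector_mult] by blast
  obtain k where k: "k > 0" "\<And>v. norm (Bt *v v) \<le> norm v * k"
    using bounded_linear.pos_bounded[OF matrix_vector_mul_bounded_linear[of Bt]] by blast
  define \<kappa> where "\<kappa> = c * k * K * \<bar>b - t0\<bar>"
  have "AE s in lebesgue_on {t0..b}. s \<in> {t0..b}" by (rule AE_Icc_mem)
  then have "AE s in lebesgue_on {t0..b}. \<forall>w e. w \<in> Linf {t0..s} \<longrightarrow> 0 \<le> e \<longrightarrow>
    (AE \<tau> in lebesgue_on {t0..s}. norm (w \<tau>) \<le> e) \<longrightarrow> norm (conv t0 w s) \<le> \<kappa> * e"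
    using c(2)
  proof (eventually_elim, intro allI impI)
    fix s e :: real and w :: "real \<Rightarrow> real^'m"
    assume s: "s \<in> {t0..b}" and \<Phi>: "\<Phi> s \<in> Linf {t0..s} \<and> (AE \<tau> in lebesgue_on {t0..s}. norm (\<Phi> s \<tau>) \<le> c)"
      and w: "w \<in> Linf {t0..s}" and e: "0 \<le> e" and bd: "AE \<tau> in lebesgue_on {t0..s}. norm (w \<tau>) \<le> e"
    have "norm (conv t0 w s) \<le> (c * (e * k) * K) * (s - t0)"
      unfolding conv_def
    proof (rule norm_LINT_le_const[OF conv_integrand_Linf])
      show "AE \<tau> in lebesgue_on {t0..s}. norm ((\<Phi> s \<tau> ** Bt) *v w \<tau>) \<le> c * (e * k) * K"
        using conjunct2[OF \<Phi>] bd
      proof eventually_elim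
        case (elim \<tau>)
        have "norm (Bt *v w \<tau>) \<le> e * k"
          using k(2)[of "w \<tau>"] mult_right_mono[OF elim(2), of k] k(1) by linarith
        have "norm ((\<Phi> s \<tau> ** Bt) *v w \<tau>) = norm (\<Phi> s \<tau> *v (Bt *v w \<tau>))"
          by (simp add: matrix_vector_mul_assoc)
        also have "\<dots> \<le> norm (\<Phi> s \<tau>) * norm (Bt *v w \<tau>) * K" by (rule K)
        also have "\<dots> \<le> c * (e * k) * K"
          using elim c K k e \<open>norm (Bt *v w \<tau>) \<le> e * k\<close> by (intro mult_right_mono mult_mono) auto
        finally show ?case .
      qed
    qed (use \<Phi> w s in auto)
    also have "\<dots> \<le> (c * (e * k) * K) * \<bar>b - t0\<bar>"
      using s c e k K by (intro mult_left_mono) auto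
    finally show "norm (conv t0 w s) \<le> \<kappa> * e" by (simp add: \<kappa>_def mult_ac)
  qed
  moreover have "\<kappa> \<ge> 0" using c k K by (simp add: \<kappa>_def)
  ultimately show ?thesis using that by blast
qed

text \<open>Controls of the form \<open>h (x t) + v t\<close> cover both a Lipschitz feedback (\<open>v = 0\<close>) and a prescribed
  control (\<open>h = 0\<close>).\<close>

lemma state_equation_causal_lipschitz:
  fixes h :: "real^'n \<Rightarrow> real^'m"
  assumes b: "t0 \<le> b" and h: "Lh-lipschitz_on UNIV h" and v: "v \<in> Linf {t0..b}"
  obtains L where "causal_lipschitz (\<lambda>x. rhs (\<lambda>t. h (x t) + v t) x) t0 b L"
proof -
  obtain kA where kA: "kA > 0" "\<And>v. norm (A *v v) \<le> norm v * kA"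
    using bounded_linear.pos_bounded[OF matrix_vector_mul_bounded_linear[of A]] by blast
  obtain kB where kB: "kB > 0" "\<And>v. norm (B *v v) \<le> norm v * kB"
    using bounded_linear.pos_bounded[OF matrix_vector_mul_bounded_linear[of B]] by blast
  obtain \<kappa> where \<kappa>: "\<kappa> \<ge> 0" "AE s in lebesgue_on {t0..b}. \<forall>w e. w \<in> Linf {t0..s} \<longrightarrow> 0 \<le> e \<longrightarrow>
    (AE \<tau> in lebesgue_on {t0..s}. norm (w \<tau>) \<le> e) \<longrightarrow> norm (conv t0 w s) \<le> \<kappa> * e"
    by (rule conv_bound)
  have Lh: "Lh \<ge> 0" using h by (rule lipschitz_on_nonneg)
  have hd: "norm (h y - h z) \<le> Lh * norm (y - z)" for y z
    using lipschitz_onD[OF h, of y z] by (simp add: dist_norm)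
  have hx: "(\<lambda>t. h (x t)) \<in> Linf {t0..c}" if "continuous_on {t0..b} x" "c \<le> b" for x c
    using that by (intro Linf_continuous continuous_on_compose2[OF lipschitz_on_continuous_on[OF h]]
        continuous_on_subset[OF that(1)]) auto
  define L where "L = kA + Lh * kB + \<kappa> * Lh"
  have "causal_lipschitz (\<lambda>x. rhs (\<lambda>t. h (x t) + v t) x) t0 b L"
  proof
    show "t0 \<le> b" by (rule b)
    show "0 \<le> L" using kA kB \<kappa> Lh by (simp add: L_def)
    show "rhs (\<lambda>t. h (x t) + v t) x \<in> Linf {t0..b}" if "continuous_on {t0..b} x" for x
      using that by (intro rhs_Linf Linf_add hx v) auto
    fix x z :: "real \<Rightarrow> real^'n"
    assume x: "continuous_on {t0..b} x" and z: "continuous_on {t0..b} z"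
    show "AE s in lebesgue_on {t0..b}. \<forall>d. (\<forall>r\<in>{t0..s}. norm (x r - z r) \<le> d) \<longrightarrow>
      norm (rhs (\<lambda>t. h (x t) + v t) x s - rhs (\<lambda>t. h (z t) + v t) z s) \<le> L * d"
      using good_times \<kappa>(2)
    proof (eventually_elim, intro allI impI)
      fix s d
      assume s: "\<Phi> s \<in> Linf {t0..s} \<and> s \<in> {t0..b} \<and>
          memory s \<le> M"
        and cb: "\<forall>w e. w \<in> Linf {t0..s} \<longrightarrow> 0 \<le> e \<longrightarrow>
          (AE \<tau> in lebesgue_on {t0..s}. norm (w \<tau>) \<le> e) \<longrightarrow> norm (conv t0 w s) \<le> \<kappa> * e"
        and d: "\<forall>r\<in>{t0..s}. norm (x r - z r) \<le> d"
      have ds: "norm (x s - z s) \<le> d" using d s by auto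
      then have d0: "0 \<le> d" using norm_ge_zero order_trans by blast
      have sb: "s \<le> b" using s by simp
      have hxs: "(\<lambda>t. h (x t)) \<in> Linf {t0..s}" "(\<lambda>t. h (z t)) \<in> Linf {t0..s}" "v \<in> Linf {t0..s}"
        using hx[OF x sb] hx[OF z sb] Linf_Icc_mono[OF v _ sb] by auto
      have hb: "norm (h (x r) - h (z r)) \<le> Lh * d" if "r \<in> {t0..s}" for r
        using hd[of "x r" "z r"] mult_left_mono[OF bspec[OF d that] Lh] by linarith
      have c1: "norm (conv t0 (\<lambda>\<tau>. h (x \<tau>) - h (z \<tau>)) s) \<le> \<kappa> * (Lh * d)"
      proof (rule cb[rule_format])
        show "(\<lambda>\<tau>. h (x \<tau>) - h (z \<tau>)) \<in> Linf {t0..s}" by (intro Linf_diff hxs)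
        show "0 \<le> Lh * d" using Lh d0 by simp
        show "AE \<tau> in lebesgue_on {t0..s}. norm (h (x \<tau>) - h (z \<tau>)) \<le> Lh * d"
          using hb by (simp add: AE_lebesgue_on_iff)
      qed
      have "conv t0 (\<lambda>\<tau>. (h (x \<tau>) + v \<tau> + \<gamma> \<tau>) - (h (z \<tau>) + v \<tau> + \<gamma> \<tau>)) s =
          conv t0 (\<lambda>\<tau>. h (x \<tau>) + v \<tau> + \<gamma> \<tau>) s - conv t0 (\<lambda>\<tau>. h (z \<tau>) + v \<tau> + \<gamma> \<tau>) s"
        using s by (intro conv_diff Linf_add hxs disturbances_Linf) auto
      then have eq: "rhs (\<lambda>t. h (x t) + v t) x s - rhs (\<lambda>t. h (z t) + v t) z s =
          A *v (x s - z s) + B *v (h (x s) - h (z s)) + conv t0 (\<lambda>\<tau>. h (x \<tau>) - h (z \<tau>)) s"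
        by (simp add: rhs_def matrix_vector_mult_diff_distrib matrix_vector_right_distrib)
      have "norm (A *v (x s - z s)) \<le> d * kA"
        using kA(2)[of "x s - z s"] mult_right_mono[OF ds, of kA] kA(1) by linarith
      moreover have "norm (B *v (h (x s) - h (z s))) \<le> (Lh * d) * kB"
      proof -
        have "norm (h (x s) - h (z s)) \<le> Lh * d" using hb[of s] s by simp
        from mult_right_mono[OF this, of kB] show ?thesis
          using kB(2)[of "h (x s) - h (z s)"] kB(1) by linarith
      qed
      ultimately have "norm (rhs (\<lambda>t. h (x t) + v t) x s - rhs (\<lambda>t. h (z t) + v t) z s)
          \<le> d * kA + (Lh * d) * kB + \<kappa> * (Lh * d)"
        unfolding eq using c1 by (intro norm_triangle_mono)
      then show "norm (rhs (\<lambda>t. h (x t) + v t) x s - rhs (\<lambda>t. h (z t) + v t) z s) \<le> L * d"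
        by (simp add: L_def algebra_simps)
    qed
  qed
  then show ?thesis by (rule that)
qed

theorem solves_unique:
  fixes h :: "real^'n \<Rightarrow> real^'m"
  assumes h: "Lh-lipschitz_on UNIV h" and v: "v \<in> Linf {t0..b}"
    and x: "solves x0 b u x" "u \<in> Linf {t0..b}" "AE t in lebesgue_on {t0..b}. u t = h (x t) + v t"
    and z: "solves x0 b u' z" "u' \<in> Linf {t0..b}" "AE t in lebesgue_on {t0..b}. u' t = h (z t) + v t"
    and t: "t \<in> {t0..b}"
  shows "x t = z t"
proof -
  have b: "t0 \<le> b" using t by auto
  obtain L where "causal_lipschitz (\<lambda>x. rhs (\<lambda>t. h (x t) + v t) x) t0 b L"
    by (rule state_equation_causal_lipschitz[OF b h v])
  then interpret causal_lipschitz "\<lambda>x. rhs (\<lambda>t. h (x t) + v t) x" t0 b L x0 .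
  have "solves x0 b (\<lambda>t. h (x t) + v t) x" "solves x0 b (\<lambda>t. h (z t) + v t) z"
    using solves_cong_AE[OF x(2,3,1)] solves_cong_AE[OF z(2,3,1)] .
  then have sol: "continuous_on {t0..b} x" "\<And>t. t \<in> {t0..b} \<Longrightarrow> x t = x0 + integral {t0..t} (rhs (\<lambda>t. h (x t) + v t) x)"
    "continuous_on {t0..b} z" "\<And>t. t \<in> {t0..b} \<Longrightarrow> z t = x0 + integral {t0..t} (rhs (\<lambda>t. h (z t) + v t) z)"
    by (simp_all add: solves_def)
  show ?thesis by (rule solution_unique[OF sol t])
qed

theorem solves_exists:
  fixes h :: "real^'n \<Rightarrow> real^'m"
  assumes h: "Lh-lipschitz_on UNIV h" and v: "\<And>b. v \<in> Linf {t0..b}"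
  obtains x where "\<And>b. solves x0 b (\<lambda>t. h (x t) + v t) x"
proof -
  have "\<exists>x. solves x0 b (\<lambda>t. h (x t) + v t) x" for b
  proof (cases "t0 \<le> b")
    case True
    obtain L where "causal_lipschitz (\<lambda>x. rhs (\<lambda>t. h (x t) + v t) x) t0 b L"
      by (rule state_equation_causal_lipschitz[OF True h v])
    then interpret causal_lipschitz "\<lambda>x. rhs (\<lambda>t. h (x t) + v t) x" t0 b L x0 .
    show ?thesis using solution_exists unfolding solves_def by metis
  qed (auto simp: solves_def)
  then obtain X where X: "\<And>b. solves x0 b (\<lambda>t. h (X b t) + v t) (X b)" by metis
  have hX: "(\<lambda>t. h (X c t) + v t) \<in> Linf {t0..b}" if "b \<le> c" for b c
    using X[of c] that by (intro Linf_add v Linf_continuous continuous_on_compose2[OF lipschitz_on_continuous_on[OF h]])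
      (auto simp: solves_def intro: continuous_on_subset)
  have agree: "X t t = X b t" if "t \<in> {t0..b}" for t b
    using that by (intro solves_unique[OF h v X[of t] hX _ solves_mono[OF X[of b]] hX]) auto
  have "solves x0 b (\<lambda>t. h (X t t) + v t) (\<lambda>t. X t t)" for b
    by (rule solves_cong[OF X[of b]]) (use agree[of _ b] in auto)
  then show ?thesis by (rule that)
qed

lemma solves_lipschitz:
  assumes "solves x0 b u x" "u \<in> Linf {t0..b}"
  obtains L where "L-lipschitz_on {t0..b} x"
proof -
  have F: "rhs u x \<in> Linf {t0..b}" using assms by (intro rhs_Linf) (auto simp: solves_def)
  have eq: "x t = x0 + integral {t0..t} (rhs u x)" if "t \<in> {t0..b}" for t
    using assms(1) that by (simp add: solves_def)
  show ?thesis by (rule integral_lipschitz_on[OF F eq that])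
qed

lemma solves_derivative_AE:
  assumes x: "solves x0 b u x" and u: "u \<in> Linf {t0..b}"
  shows "AE t in lebesgue_on {t0..b}. (x has_vector_derivative rhs u x t) (at t)"
proof -
  have F: "rhs u x integrable_on {t0..b}"
    using x u by (intro Linf_integrable_on_Icc rhs_Linf) (auto simp: solves_def)
  have "AE t in lebesgue. t \<notin> {t0, b}" by (rule AE_not_in) auto
  then have "AE t in lebesgue_on {t0..b}. t \<in> {t0<..<b}"
    by (subst AE_lebesgue_on_iff) (simp, rule eventually_mono, auto)
  then show ?thesis using indefinite_integral_has_vector_derivative_AE[OF F]
  proof eventually_elim
    case (elim t)
    have "((\<lambda>s. x0 + integral {t0..s} (rhs u x)) has_vector_derivative 0 + rhs u x t) (at t)"
      by (intro has_vector_derivative_add has_vector_derivative_const elim(2))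
    then have "((\<lambda>s. x0 + integral {t0..s} (rhs u x)) has_vector_derivative rhs u x t) (at t)" by simp
    then show ?case
    proof (rule has_vector_derivative_transform_within_open)
      show "open {t0<..<b}" "t \<in> {t0<..<b}" using elim(1) by auto
      show "x0 + integral {t0..s} (rhs u x) = x s" if "s \<in> {t0<..<b}" for s
        using x that by (auto simp: solves_def)
    qed
  qed
qed

lemma good_times_gain: "AE t in lebesgue_on {t0..b}. \<Phi> t \<in> Linf {t0..t} \<and> t \<in> {t0..b} \<and>
    memory t \<le> M \<and>
    N (C *v (B *v \<gamma> t + p t)) + N (C *v conv t0 \<gamma> t) + \<delta> \<le> \<rho> * (1 - M)"
proof -
  have "AE t in lebesgue_on {t0..b}. \<rho> \<ge> (N (C *v (B *v \<gamma> t + p t))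
      + (LINT \<tau>:{t0..t}|lebesgue. N ((C ** \<Phi> t \<tau> ** Bt) *v \<gamma> \<tau>)) + \<delta>) / (1 - M)"
    by (rule AE_lebesgue_on_mono[OF gain_condition]) auto
  then show ?thesis using good_times
  proof eventually_elim
    case (elim t)
    have "N (C *v conv t0 \<gamma> t) = N (LINT \<tau>:{t0..t}|lebesgue. (C ** \<Phi> t \<tau> ** Bt) *v \<gamma> \<tau>)"
      using elim by (simp add: LINT_matrix_conv disturbances_Linf)
    also have "\<dots> \<le> (LINT \<tau>:{t0..t}|lebesgue. N ((C ** \<Phi> t \<tau> ** Bt) *v \<gamma> \<tau>))"
      using elim by (intro weighted_norm_LINT_le slice_integrand_Linf disturbances_Linf) auto
    finally show ?case using elim memory_small by (auto simp: pos_divide_le_eq)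
  qed
qed

lemma Lyapunov_form: "y \<bullet> (P *v (\<Lambda> *v y)) \<le> 0"
proof -
  have "y \<bullet> ((transpose \<Lambda> ** P) *v y) = (\<Lambda> *v y) \<bullet> (P *v y)"
    by (metis dot_lmul_matrix inner_commute matrix_vector_mul_assoc transpose_matrix_vector)
  also have "\<dots> = y \<bullet> (P *v (\<Lambda> *v y))" by (rule form_commute)
  finally have "y \<bullet> ((transpose \<Lambda> ** P + P ** \<Lambda>) *v y) = 2 * (y \<bullet> (P *v (\<Lambda> *v y)))"
    by (simp add: matrix_vector_mult_add_rdistrib inner_add_right matrix_vector_mul_assoc)
  moreover have "y \<bullet> ((transpose \<Lambda> ** P + P ** \<Lambda>) *v y) \<le> 0"
    using Lyapunov by (simp add: neg_semidefinite_def)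
  ultimately show ?thesis by linarith
qed

lemma output_has_vector_derivative:
  "(x has_vector_derivative d) (at t) \<Longrightarrow> ((\<lambda>s. C *v x s) has_vector_derivative C *v d) (at t)"
  by (rule bounded_linear.has_vector_derivative[OF matrix_vector_mul_bounded_linear])

lemma output_rhs:
  "C *v rhs u x t = \<Lambda> *v (C *v x t) + C *v (B *v (u t + \<gamma> t)) + C *v p t + C *v conv t0 (\<lambda>\<tau>. u \<tau> + \<gamma> \<tau>) t"
  using CA by (simp add: rhs_def matrix_vector_right_distrib matrix_vector_mul_assoc)

text \<open>The derivative of \<open>N y\<close> is the form of \<open>y\<close> with \<open>y'\<close>, divided by \<open>N y\<close>. The relay contributes
  exactly \<open>- \<rho>\<close>, the drift \<open>\<Lambda> y\<close> nothing positive, and by the Cauchy--Schwarz inequality the remaining terms at most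
  their norms, whose sum is at most \<open>\<rho> - \<delta>\<close> by the gain condition and the contraction.\<close>

lemma output_norm_rate:
  assumes der: "(x has_vector_derivative rhs u x t) (at t)"
    and good: "\<Phi> t \<in> Linf {t0..t} \<and> t \<in> {t0..b} \<and>
      memory t \<le> M \<and>
      N (C *v (B *v \<gamma> t + p t)) + N (C *v conv t0 \<gamma> t) + \<delta> \<le> \<rho> * (1 - M)"
    and u: "u \<in> Linf {t0..t}" "AE \<tau> in lebesgue_on {t0..t}. gauge_norm (u \<tau>) \<le> \<rho>"
    and nz: "C *v x t \<noteq> 0" and ut: "u t = uhat (x t)"
  shows "\<exists>v\<le>-\<delta>. ((\<lambda>s. N (C *v x s)) has_vector_derivative v) (at t)"
proof -
  define y where "y = C *v x t"
  have Ny: "N y > 0" using nz by (simp add: y_def)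
  have CBu: "C *v (B *v u t) = (- (\<rho> / N y)) *\<^sub>R y"
  proof -
    have "u t = (- (\<rho> / N y)) *\<^sub>R (D *v y)" by (simp add: ut feedback_def y_def)
    then show ?thesis by (simp only: matrix_vector_mult_scaleR CB_D)
  qed
  define z where "z = C *v (B *v \<gamma> t + p t) + C *v conv t0 \<gamma> t + C *v conv t0 u t"
  have "N (C *v conv t0 u t) \<le> M * \<rho>"
    using good u gain_pos by (intro conv_contraction) auto
  then have Nz: "N z \<le> \<rho> - \<delta>"
    using good weighted_norm_triangle[of "C *v (B *v \<gamma> t + p t) + C *v conv t0 \<gamma> t" "C *v conv t0 u t"]
      weighted_norm_triangle[of "C *v (B *v \<gamma> t + p t)" "C *v conv t0 \<gamma> t"]
    by (simp add: z_def algebra_simps)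
  have "C *v rhs u x t = \<Lambda> *v y + (- (\<rho> / N y)) *\<^sub>R y + z"
  proof -
    have "C *v conv t0 (\<lambda>\<tau>. u \<tau> + \<gamma> \<tau>) t = C *v conv t0 u t + C *v conv t0 \<gamma> t"
      using good u(1) by (simp add: conv_add disturbances_Linf matrix_vector_right_distrib)
    then show ?thesis
      unfolding output_rhs z_def matrix_vector_right_distrib CBu y_def[symmetric] by (simp add: ac_simps)
  qed
  then have "y \<bullet> (P *v (C *v rhs u x t)) = y \<bullet> (P *v (\<Lambda> *v y)) + (- (\<rho> / N y)) * (y \<bullet> (P *v y)) + y \<bullet> (P *v z)"
    by (simp only: matrix_vector_right_distrib matrix_vector_mult_scaleR inner_add_right inner_scaleR_right)
  also have "\<dots> \<le> 0 + (- (\<rho> / N y)) * (N y * N y) + N y * (\<rho> - \<delta>)"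
    using Lyapunov_form[of y] weighted_Cauchy_Schwarz[of y z] mult_left_mono[OF Nz, of "N y"]
    by (simp add: weighted_norm_sq)
  also have "\<dots> = N y * (- \<delta>)" using Ny by (simp add: algebra_simps)
  finally have "(y \<bullet> (P *v (C *v rhs u x t))) / N y \<le> - \<delta>"
    using Ny by (simp add: pos_divide_le_eq mult.commute)
  moreover have "((\<lambda>s. N (C *v x s)) has_vector_derivative (y \<bullet> (P *v (C *v rhs u x t))) / N y) (at t)"
    unfolding y_def by (rule weighted_norm_has_vector_derivative[OF output_has_vector_derivative[OF der] nz])
  ultimately show ?thesis by blast
qed

lemma output_norm_absolutely_continuous:
  assumes "solves x0 b u x" "u \<in> Linf {t0..b}" "t0 \<le> a" "c \<le> b"
  shows "absolutely_continuous_on {a..c} (\<lambda>t. N (C *v x t))"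
proof -
  obtain L where L: "L-lipschitz_on {t0..b} x" by (rule solves_lipschitz[OF assms(1,2)])
  obtain K where K: "K > 0" "\<And>y. N y \<le> K * norm y"
    by (rule weighted_norm_le_norm) (blast intro: that)+
  obtain k where k: "k > 0" "\<And>v. norm (C *v v) \<le> norm v * k"
    using bounded_linear.pos_bounded[OF matrix_vector_mul_bounded_linear[of C]] by blast
  have "(K * k * L)-lipschitz_on {a..c} (\<lambda>t. N (C *v x t))"
  proof (rule lipschitz_onI)
    fix s t assume st: "s \<in> {a..c}" "t \<in> {a..c}"
    have "dist (N (C *v x s)) (N (C *v x t)) \<le> N (C *v (x s - x t))"
      using weighted_norm_diff[of "C *v x s" "C *v x t"] by (simp add: dist_real_def matrix_vector_mult_diff_distrib)
    also have "\<dots> \<le> K * norm (C *v (x s - x t))" by (rule K)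
    also have "\<dots> \<le> K * (norm (x s - x t) * k)" using K k by (intro mult_left_mono) auto
    also have "\<dots> \<le> K * ((L * dist s t) * k)"
      using lipschitz_onD[OF L, of s t] st assms(3,4) K k by (intro mult_left_mono mult_right_mono) (auto simp: dist_norm)
    finally show "dist (N (C *v x s)) (N (C *v x t)) \<le> K * k * L * dist s t" by (simp add: mult_ac)
  qed (use K k lipschitz_on_nonneg[OF L] in auto)
  then show ?thesis by (rule lipschitz_imp_absolutely_continuous_on)
qed

lemma output_norm_decrease:
  assumes x: "solves x0 b u x" and u: "u \<in> Linf {t0..b}"
    and bd: "AE \<tau> in lebesgue_on {t0..b}. gauge_norm (u \<tau>) \<le> \<rho>"
    and ac: "t0 \<le> a" "a \<le> c" "c \<le> b"
    and fb: "AE t in lebesgue_on {a..c}. C *v x t \<noteq> 0 \<and> u t = uhat (x t)"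
  shows "N (C *v x c) - N (C *v x a) \<le> - \<delta> * (c - a)"
proof (rule absolutely_continuous_increment_le[OF output_norm_absolutely_continuous[OF x u ac(1,3)] ac(2)])
  have "AE t in lebesgue_on {a..c}. (x has_vector_derivative rhs u x t) (at t)"
    using ac by (intro AE_lebesgue_on_mono[OF solves_derivative_AE[OF x u]]) auto
  moreover have "AE t in lebesgue_on {a..c}. \<Phi> t \<in> Linf {t0..t} \<and> t \<in> {t0..b} \<and>
    memory t \<le> M \<and>
    N (C *v (B *v \<gamma> t + p t)) + N (C *v conv t0 \<gamma> t) + \<delta> \<le> \<rho> * (1 - M)"
    using ac by (intro AE_lebesgue_on_mono[OF good_times_gain[of b]]) auto
  ultimately show "AE t in lebesgue_on {a..c}. \<exists>v\<le>- \<delta>. ((\<lambda>t. N (C *v x t)) has_vector_derivative v) (at t)"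
    using fb
  proof eventually_elim
    case (elim t)
    have ut: "u \<in> Linf {t0..t}" using elim by (intro Linf_Icc_mono[OF u]) auto
    have "AE \<tau> in lebesgue_on {t0..t}. gauge_norm (u \<tau>) \<le> \<rho>"
      using elim by (intro AE_lebesgue_on_mono[OF bd]) auto
    from output_norm_rate[OF elim(1,2) ut this] show ?case using elim(3) by blast
  qed
qed

text \<open>Utkin solutions in workable form: the Filippov inclusion is replaced by its explicit description
  and the differential equation by the integral equation. The two lemmas that relate it to
  \<^const>\<open>equivalent_control\<close> and \<^const>\<open>utkin_solution\<close> show that nothing is lost.\<close>

definition "sliding_solution x0 u x \<longleftrightarrow> (\<forall>b. u \<in> Linf {t0..b}) \<and> (\<forall>b. solves x0 b u x) \<and>
  (AE t in lebesgue_on {t0..}. gauge_norm (u t) \<le> \<rho> \<and> (C *v x t \<noteq> 0 \<longrightarrow> u t = uhat (x t)))"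

lemma continuous_output_norm:
  "solves x0 b u x \<Longrightarrow> t0 \<le> a \<Longrightarrow> c \<le> b \<Longrightarrow> continuous_on {a..c} (\<lambda>t. N (C *v x t))"
  by (intro continuous_on_compose2[OF continuous_weighted_norm[of UNIV]]
      continuous_on_compose2[OF matrix_vector_mult_linear_continuous_on[of UNIV C]])
    (auto simp: solves_def intro: continuous_on_subset)

theorem sliding_solution_reaches:
  assumes "sliding_solution x0 u x"
  obtains T where "reaching_time t0 (\<lambda>t. C *v x t) T" "T \<in> {t0..t0 + N (C *v x0) / \<delta>}"
proof -
  have u: "u \<in> Linf {t0..b}" and x: "solves x0 b u x" for b
    using assms by (auto simp: sliding_solution_def)
  have fb: "AE t in lebesgue_on {t0..}. gauge_norm (u t) \<le> \<rho> \<and> (C *v x t \<noteq> 0 \<longrightarrow> u t = uhat (x t))"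
    using assms by (simp add: sliding_solution_def)
  define V where "V t = N (C *v x t)" for t
  have dec: "V c - V a \<le> - \<delta> * (c - a)" if ac: "t0 \<le> a" "a \<le> c" "\<And>t. a < t \<Longrightarrow> t \<le> c \<Longrightarrow> V t > 0" for a c
    unfolding V_def
  proof (rule output_norm_decrease[OF x[of c] u[of c]])
    show "AE \<tau> in lebesgue_on {t0..c}. gauge_norm (u \<tau>) \<le> \<rho>"
      using AE_lebesgue_on_mono[OF fb, of "{t0..c}"] by (auto elim: eventually_mono)
    have "AE t in lebesgue_on {a..c}. gauge_norm (u t) \<le> \<rho> \<and> (C *v x t \<noteq> 0 \<longrightarrow> u t = uhat (x t))"
      using ac(1) by (intro AE_lebesgue_on_mono[OF fb]) auto
    moreover have "AE t in lebesgue_on {a..c}. a < t \<and> t \<le> c" by (rule AE_Icc_gt)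
    ultimately show "AE t in lebesgue_on {a..c}. C *v x t \<noteq> 0 \<and> u t = uhat (x t)"
    proof eventually_elim
      case (elim t)
      then have "V t > 0" using ac(3) by auto
      then show ?case using elim by (auto simp: V_def)
    qed
  qed (use ac in auto)
  have xt0: "x t0 = x0" using x[of t0] by (auto simp: solves_def)
  define b0 where "b0 = t0 + V t0 / \<delta>"
  have b0: "t0 \<le> b0" using margin_pos by (simp add: b0_def V_def)
  have cont: "continuous_on {t0..b} V" for b
    unfolding V_def[abs_def] by (rule continuous_output_norm[OF x[of b]]) auto
  have nonneg: "V t \<ge> 0" for t by (simp add: V_def)
  define Z where "Z = {t \<in> {t0..b0}. V t = 0}"
  have "Z \<noteq> {}"
  proof
    assume "Z = {}"
    then have pos: "V t > 0" if "t \<in> {t0..b0}" for t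
      using that nonneg[of t] by (force simp: Z_def less_le)
    have "V b0 - V t0 \<le> - \<delta> * (b0 - t0)" by (rule dec) (use pos b0 in auto)
    also have "\<dots> = - V t0" using margin_pos by (simp add: b0_def)
    finally show False using pos[of b0] b0 by simp
  qed
  moreover have "compact Z"
  proof -
    have "closed Z" unfolding Z_def by (intro continuous_closed_preimage_constant cont) auto
    then show ?thesis by (auto simp: Z_def compact_eq_bounded_closed intro: bounded_subset[of "{t0..b0}"])
  qed
  ultimately obtain T where T: "T \<in> Z" "\<And>t. t \<in> Z \<Longrightarrow> T \<le> t" using compact_attains_inf[of Z] by auto
  have "V t = 0" if "t \<ge> T" for t
  proof (rule vanishing_persists[where T=T and b=t and V=V])
    show "continuous_on {T..t} V" using T(1) by (intro continuous_on_subset[OF cont[of t]]) (auto simp: Z_def)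
    fix a c assume ac: "T \<le> a" "a \<le> c" "c \<le> t" and "\<And>t. a < t \<Longrightarrow> t \<le> c \<Longrightarrow> V t > 0"
    then have "V c - V a \<le> - \<delta> * (c - a)" using T(1) by (intro dec) (auto simp: Z_def)
    also have "\<dots> \<le> 0" using ac margin_pos by simp
    finally show "V c \<le> V a" by simp
  qed (use T(1) nonneg that in \<open>auto simp: Z_def\<close>)
  moreover have "V t \<noteq> 0" if "t0 \<le> t" "t < T" for t
    using T that by (force simp: Z_def)
  ultimately have "reaching_time t0 (\<lambda>t. C *v x t) T"
    using T(1) by (auto simp: reaching_time_def V_def Z_def)
  then show ?thesis using T(1) by (intro that[of T]) (auto simp: Z_def b0_def V_def xt0)
qed

lemma equivalent_control_imp_sliding_solution:
  assumes x: "utkin_solution A B Bt \<Phi> \<gamma> p uhat t0 x0 x"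
    and eq: "equivalent_control A B Bt \<Phi> \<gamma> p uhat t0 x u"
  shows "sliding_solution x0 u x"
proof -
  have um: "u \<in> borel_measurable (lebesgue_on {t0..})"
    and uF: "AE t in lebesgue_on {t0..}. u t \<in> filippov uhat (x t)"
    and der: "AE t in lebesgue_on {t0..}. (x has_vector_derivative rhs u x t) (at t)"
    using eq by (simp_all add: equivalent_control_def rhs_def conv_def)
  have fb: "AE t in lebesgue_on {t0..}. gauge_norm (u t) \<le> \<rho> \<and> (C *v x t \<noteq> 0 \<longrightarrow> u t = uhat (x t))"
    using uF by eventually_elim (use filippov_feedback_bounded filippov_feedback_regular in auto)
  obtain k where k: "k > 0" "\<And>u. norm u \<le> k * gauge_norm u"
    by (rule norm_le_gauge_norm) (blast intro: that)+
  have uL: "u \<in> Linf {t0..b}" for b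
  proof (rule LinfI)
    show "u \<in> borel_measurable (lebesgue_on {t0..b})" by (rule measurable_restrict_mono[OF um]) auto
    have "AE t in lebesgue_on {t0..b}. gauge_norm (u t) \<le> \<rho> \<and> (C *v x t \<noteq> 0 \<longrightarrow> u t = uhat (x t))"
      by (rule AE_lebesgue_on_mono[OF fb]) auto
    then show "AE t in lebesgue_on {t0..b}. norm (u t) \<le> k * \<rho>"
      by eventually_elim (meson k mult_left_mono less_imp_le order_trans)
  qed
  have "solves x0 b u x" for b
    unfolding solves_def
  proof (intro conjI ballI)
    have ac: "absolutely_continuous_on {t0..c} x" if "t0 \<le> c" for c
      using x that by (simp add: utkin_solution_def)
    show "continuous_on {t0..b} x"
      by (cases "t0 \<le> b") (auto intro: absolutely_continuous_imp_continuous_on ac)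
    fix t assume t: "t \<in> {t0..b}"
    have "(rhs u x has_integral (x t - x t0)) {t0..t}"
      using t by (intro absolutely_continuous_has_integral ac AE_lebesgue_on_mono[OF der]) auto
    then show "x t = x0 + integral {t0..t} (rhs u x)"
      using x by (simp add: integral_unique utkin_solution_def)
  qed
  then show ?thesis using uL fb by (simp add: sliding_solution_def)
qed

lemma sliding_solution_imp_utkin:
  assumes s: "sliding_solution x0 u x"
  shows "equivalent_control A B Bt \<Phi> \<gamma> p uhat t0 x u" "utkin_solution A B Bt \<Phi> \<gamma> p uhat t0 x0 x"
proof -
  have u: "u \<in> Linf {t0..b}" and x: "solves x0 b u x" for b
    using s by (auto simp: sliding_solution_def)
  have fb: "AE t in lebesgue_on {t0..}. gauge_norm (u t) \<le> \<rho> \<and> (C *v x t \<noteq> 0 \<longrightarrow> u t = uhat (x t))"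
    using s by (simp add: sliding_solution_def)
  have "AE t in lebesgue_on {t0..}. u t \<in> filippov uhat (x t)"
    using fb
  proof eventually_elim
    case (elim t)
    then show ?case
      by (cases "C *v x t = 0") (use filippov_feedback_sliding filippov_feedback_self in auto)
  qed
  moreover have "AE t in lebesgue_on {t0..}. (x has_vector_derivative rhs u x t) (at t)"
    by (intro AE_lebesgue_on_atLeast solves_derivative_AE[OF x u])
  moreover have "u \<in> borel_measurable (lebesgue_on {t0..})"
    by (intro measurable_lebesgue_on_atLeast Linf_measurable[OF u])
  ultimately show eq: "equivalent_control A B Bt \<Phi> \<gamma> p uhat t0 x u"
    by (simp add: equivalent_control_def rhs_def conv_def)
  have "absolutely_continuous_on {t0..b} x" for b
  proof -
    obtain L where "L-lipschitz_on {t0..b} x" by (rule solves_lipschitz[OF x u])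
    then show ?thesis by (rule lipschitz_imp_absolutely_continuous_on)
  qed
  moreover have "x t0 = x0" using x[of t0] by (auto simp: solves_def)
  ultimately show "utkin_solution A B Bt \<Phi> \<gamma> p uhat t0 x0 x"
    using eq by (auto simp: utkin_solution_def)
qed

end

section \<open>Uniqueness of the sliding motion\<close>

context sliding_mode_system
begin

text \<open>The relay with its singularity at \<open>C *v x = 0\<close> smoothed to a linear feedback where \<open>N (C *v x) < \<epsilon>\<close>.\<close>

definition "regularised_feedback \<epsilon> x = (- \<rho> / max \<epsilon> (N (C *v x))) *\<^sub>R (D *v (C *v x))"

lemma regularised_feedback_eq: "N (C *v x) \<ge> \<epsilon> \<Longrightarrow> regularised_feedback \<epsilon> x = uhat x"
  by (simp add: regularised_feedback_def feedback_def max_absorb2)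

lemma gauge_norm_regularised:
  assumes "\<epsilon> > 0"
  shows "gauge_norm (regularised_feedback \<epsilon> x) \<le> \<rho>"
proof -
  have m: "max \<epsilon> (N (C *v x)) > 0" using assms by simp
  have "gauge_norm (regularised_feedback \<epsilon> x) = \<rho> * (N (C *v x) / max \<epsilon> (N (C *v x)))"
    using m gain_pos unfolding regularised_feedback_def gauge_norm_scaleR gauge_norm_D by simp
  also have "\<dots> \<le> \<rho> * 1" using m gain_pos by (intro mult_left_mono) (auto simp: pos_divide_le_eq)
  finally show ?thesis by simp
qed

lemma radial_clip_lipschitz:
  assumes e: "\<epsilon> > 0"
  shows "N ((1 / max \<epsilon> (N y)) *\<^sub>R y - (1 / max \<epsilon> (N z)) *\<^sub>R z) \<le> (2 / \<epsilon>) * N (y - z)"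
proof -
  let ?m = "max \<epsilon> (N y)" and ?k = "max \<epsilon> (N z)"
  have m: "?m > 0" "?k > 0" "?m \<ge> \<epsilon>" using e by auto
  have "(1 / ?m) *\<^sub>R y - (1 / ?k) *\<^sub>R z = (1 / ?m) *\<^sub>R (y - z) + (1 / ?m - 1 / ?k) *\<^sub>R z"
    by (simp add: algebra_simps)
  also have "N \<dots> \<le> N ((1 / ?m) *\<^sub>R (y - z)) + N ((1 / ?m - 1 / ?k) *\<^sub>R z)" by (rule weighted_norm_triangle)
  also have "N ((1 / ?m) *\<^sub>R (y - z)) \<le> (1 / \<epsilon>) * N (y - z)"
    using m e unfolding weighted_norm_scaleR by (intro mult_right_mono) (auto simp: frac_le)
  also have "N ((1 / ?m - 1 / ?k) *\<^sub>R z) \<le> (1 / \<epsilon>) * N (y - z)"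
  proof -
    have "\<bar>?k - ?m\<bar> \<le> N (y - z)" using weighted_norm_diff[of y z] by linarith
    moreover have "1 / ?m - 1 / ?k = (?k - ?m) / (?m * ?k)" using m by (simp add: diff_frac_eq mult.commute)
    ultimately have "\<bar>1 / ?m - 1 / ?k\<bar> * N z \<le> (N (y - z) / (?m * ?k)) * ?k"
      using m by (intro mult_mono) (auto simp: divide_right_mono)
    also have "\<dots> = (1 / ?m) * N (y - z)" using m by simp
    also have "\<dots> \<le> (1 / \<epsilon>) * N (y - z)" using m e by (intro mult_right_mono) (auto simp: frac_le)
    finally show ?thesis by simp
  qed
  finally show ?thesis by simp
qed

lemma regularised_feedback_lipschitz:
  assumes e: "\<epsilon> > 0"
  obtains L where "L-lipschitz_on UNIV (regularised_feedback \<epsilon>)"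
proof -
  obtain l where l: "l > 0" "\<And>u. norm u \<le> l * gauge_norm u"
    by (rule norm_le_gauge_norm) (blast intro: that)+
  obtain K where K: "K > 0" "\<And>y. N y \<le> K * norm y"
    by (rule weighted_norm_le_norm) (blast intro: that)+
  obtain k where k: "k > 0" "\<And>v. norm (C *v v) \<le> norm v * k"
    using bounded_linear.pos_bounded[OF matrix_vector_mul_bounded_linear[of C]] by blast
  have "(l * (\<rho> * (2 / \<epsilon> * (K * k))))-lipschitz_on UNIV (regularised_feedback \<epsilon>)"
  proof (rule lipschitz_onI)
    fix x z
    let ?r = "\<lambda>x. (1 / max \<epsilon> (N (C *v x))) *\<^sub>R (C *v x)"
    have "regularised_feedback \<epsilon> x - regularised_feedback \<epsilon> z = (- \<rho>) *\<^sub>R (D *v (?r x - ?r z))"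
      by (simp add: regularised_feedback_def matrix_vector_mult_diff_distrib matrix_vector_mult_scaleR algebra_simps)
    then have "gauge_norm (regularised_feedback \<epsilon> x - regularised_feedback \<epsilon> z) = \<rho> * N (?r x - ?r z)"
      using gain_pos by (simp only: gauge_norm_scaleR gauge_norm_D)
    also have "\<dots> \<le> \<rho> * ((2 / \<epsilon>) * N (C *v x - C *v z))"
      using gain_pos by (intro mult_left_mono radial_clip_lipschitz e) auto
    also have "\<dots> \<le> \<rho> * ((2 / \<epsilon>) * (K * (k * norm (x - z))))"
    proof -
      have "N (C *v x - C *v z) \<le> K * norm (C *v (x - z))"
        using K(2)[of "C *v (x - z)"] by (simp add: matrix_vector_mult_diff_distrib)
      also have "\<dots> \<le> K * (k * norm (x - z))" using K k(2)[of "x - z"] by (simp add: mult.commute)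
      finally show ?thesis using gain_pos e by (intro mult_left_mono) auto
    qed
    finally have "l * gauge_norm (regularised_feedback \<epsilon> x - regularised_feedback \<epsilon> z)
        \<le> l * (\<rho> * ((2 / \<epsilon>) * (K * (k * norm (x - z)))))"
      using l by (intro mult_left_mono) auto
    with l(2)[of "regularised_feedback \<epsilon> x - regularised_feedback \<epsilon> z"]
    have "norm (regularised_feedback \<epsilon> x - regularised_feedback \<epsilon> z) \<le> l * (\<rho> * ((2 / \<epsilon>) * (K * (k * norm (x - z)))))"
      by (rule order_trans)
    then show "dist (regularised_feedback \<epsilon> x) (regularised_feedback \<epsilon> z) \<le> l * (\<rho> * (2 / \<epsilon> * (K * k))) * dist x z"
      by (simp add: dist_norm mult_ac)
  qed (use l K k gain_pos e in auto)
  then show ?thesis by (rule that)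
qed

lemma regular_phase_unique:
  assumes e: "\<epsilon> > 0"
    and x: "solves x0 b u x" "u \<in> Linf {t0..b}" "AE t in lebesgue_on {t0..b}. u t = regularised_feedback \<epsilon> (x t)"
    and z: "solves x0 b u' z" "u' \<in> Linf {t0..b}" "AE t in lebesgue_on {t0..b}. u' t = regularised_feedback \<epsilon> (z t)"
    and t: "t \<in> {t0..b}"
  shows "x t = z t"
proof -
  obtain L where L: "L-lipschitz_on UNIV (regularised_feedback \<epsilon>)" by (rule regularised_feedback_lipschitz[OF e])
  show ?thesis
    by (rule solves_unique[OF L Linf_zero x(1,2) _ z(1,2) _ t]) (use x z in simp_all)
qed

lemma linear_solves_unique:
  assumes "solves x0 b u x" "u \<in> Linf {t0..b}" "solves x0 b u' z" "u' \<in> Linf {t0..b}"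
    "AE t in lebesgue_on {t0..b}. u t = u' t" "t \<in> {t0..b}"
  shows "x t = z t"
proof -
  have h: "0-lipschitz_on UNIV (\<lambda>x :: real^'n. 0 :: real^'m)" by (rule lipschitz_onI) auto
  show ?thesis
    by (rule solves_unique[OF h assms(2) assms(1,2) _ assms(3,4) _ assms(6)])
      (use assms(5) in \<open>auto elim: eventually_mono\<close>)
qed

text \<open>The forcing term of the Volterra equation after \<open>T\<close>, for an arbitrary total input \<open>v\<close> before \<open>T\<close>; with the relay
  as control it is \<^const>\<open>free_term\<close>.\<close>

definition "past_forcing v T t = - (D *v (C *v p t + (LINT \<tau>:{t0..T}|lebesgue. (C ** \<Phi> t \<tau> ** Bt) *v v \<tau>)))"

lemma LINT_past_eq:
  assumes "\<Phi> t \<in> Linf {t0..t}" "v \<in> Linf {t0..T}" "t0 \<le> T" "T \<le> t"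
  shows "(LINT \<tau>:{t0..T}|lebesgue. (C ** \<Phi> t \<tau> ** Bt) *v v \<tau>) =
    C *v conv t0 (\<lambda>\<tau>. if \<tau> \<in> {t0..T} then v \<tau> else 0) t"
proof -
  let ?w = "\<lambda>\<tau>. if \<tau> \<in> {t0..T} then v \<tau> else 0"
  have w: "?w \<in> Linf {t0..t}" by (rule Linf_extend_by_zero[OF assms(2)]) auto
  have int: "(\<lambda>\<tau>. (C ** \<Phi> t \<tau> ** Bt) *v ?w \<tau>) \<in> Linf {t0..t}" by (rule slice_integrand_Linf[OF assms(1) w])
  have "C *v conv t0 ?w t = (LINT \<tau>:{t0..t}|lebesgue. (C ** \<Phi> t \<tau> ** Bt) *v ?w \<tau>)"
    by (rule LINT_matrix_conv[OF assms(1) w, symmetric])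
  also have "\<dots> = (LINT \<tau>:{t0..T}|lebesgue. (C ** \<Phi> t \<tau> ** Bt) *v ?w \<tau>)
      + (LINT \<tau>:{T..t}|lebesgue. (C ** \<Phi> t \<tau> ** Bt) *v ?w \<tau>)"
    by (rule LINT_combine_Icc[OF int assms(3,4)])
  also have "(LINT \<tau>:{t0..T}|lebesgue. (C ** \<Phi> t \<tau> ** Bt) *v ?w \<tau>) = (LINT \<tau>:{t0..T}|lebesgue. (C ** \<Phi> t \<tau> ** Bt) *v v \<tau>)"
    by (rule set_lebesgue_integral_cong) auto
  also have "(LINT \<tau>:{T..t}|lebesgue. (C ** \<Phi> t \<tau> ** Bt) *v ?w \<tau>) = (LINT \<tau>:{T..t}|lebesgue. 0)"
  proof (rule LINT_cong_AE_Icc)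
    show "(\<lambda>\<tau>. (C ** \<Phi> t \<tau> ** Bt) *v ?w \<tau>) \<in> Linf {T..t}" using assms(3) by (intro Linf_Icc_mono[OF int]) auto
    have "AE \<tau> in lebesgue_on {T..t}. T < \<tau>"
      by (rule eventually_mono[OF AE_Icc_gt]) simp
    then show "AE \<tau> in lebesgue_on {T..t}. (C ** \<Phi> t \<tau> ** Bt) *v ?w \<tau> = 0"
      by eventually_elim auto
  qed
  finally show ?thesis by (simp add: set_lebesgue_integral_def)
qed

lemma past_forcing_Linf:
  assumes v: "v \<in> Linf {t0..T}" and T: "t0 \<le> T"
  shows "past_forcing v T \<in> Linf {T..b}"
proof (rule Linf_AE_cong)
  let ?w = "\<lambda>\<tau>. if \<tau> \<in> {t0..T} then v \<tau> else 0"
  have w: "?w \<in> Linf {t0..b}" by (rule Linf_extend_by_zero[OF v]) auto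
  have full: "(\<lambda>t. - (D *v (C *v p t + C *v conv t0 ?w t))) \<in> Linf {t0..b}"
    by (intro Linf_uminus Linf_matrix_vector Linf_add disturbances_Linf conv_Linf w)
  show "(\<lambda>t. - (D *v (C *v p t + C *v conv t0 ?w t))) \<in> Linf {T..b}"
    by (rule Linf_Icc_mono[OF full T order_refl])
  show "AE t in lebesgue_on {T..b}. - (D *v (C *v p t + C *v conv t0 ?w t)) = past_forcing v T t"
    using good_times_from[OF T]
  proof eventually_elim
    case (elim t)
    have "(LINT \<tau>:{t0..T}|lebesgue. (C ** \<Phi> t \<tau> ** Bt) *v v \<tau>) = C *v conv t0 ?w t"
      using elim by (intro LINT_past_eq v T) auto
    then show ?case by (simp only: past_forcing_def)
  qed
qed simp

text \<open>Multiplication by \<open>C B\<close> turns the Volterra equation for the total input \<open>w\<close> into the balance of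
  the terms of \<open>C x'\<close>; the memory splits at \<open>T\<close> into the forcing term and the Volterra operator.\<close>

lemma sliding_identity_iff:
  assumes \<Phi>: "\<Phi> t \<in> Linf {t0..t}" "\<Phi> t \<in> Linf {T..t}" and T: "t0 \<le> T" "T \<le> t"
    and w: "w \<in> Linf {t0..t}" and v: "AE \<tau> in lebesgue_on {t0..T}. w \<tau> = v \<tau>"
  shows "w t = past_forcing v T t + volterra T w t \<longleftrightarrow>
    C *v (B *v w t) + C *v p t + C *v conv t0 w t = 0"
proof -
  have wT: "w \<in> Linf {t0..T}" "w \<in> Linf {T..t}" using T by (auto intro: Linf_Icc_mono[OF w])
  have int: "(\<lambda>\<tau>. (C ** \<Phi> t \<tau> ** Bt) *v w \<tau>) \<in> Linf {t0..t}" by (rule slice_integrand_Linf[OF \<Phi>(1) w])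
  define I where "I = (LINT \<tau>:{t0..T}|lebesgue. (C ** \<Phi> t \<tau> ** Bt) *v v \<tau>)"
  have "C *v conv t0 w t = (LINT \<tau>:{t0..t}|lebesgue. (C ** \<Phi> t \<tau> ** Bt) *v w \<tau>)"
    by (rule LINT_matrix_conv[OF \<Phi>(1) w, symmetric])
  also have "\<dots> = (LINT \<tau>:{t0..T}|lebesgue. (C ** \<Phi> t \<tau> ** Bt) *v w \<tau>)
      + (LINT \<tau>:{T..t}|lebesgue. (C ** \<Phi> t \<tau> ** Bt) *v w \<tau>)"
    by (rule LINT_combine_Icc[OF int T])
  also have "(LINT \<tau>:{t0..T}|lebesgue. (C ** \<Phi> t \<tau> ** Bt) *v w \<tau>) = I"
    unfolding I_def
  proof (rule LINT_cong_AE_Icc)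
    show "(\<lambda>\<tau>. (C ** \<Phi> t \<tau> ** Bt) *v w \<tau>) \<in> Linf {t0..T}" using T by (intro Linf_Icc_mono[OF int]) auto
    show "AE \<tau> in lebesgue_on {t0..T}. (C ** \<Phi> t \<tau> ** Bt) *v w \<tau> = (C ** \<Phi> t \<tau> ** Bt) *v v \<tau>"
      using v by eventually_elim simp
  qed
  also have "(LINT \<tau>:{T..t}|lebesgue. (C ** \<Phi> t \<tau> ** Bt) *v w \<tau>) = C *v conv T w t"
    by (rule LINT_matrix_conv[OF \<Phi>(2) wT(2)])
  finally have conv: "C *v conv t0 w t = I + C *v conv T w t" .
  have "w t = past_forcing v T t + volterra T w t \<longleftrightarrow> w t + D *v (C *v p t + C *v conv t0 w t) = 0"
    unfolding past_forcing_def volterra_op_eq[OF \<Phi>(2) wT(2)] I_def[symmetric] conv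
    by (simp add: matrix_vector_right_distrib eq_neg_iff_add_eq_0 algebra_simps)
  also have "\<dots> \<longleftrightarrow> C *v (B *v (w t + D *v (C *v p t + C *v conv t0 w t))) = 0"
    by (simp only: CB_eq_0_iff)
  also have "\<dots> \<longleftrightarrow> C *v (B *v w t) + C *v p t + C *v conv t0 w t = 0"
    by (simp add: matrix_vector_right_distrib add.assoc)
  finally show ?thesis .
qed

lemma sliding_phase_identity:
  assumes x: "solves x0 b u x" and u: "u \<in> Linf {t0..b}" and T: "t0 \<le> T"
    and zero: "\<And>t. t \<ge> T \<Longrightarrow> C *v x t = 0"
  shows "AE t in lebesgue_on {T..b}. sliding_balance u t"
proof -
  have "AE t in lebesgue_on {T..b}. T < t"
    by (rule eventually_mono[OF AE_Icc_gt]) simp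
  moreover have "AE t in lebesgue_on {T..b}. (x has_vector_derivative rhs u x t) (at t)"
    using T by (intro AE_lebesgue_on_mono[OF solves_derivative_AE[OF x u]]) auto
  ultimately show ?thesis
  proof eventually_elim
    case (elim t)
    have "((\<lambda>s. C *v x s) has_vector_derivative C *v rhs u x t) (at t)"
      by (rule output_has_vector_derivative[OF elim(2)])
    then have "((\<lambda>s. 0) has_vector_derivative C *v rhs u x t) (at t)"
      by (rule has_vector_derivative_transform_within_open[of _ _ _ "{T<..}"]) (use elim(1) zero in auto)
    then have "C *v rhs u x t = 0"
      using vector_derivative_unique_at[OF _ has_vector_derivative_const] by blast
    then show ?case unfolding output_rhs using zero[of t] elim(1) by simp
  qed
qed

lemma sliding_control_volterra:
  assumes s: "sliding_solution x0 u x" and T: "reaching_time t0 (\<lambda>t. C *v x t) T"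
  shows "AE t in lebesgue_on {T..b}. u t + \<gamma> t =
    free_term C B Bt \<Phi> \<gamma> p uhat t0 T x t + volterra T (\<lambda>t. u t + \<gamma> t) t"
    "AE t in lebesgue_on {t0..T}. u t = uhat (x t)"
proof -
  have u: "u \<in> Linf {t0..b}" and x: "solves x0 b u x" for b
    using s by (auto simp: sliding_solution_def)
  have Tt: "t0 \<le> T" "\<And>t. t0 \<le> t \<Longrightarrow> t < T \<Longrightarrow> C *v x t \<noteq> 0" "\<And>t. t \<ge> T \<Longrightarrow> C *v x t = 0"
    using T by (auto simp: reaching_time_def)
  show fb: "AE t in lebesgue_on {t0..T}. u t = uhat (x t)"
  proof -
    have "AE t in lebesgue_on {t0..T}. t0 \<le> t \<and> t < T" by (rule AE_Icc_lt)
    moreover have "AE t in lebesgue_on {t0..T}. gauge_norm (u t) \<le> \<rho> \<and> (C *v x t \<noteq> 0 \<longrightarrow> u t = uhat (x t))"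
      using s unfolding sliding_solution_def by (elim conjE, elim AE_lebesgue_on_mono) auto
    ultimately show ?thesis by eventually_elim (use Tt(2) in auto)
  qed
  then have v: "AE t in lebesgue_on {t0..T}. u t + \<gamma> t = \<gamma> t + uhat (x t)"
    by eventually_elim simp
  have "AE t in lebesgue_on {T..b}. sliding_balance u t"
    by (rule sliding_phase_identity[OF x u Tt(1)]) (rule Tt(3))
  then show "AE t in lebesgue_on {T..b}. u t + \<gamma> t =
    free_term C B Bt \<Phi> \<gamma> p uhat t0 T x t + volterra T (\<lambda>t. u t + \<gamma> t) t"
    using good_times_from[OF Tt(1)]
  proof eventually_elim
    case (elim t)
    have "u t + \<gamma> t = past_forcing (\<lambda>\<tau>. \<gamma> \<tau> + uhat (x \<tau>)) T t + volterra T (\<lambda>t. u t + \<gamma> t) t \<longleftrightarrow>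
      C *v (B *v (u t + \<gamma> t)) + C *v p t + C *v conv t0 (\<lambda>t. u t + \<gamma> t) t = 0"
      using elim Tt(1) v by (intro sliding_identity_iff Linf_add u disturbances_Linf) auto
    then show ?case using elim(1) by (simp add: past_forcing_def free_term_def)
  qed
qed

lemma free_term_Linf:
  assumes s: "sliding_solution x0 u x" and T: "reaching_time t0 (\<lambda>t. C *v x t) T"
  shows "free_term C B Bt \<Phi> \<gamma> p uhat t0 T x \<in> Linf {T..b}"
proof -
  have "u \<in> Linf {t0..T}" using s by (auto simp: sliding_solution_def)
  then have "(\<lambda>t. \<gamma> t + uhat (x t)) \<in> Linf {t0..T}"
    by (intro Linf_add disturbances_Linf Linf_AE_cong[OF _ _ sliding_control_volterra(2)[OF s T]]) auto
  then have "past_forcing (\<lambda>t. \<gamma> t + uhat (x t)) T \<in> Linf {T..b}"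
    using T by (intro past_forcing_Linf) (auto simp: reaching_time_def)
  then show ?thesis by (simp add: past_forcing_def[abs_def] free_term_def[abs_def])
qed

lemma volterra_solution_unique:
  assumes T: "t0 \<le> T" and v: "v \<in> Linf {T..b}" and w: "w \<in> Linf {T..b}"
    and "AE t in lebesgue_on {T..b}. v t = g t + volterra T v t"
    and "AE t in lebesgue_on {T..b}. w t = g t + volterra T w t"
  shows "AE t in lebesgue_on {T..b}. v t = w t"
proof -
  have "AE t in lebesgue_on {T..b}. v t - w t = 0"
  proof (rule volterra_equation_zero[OF T Linf_diff[OF v w]])
    show "AE t in lebesgue_on {T..b}. v t - w t = volterra T (\<lambda>t. v t - w t) t"
      using assms(4,5) volterra_op_diff_AE[OF v w] by eventually_elim simp
  qed
  then show ?thesis by eventually_elim simp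
qed

text \<open>Before \<open>T\<close> both outputs have a positive lower bound on every compact interval, so both solutions are solutions
  for the same regularised feedback and agree. By continuity the second output vanishes at
  \<open>T\<close> as well.\<close>

lemma reaching_times_le:
  assumes s: "sliding_solution x0 u x" and T: "reaching_time t0 (\<lambda>t. C *v x t) T"
    and s': "sliding_solution x0 u' x'" and T': "reaching_time t0 (\<lambda>t. C *v x' t) T'"
    and le: "T \<le> T'"
  shows "T = T'" "\<And>t. t \<in> {t0..T} \<Longrightarrow> x t = x' t"
proof -
  have u: "u \<in> Linf {t0..b}" and x: "solves x0 b u x" for b
    using s by (auto simp: sliding_solution_def)
  have u': "u' \<in> Linf {t0..b}" and x': "solves x0 b u' x'" for b
    using s' by (auto simp: sliding_solution_def)
  have Tt: "t0 \<le> T" using T by (auto simp: reaching_time_def)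
  have before: "x t = x' t" if t: "t \<in> {t0..<T}" for t
  proof -
    have pos: "N (C *v x r) > 0" "N (C *v x' r) > 0" if "r \<in> {t0..t}" for r
      using T T' le t that by (auto simp: reaching_time_def)
    have ne: "{t0..t} \<noteq> {}" using t by auto
    obtain r where r: "r \<in> {t0..t}" "\<And>q. q \<in> {t0..t} \<Longrightarrow> N (C *v x r) \<le> N (C *v x q)"
      using continuous_attains_inf[OF compact_Icc ne continuous_output_norm[OF x[of t] order_refl order_refl]] by blast
    obtain r' where r': "r' \<in> {t0..t}" "\<And>q. q \<in> {t0..t} \<Longrightarrow> N (C *v x' r') \<le> N (C *v x' q)"
      using continuous_attains_inf[OF compact_Icc ne continuous_output_norm[OF x'[of t] order_refl order_refl]] by blast
    define \<epsilon> where "\<epsilon> = min (N (C *v x r)) (N (C *v x' r'))"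
    have \<epsilon>: "\<epsilon> > 0" using pos r r' by (simp add: \<epsilon>_def)
    have inT: "AE q in lebesgue_on {t0..t}. q \<in> {t0..t}" by (simp add: AE_lebesgue_on_iff)
    have "AE q in lebesgue_on {t0..t}. u q = regularised_feedback \<epsilon> (x q)"
      using inT AE_lebesgue_on_mono[OF sliding_control_volterra(2)[OF s T], of "{t0..t}"] t
      by (auto elim!: eventually_elim2 simp: regularised_feedback_eq \<epsilon>_def min.coboundedI1 r)
    moreover have "AE q in lebesgue_on {t0..t}. u' q = regularised_feedback \<epsilon> (x' q)"
      using inT AE_lebesgue_on_mono[OF sliding_control_volterra(2)[OF s' T'], of "{t0..t}"] t le
      by (auto elim!: eventually_elim2 simp: regularised_feedback_eq \<epsilon>_def min.coboundedI2 r')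
    ultimately show ?thesis
      using t by (intro regular_phase_unique[OF \<epsilon> x u _ x' u']) auto
  qed
  have at: "x t = x' t" if t: "t \<in> {t0..T}" for t
  proof (cases "T = t0")
    case True
    then have "t = t0" using t by auto
    then show ?thesis using x[of t0] x'[of t0] by (simp add: solves_def)
  next
    case False
    have c: "continuous_on {t0..T} (\<lambda>t. x t - x' t)"
      using x[of T] x'[of T] by (intro continuous_intros) (auto simp: solves_def)
    have "closure {t0<..<T} = {t0..T}" using False Tt by simp
    have "x t - x' t = 0"
    proof (rule continuous_constant_on_closure[of "{t0<..<T}" "\<lambda>t. x t - x' t"])
      show "continuous_on (closure {t0<..<T}) (\<lambda>t. x t - x' t)"
        unfolding \<open>closure {t0<..<T} = {t0..T}\<close> by (rule c)
      show "t \<in> closure {t0<..<T}" unfolding \<open>closure {t0<..<T} = {t0..T}\<close> by (rule t)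
      show "\<And>t. t \<in> {t0<..<T} \<Longrightarrow> x t - x' t = 0" using before by auto
    qed
    then show ?thesis by simp
  qed
  have "C *v x' T = 0" using at[of T] T Tt by (auto simp: reaching_time_def)
  then show "T = T'" using T' Tt le by (auto simp: reaching_time_def)
  show "\<And>t. t \<in> {t0..T} \<Longrightarrow> x t = x' t" by (rule at)
qed

theorem sliding_solution_unique:
  assumes s: "sliding_solution x0 u x" and s': "sliding_solution x0 u' x'"
  shows "t \<ge> t0 \<Longrightarrow> x t = x' t"
proof -
  assume t: "t \<ge> t0"
  obtain T where T: "reaching_time t0 (\<lambda>t. C *v x t) T" by (rule sliding_solution_reaches[OF s])
  obtain T' where T': "reaching_time t0 (\<lambda>t. C *v x' t) T'" by (rule sliding_solution_reaches[OF s'])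
  have "T = T' \<and> (\<forall>t\<in>{t0..T}. x t = x' t)"
  proof (cases "T \<le> T'")
    case True
    from reaching_times_le[OF s T s' T' this] show ?thesis by simp
  next
    case False
    then have "T' \<le> T" by simp
    from reaching_times_le[OF s' T' s T this] show ?thesis by simp
  qed
  then have TT: "T = T'" and xx: "\<And>t. t \<in> {t0..T} \<Longrightarrow> x t = x' t" by auto
  have u: "u \<in> Linf {t0..b}" and x: "solves x0 b u x" for b
    using s by (auto simp: sliding_solution_def)
  have u': "u' \<in> Linf {t0..b}" and x': "solves x0 b u' x'" for b
    using s' by (auto simp: sliding_solution_def)
  have Tt: "t0 \<le> T" using T by (auto simp: reaching_time_def)
  have ft: "free_term C B Bt \<Phi> \<gamma> p uhat t0 T x = free_term C B Bt \<Phi> \<gamma> p uhat t0 T x'"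
  proof
    fix r
    have "(LINT \<tau>:{t0..T}|lebesgue. (C ** \<Phi> r \<tau> ** Bt) *v (\<gamma> \<tau> + uhat (x \<tau>))) =
        (LINT \<tau>:{t0..T}|lebesgue. (C ** \<Phi> r \<tau> ** Bt) *v (\<gamma> \<tau> + uhat (x' \<tau>)))"
      by (rule set_lebesgue_integral_cong) (use xx in auto)
    then show "free_term C B Bt \<Phi> \<gamma> p uhat t0 T x r = free_term C B Bt \<Phi> \<gamma> p uhat t0 T x' r"
      by (simp add: free_term_def)
  qed
  have vL: "(\<lambda>t. u t + \<gamma> t) \<in> Linf {T..t}" "(\<lambda>t. u' t + \<gamma> t) \<in> Linf {T..t}"
    using Tt by (auto intro!: Linf_add disturbances_Linf intro: Linf_Icc_mono[OF u] Linf_Icc_mono[OF u'])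
  have late: "AE r in lebesgue_on {T..t}. u r + \<gamma> r = u' r + \<gamma> r"
    using sliding_control_volterra(1)[OF s T] sliding_control_volterra(1)[OF s' T'[folded TT]]
    unfolding ft by (rule volterra_solution_unique[OF Tt vL])
  have early: "AE r in lebesgue_on {t0..T}. u r = u' r"
  proof -
    have "AE r in lebesgue_on {t0..T}. r \<in> {t0..T}" by (rule AE_Icc_mem)
    then show ?thesis
      using sliding_control_volterra(2)[OF s T] sliding_control_volterra(2)[OF s' T'[folded TT]]
      by eventually_elim (use xx in auto)
  qed
  have "AE r in lebesgue_on {t0..t}. u r = u' r"
  proof -
    have "AE r in lebesgue. r \<in> {T..t} \<longrightarrow> u r = u' r" "AE r in lebesgue. r \<in> {t0..T} \<longrightarrow> u r = u' r"
      using late early by (simp_all add: AE_lebesgue_on_iff)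
    then have "AE r in lebesgue. r \<in> {t0..t} \<longrightarrow> u r = u' r" by eventually_elim auto
    then show ?thesis by (simp add: AE_lebesgue_on_iff)
  qed
  then show "x t = x' t" using t by (intro linear_solves_unique[OF x u x' u']) auto
qed

end

section \<open>Existence of the sliding motion\<close>

context sliding_mode_system
begin

lemma output_norm_nonincreasing:
  assumes x: "solves x0 b u x" and u: "u \<in> Linf {t0..b}" and ac: "t0 \<le> a" "a \<le> c" "c \<le> b"
    and pos: "\<And>t. a < t \<Longrightarrow> t \<le> c \<Longrightarrow> N (C *v x t) > 0"
    and ident: "AE t in lebesgue_on {a..c}.
      sliding_balance u t"
  shows "N (C *v x c) \<le> N (C *v x a)"
proof -
  have "N (C *v x c) - N (C *v x a) \<le> 0 * (c - a)"
  proof (rule absolutely_continuous_increment_le[OF output_norm_absolutely_continuous[OF x u ac(1,3)] ac(2)])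
    have "AE t in lebesgue_on {a..c}. (x has_vector_derivative rhs u x t) (at t)"
      using ac by (intro AE_lebesgue_on_mono[OF solves_derivative_AE[OF x u]]) auto
    moreover have "AE t in lebesgue_on {a..c}. a < t \<and> t \<le> c" by (rule AE_Icc_gt)
    ultimately show "AE t in lebesgue_on {a..c}. \<exists>v\<le>0. ((\<lambda>t. N (C *v x t)) has_vector_derivative v) (at t)"
      using ident
    proof eventually_elim
      case (elim t)
      have nz: "C *v x t \<noteq> 0" and Np: "N (C *v x t) > 0" using pos[of t] elim(2) by auto
      have "C *v rhs u x t = \<Lambda> *v (C *v x t) + (C *v (B *v (u t + \<gamma> t)) + C *v p t + C *v conv t0 (\<lambda>\<tau>. u \<tau> + \<gamma> \<tau>) t)"
        unfolding output_rhs by (simp only: add.assoc)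
      then have "C *v rhs u x t = \<Lambda> *v (C *v x t)" unfolding elim(3) by simp
      then have "((\<lambda>s. N (C *v x s)) has_vector_derivative
          ((C *v x t) \<bullet> (P *v (\<Lambda> *v (C *v x t)))) / N (C *v x t)) (at t)"
        using weighted_norm_has_vector_derivative[OF output_has_vector_derivative[OF elim(1)] nz] by simp
      moreover have "((C *v x t) \<bullet> (P *v (\<Lambda> *v (C *v x t)))) / N (C *v x t) \<le> 0"
        using Lyapunov_form[of "C *v x t"] Np by (simp add: divide_nonpos_pos)
      ultimately show ?case by blast
    qed
  qed
  then show ?thesis by simp
qed

text \<open>On the surface \<open>C B u\<close> must balance disturbances and memory. If \<open>u\<close> obeys the bound \<open>\<rho> + d\<close>, then the memory of
  \<open>u\<close> is at most \<open>M * (\<rho> + d)\<close>, and the gain condition improves the bound to \<open>\<rho> + M * d\<close>. Iteration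
  removes the excess.\<close>

lemma sliding_control_within_gain:
  assumes u: "u \<in> Linf {t0..b}" and T: "t0 \<le> T"
    and before: "AE t in lebesgue_on {t0..b}. t < T \<longrightarrow> gauge_norm (u t) \<le> \<rho>"
    and after: "AE t in lebesgue_on {T..b}.
      sliding_balance u t"
  shows "AE t in lebesgue_on {t0..b}. gauge_norm (u t) \<le> \<rho>"
proof -
  have M01: "0 \<le> M" "M < 1" by (rule memory_nonneg, rule memory_small)
  have after': "AE t in lebesgue_on {t0..b}. T \<le> t \<longrightarrow>
      sliding_balance u t"
    using after unfolding AE_lebesgue_on_iff[of "{T..b}", simplified]
    by (subst AE_lebesgue_on_iff) (simp, rule eventually_mono, auto)
  have step: "AE t in lebesgue_on {t0..b}. gauge_norm (u t) \<le> \<rho> + M * d"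
    if d: "d \<ge> 0" and bd: "AE t in lebesgue_on {t0..b}. gauge_norm (u t) \<le> \<rho> + d" for d
    using before after' good_times_gain
  proof eventually_elim
    case (elim t)
    show ?case
    proof (cases "t < T")
      case True
      then show ?thesis using elim(1) M01 d by (simp add: add_increasing2)
    next
      case False
      have ut: "u \<in> Linf {t0..t}" using elim(3) by (intro Linf_Icc_mono[OF u]) auto
      have bdt: "AE \<tau> in lebesgue_on {t0..t}. gauge_norm (u \<tau>) \<le> \<rho> + d"
        using elim(3) by (intro AE_lebesgue_on_mono[OF bd]) auto
      have cu: "N (C *v conv t0 u t) \<le> M * (\<rho> + d)"
        using elim(3) d gain_pos by (intro conv_contraction ut bdt) auto
      have "C *v conv t0 (\<lambda>\<tau>. u \<tau> + \<gamma> \<tau>) t = C *v conv t0 u t + C *v conv t0 \<gamma> t"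
        using elim(3) ut by (simp add: conv_add disturbances_Linf matrix_vector_right_distrib)
      then have "C *v (B *v u t) + (C *v (B *v \<gamma> t + p t) + C *v conv t0 \<gamma> t + C *v conv t0 u t) = 0"
        using elim(2) False by (simp add: matrix_vector_right_distrib algebra_simps)
      then have "C *v (B *v u t) = - (C *v (B *v \<gamma> t + p t) + C *v conv t0 \<gamma> t + C *v conv t0 u t)"
        by (simp only: eq_neg_iff_add_eq_0)
      then have "gauge_norm (u t) = N (C *v (B *v \<gamma> t + p t) + C *v conv t0 \<gamma> t + C *v conv t0 u t)"
        by (simp only: gauge_norm_def weighted_norm_minus)
      also have "\<dots> \<le> N (C *v (B *v \<gamma> t + p t)) + N (C *v conv t0 \<gamma> t) + N (C *v conv t0 u t)"
        using weighted_norm_triangle[of "C *v (B *v \<gamma> t + p t) + C *v conv t0 \<gamma> t" "C *v conv t0 u t"]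
          weighted_norm_triangle[of "C *v (B *v \<gamma> t + p t)" "C *v conv t0 \<gamma> t"] by linarith
      also have "\<dots> \<le> \<rho> * (1 - M) + M * (\<rho> + d)" using cu elim(3) margin_pos by linarith
      finally show ?thesis by (simp add: algebra_simps)
    qed
  qed
  obtain c where c: "c \<ge> 0" "AE t in lebesgue_on {t0..b}. gauge_norm (u t) \<le> c"
    by (rule Linf_gauge_normE[OF u])
  have "AE t in lebesgue_on {t0..b}. gauge_norm (u t) \<le> \<rho> + M ^ n * c" for n
  proof (induction n)
    case 0
    show ?case using c(2) by eventually_elim (use gain_pos in simp)
  next
    case (Suc n)
    from step[OF _ this] show ?case using c(1) M01 by (simp add: mult.assoc)
  qed
  then have "AE t in lebesgue_on {t0..b}. \<forall>n. gauge_norm (u t) \<le> \<rho> + M ^ n * c"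
    by (simp add: AE_all_countable)
  then show ?thesis
  proof eventually_elim
    case (elim t)
    have "(\<lambda>n. \<rho> + M ^ n * c) \<longlonglongrightarrow> \<rho> + 0 * c"
      using M01 by (intro tendsto_add tendsto_mult LIMSEQ_power_zero tendsto_const) auto
    then have "gauge_norm (u t) \<le> \<rho> + 0 * c"
      by (rule LIMSEQ_le_const) (use elim in blast)
    then show ?case by simp
  qed
qed

text \<open>Existence of the reaching phase, stated in terms of the control \<open>v\<close> alone: whatever control continues
  \<open>v\<close> after \<open>T\<close>, the state driven by it is regular before \<open>T\<close>, obeys the relay there, and reaches the surface
  at \<open>T\<close>. The formulation leaves the control after \<open>T\<close> to be chosen later, although the state is
  only defined once the control is known for all times.\<close>

theorem regular_phase_exists:
  obtains T v where "t0 \<le> T" "\<forall>b. v \<in> Linf {t0..b}" "\<forall>t. gauge_norm (v t) \<le> \<rho>"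
    "\<forall>u x. (\<forall>b. u \<in> Linf {t0..b}) \<and> (\<forall>t. t0 \<le> t \<and> t < T \<longrightarrow> u t = v t) \<and> (\<forall>b. solves x0 b u x) \<longrightarrow>
      (\<forall>t. t0 \<le> t \<and> t < T \<longrightarrow> C *v x t \<noteq> 0 \<and> u t = uhat (x t)) \<and> C *v x T = 0"
proof -
  define \<epsilon> where "\<epsilon> k = 1 / (real k + 1)" for k
  have \<epsilon>: "\<epsilon> k > 0" for k by (simp add: \<epsilon>_def)
  have \<epsilon>_mono: "\<epsilon> j \<le> \<epsilon> k" if "k \<le> j" for k j using that by (simp add: \<epsilon>_def frac_le)
  let ?h = "\<lambda>k. regularised_feedback (\<epsilon> k)"
  have "\<exists>X. \<forall>b. solves x0 b (\<lambda>t. ?h k (X t)) X" for k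
  proof -
    obtain L where L: "L-lipschitz_on UNIV (?h k)" by (rule regularised_feedback_lipschitz[OF \<epsilon>])
    obtain X where "\<And>b. solves x0 b (\<lambda>t. ?h k (X t) + 0) X"
      by (rule solves_exists[where ?x0.0=x0, OF L Linf_zero]) (blast intro: that)
    then show ?thesis by auto
  qed
  then obtain X where X: "\<And>k b. solves x0 b (\<lambda>t. ?h k (X k t)) (X k)" by metis
  have Xc: "continuous_on {t0..b} (X k)" for k b using X[where k=k and b=b] by (simp add: solves_def)
  have UL: "(\<lambda>t. ?h k (X k t)) \<in> Linf {t0..b}" for k b
  proof -
    obtain L where L: "L-lipschitz_on UNIV (?h k)" by (rule regularised_feedback_lipschitz[OF \<epsilon>])
    show ?thesis
      by (intro Linf_continuous continuous_on_compose2[OF lipschitz_on_continuous_on[OF L] Xc]) auto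
  qed
  define good where "good k s \<longleftrightarrow> t0 \<le> s \<and> (\<forall>t\<in>{t0..s}. N (C *v X k t) > \<epsilon> k)" for k s
  have hX: "?h j (X k t) = uhat (X k t)" if "good k s" "k \<le> j" "t \<in> {t0..s}" for j k s t
    using that \<epsilon>_mono[of k j] by (intro regularised_feedback_eq) (force simp: good_def)
  have agree: "X k t = X j t" if g: "good k s" "k \<le> j" "t \<in> {t0..s}" for k j s t
  proof (rule regular_phase_unique[OF \<epsilon>[of j] X UL _ X UL _ g(3)])
    show "AE t in lebesgue_on {t0..s}. ?h k (X k t) = ?h j (X k t)"
      using hX[OF g(1) order_refl] hX[OF g(1,2)] by (simp add: AE_lebesgue_on_iff)
  qed simp
  have good_up: "good j s" if g: "good k s" "k \<le> j" for k j s
    unfolding good_def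
  proof (intro conjI ballI)
    show "t0 \<le> s" using g by (simp add: good_def)
    fix t assume t: "t \<in> {t0..s}"
    have "\<epsilon> k < N (C *v X k t)" using g(1) t by (simp add: good_def)
    then show "\<epsilon> j < N (C *v X j t)" using agree[OF g t] \<epsilon>_mono[OF g(2)] by simp
  qed
  have good_down: "good k t" if "good k s" "t0 \<le> t" "t \<le> s" for k s t
    using that by (auto simp: good_def)
  have bound: "s \<le> t0 + N (C *v x0) / \<delta>" if g: "good k s" for k s
  proof -
    have ts: "t0 \<le> s" using g by (simp add: good_def)
    have "N (C *v X k s) - N (C *v X k t0) \<le> - \<delta> * (s - t0)"
    proof (rule output_norm_decrease[OF X UL _ order_refl ts order_refl])
      show "AE t in lebesgue_on {t0..s}. gauge_norm (?h k (X k t)) \<le> \<rho>"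
        using gauge_norm_regularised[OF \<epsilon>] by simp
      show "AE t in lebesgue_on {t0..s}. C *v X k t \<noteq> 0 \<and> ?h k (X k t) = uhat (X k t)"
        using hX[OF g order_refl] g \<epsilon>[of k] by (force simp: AE_lebesgue_on_iff good_def)
    qed
    moreover have "X k t0 = x0" using X[of t0 k] by (simp add: solves_def)
    ultimately have "\<delta> * (s - t0) \<le> N (C *v x0)"
      using weighted_norm_nonneg[of "C *v X k s"] by (simp only: mult_minus_left)
    then have "s - t0 \<le> N (C *v x0) / \<delta>" using margin_pos by (simp add: pos_le_divide_eq mult.commute)
    then show ?thesis by simp
  qed
  have extend: "\<exists>s'>s. good k s'" if g: "good k s" for k s
  proof -
    have ts: "t0 \<le> s" "\<epsilon> k < N (C *v X k s)" using g by (auto simp: good_def)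
    have c: "continuous_on {t0..s + 1} (\<lambda>t. N (C *v X k t))"
      by (rule continuous_output_norm[OF X]) auto
    obtain d where d: "d > 0" "\<And>t. t \<in> {t0..s + 1} \<Longrightarrow> dist t s < d \<Longrightarrow>
        dist (N (C *v X k t)) (N (C *v X k s)) < N (C *v X k s) - \<epsilon> k"
      using c ts unfolding continuous_on_iff by (metis atLeastAtMost_iff diff_gt_0_iff_gt le_add_same_cancel1 zero_le_one)
    define s' where "s' = s + min d 1 / 2"
    have "good k s'"
      unfolding good_def
    proof (intro conjI ballI)
      show "t0 \<le> s'" using ts d by (simp add: s'_def)
      fix t assume t: "t \<in> {t0..s'}"
      show "\<epsilon> k < N (C *v X k t)"
      proof (cases "t \<le> s")
        case True
        then show ?thesis using g t by (simp add: good_def)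
      next
        case False
        then have "t \<in> {t0..s + 1}" "dist t s < d" using t d by (auto simp: s'_def dist_real_def min_def split: if_splits)
        from d(2)[OF this] show ?thesis by (simp add: dist_real_def)
      qed
    qed
    moreover have "s' > s" using d by (simp add: s'_def)
    ultimately show ?thesis by blast
  qed
  \<comment> \<open>The initial time is added because the set is empty if the motion starts on the surface.\<close>
  define S where "S = insert t0 {s. \<exists>k. good k s}"
  define T where "T = Sup S"
  have S_bdd: "bdd_above S"
  proof (rule bdd_aboveI)
    fix s assume "s \<in> S"
    then show "s \<le> t0 + N (C *v x0) / \<delta>" using bound margin_pos by (auto simp: S_def)
  qed
  have S_le: "s \<le> T" if "s \<in> S" for s unfolding T_def by (rule cSup_upper[OF that S_bdd])
  have tT: "t0 \<le> T" by (rule S_le) (simp add: S_def)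
  have not_T: "\<not> good k T" for k
  proof
    assume "good k T"
    then obtain s' where "s' > T" "good k s'" using extend by blast
    then show False using S_le[of s'] by (auto simp: S_def)
  qed
  have good_lt: "s < T" if "good k s" for k s
  proof -
    have "s \<in> S" using that by (auto simp: S_def)
    then have "s \<le> T" by (rule S_le)
    moreover have "s \<noteq> T" using that not_T by blast
    ultimately show ?thesis by simp
  qed
  have before: "\<exists>k. good k t" if t: "t0 \<le> t" "t < T" for t
  proof -
    obtain s where s: "s \<in> S" "t < s" using t(2) less_cSup_iff[of S t] S_bdd by (auto simp: T_def S_def)
    then obtain k where "good k s" using t by (auto simp: S_def)
    then show ?thesis using good_down[of k s t] s t by auto
  qed
  define Y where "Y t = X (SOME k. good k t) t" for t
  have Y: "Y t = X k t" if g: "good k t" for k t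
  proof -
    define k' where "k' = (SOME k. good k t)"
    have g': "good k' t" unfolding k'_def by (rule someI[where P="\<lambda>k. good k t", OF g])
    have t: "t \<in> {t0..t}" using g by (simp add: good_def)
    have "X k' t = X k t"
    proof (cases "k \<le> k'")
      case True
      show ?thesis by (rule agree[OF g True t, symmetric])
    next
      case False
      then have "k' \<le> k" by simp
      from agree[OF g' this t] show ?thesis .
    qed
    then show ?thesis by (simp add: Y_def k'_def)
  qed
  \<comment> \<open>On the reaching phase Y is the pointwise limit of the regularised solutions.\<close>
  have Ym: "Y \<in> borel_measurable (lebesgue_on {t0..<T})"
  proof (rule borel_measurable_LIMSEQ_metric)
    show "X j \<in> borel_measurable (lebesgue_on {t0..<T})" for j
      by (intro continuous_imp_measurable_on_sets_lebesgue continuous_on_subset[OF Xc[of T j]]) auto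
    fix t assume "t \<in> space (lebesgue_on {t0..<T})"
    then have t: "t0 \<le> t" "t < T" by auto
    obtain k where g: "good k t" using before[OF t] by blast
    have "X j t = Y t" if "j \<ge> k" for j using Y[OF g] agree[OF g that, of t] t by simp
    then show "(\<lambda>j. X j t) \<longlonglongrightarrow> Y t"
      by (intro tendsto_eventually) (auto simp: eventually_sequentially)
  qed
  obtain l where l: "l > 0" "\<And>u. norm u \<le> l * gauge_norm u"
    by (rule norm_le_gauge_norm) (blast intro: that)+
  have gu: "gauge_norm (uhat x) \<le> \<rho>" for x using gauge_norm_feedback[of x] gain_pos by simp
  have "(\<lambda>t. uhat (Y t)) \<in> Linf {t0..<T}"
  proof (rule LinfI)
    show "(\<lambda>t. uhat (Y t)) \<in> borel_measurable (lebesgue_on {t0..<T})"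
      by (rule measurable_compose[OF Ym feedback_borel_measurable])
    have "norm (uhat x) \<le> l * \<rho>" for x
      using l(2)[of "uhat x"] mult_left_mono[OF gu[of x], of l] l(1) by linarith
    then show "AE t in lebesgue_on {t0..<T}. norm (uhat (Y t)) \<le> l * \<rho>" by simp
  qed
  then have vL: "(\<lambda>t. if t \<in> {t0..<T} then uhat (Y t) else 0) \<in> Linf {t0..b}" for b
    by (rule Linf_extend_by_zero) auto
  define v where "v t = (if t \<in> {t0..<T} then uhat (Y t) else 0)" for t
  have vb: "gauge_norm (v t) \<le> \<rho>" for t using gu gain_pos by (simp add: v_def)
  have phase: "(\<forall>t. t0 \<le> t \<and> t < T \<longrightarrow> C *v x t \<noteq> 0 \<and> u t = uhat (x t)) \<and> C *v x T = 0"
    if u: "\<And>b. u \<in> Linf {t0..b}" and uv: "\<And>t. t0 \<le> t \<Longrightarrow> t < T \<Longrightarrow> u t = v t"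
      and x: "\<And>b. solves x0 b u x" for u x
  proof (intro conjI allI impI)
    have xX: "x t = X k t" if g: "good k s" and t: "t \<in> {t0..s}" for k s t
    proof (rule linear_solves_unique[OF x u X UL _ t])
      have "u r = ?h k (X k r)" if r: "r \<in> {t0..s}" for r
        using uv[of r] good_lt[OF g] r Y[OF good_down[OF g, of r]] hX[OF g order_refl r] by (simp add: v_def)
      then show "AE r in lebesgue_on {t0..s}. u r = ?h k (X k r)" by (simp add: AE_lebesgue_on_iff)
    qed
    have pre: "C *v x t \<noteq> 0 \<and> u t = uhat (x t)" if t: "t0 \<le> t" "t < T" for t
    proof -
      obtain k where g: "good k t" using before[OF t] by blast
      have "x t = X k t" using xX[OF g, of t] t by simp
      moreover have "N (C *v X k t) > 0" using g t \<epsilon>[of k] by (force simp: good_def)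
      ultimately show ?thesis using uv[OF t] t Y[OF g] by (simp add: v_def)
    qed
    then show "C *v x t \<noteq> 0" "u t = uhat (x t)" if "t0 \<le> t \<and> t < T" for t using that by auto
    show "C *v x T = 0"
    proof (rule ccontr)
      assume nz: "C *v x T \<noteq> 0"
      have pos: "N (C *v x r) > 0" if "r \<in> {t0..T}" for r
        using pre[of r] nz that by (cases "r = T") auto
      have ne: "{t0..T} \<noteq> {}" using tT by auto
      obtain r where r: "r \<in> {t0..T}" "\<And>q. q \<in> {t0..T} \<Longrightarrow> N (C *v x r) \<le> N (C *v x q)"
        using continuous_attains_inf[OF compact_Icc ne continuous_output_norm[OF x[of T] order_refl order_refl]] by blast
      obtain k where k: "inverse (real (Suc k)) < N (C *v x r)" using reals_Archimedean[OF pos[OF r(1)]] by blast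
      then have ek: "\<epsilon> k < N (C *v x q)" if "q \<in> {t0..T}" for q
        using r(2)[OF that] by (simp add: \<epsilon>_def inverse_eq_divide add.commute)
      have eq: "x q = X k q" if q: "q \<in> {t0..T}" for q
      proof (rule regular_phase_unique[OF \<epsilon>[of k] x u _ X UL _ q])
        have "AE t in lebesgue_on {t0..T}. t0 \<le> t \<and> t < T" by (rule AE_Icc_lt)
        then show "AE t in lebesgue_on {t0..T}. u t = ?h k (x t)"
        proof eventually_elim
          case (elim t)
          have "?h k (x t) = uhat (x t)" using ek[of t] elim by (intro regularised_feedback_eq) auto
          then show ?case using pre[of t] elim by simp
        qed
      qed simp
      \<comment> \<open>A nonzero output at T would keep a regularised solution above its threshold up to T.\<close>
      have "good k T" using ek eq tT by (auto simp: good_def)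
      then show False using not_T by blast
    qed
  qed
  show ?thesis
  proof (rule that[of T v])
    show "\<forall>b. v \<in> Linf {t0..b}" using vL by (simp add: v_def[abs_def])
    show "\<forall>u x. (\<forall>b. u \<in> Linf {t0..b}) \<and> (\<forall>t. t0 \<le> t \<and> t < T \<longrightarrow> u t = v t) \<and> (\<forall>b. solves x0 b u x) \<longrightarrow>
      (\<forall>t. t0 \<le> t \<and> t < T \<longrightarrow> C *v x t \<noteq> 0 \<and> u t = uhat (x t)) \<and> C *v x T = 0"
    proof (intro allI impI)
      fix u x
      assume "(\<forall>b. u \<in> Linf {t0..b}) \<and> (\<forall>t. t0 \<le> t \<and> t < T \<longrightarrow> u t = v t) \<and> (\<forall>b. solves x0 b u x)"
      then show "(\<forall>t. t0 \<le> t \<and> t < T \<longrightarrow> C *v x t \<noteq> 0 \<and> u t = uhat (x t)) \<and> C *v x T = 0"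
        by (intro phase) auto
    qed
  qed (use tT vb in auto)
qed

theorem sliding_solution_exists:
  obtains u x where "sliding_solution x0 u x"
proof -
  obtain T v where T: "t0 \<le> T" and vall: "\<forall>b. v \<in> Linf {t0..b}" "\<forall>t. gauge_norm (v t) \<le> \<rho>"
    and phase: "\<forall>u x. (\<forall>b. u \<in> Linf {t0..b}) \<and> (\<forall>t. t0 \<le> t \<and> t < T \<longrightarrow> u t = v t) \<and> (\<forall>b. solves x0 b u x) \<longrightarrow>
      (\<forall>t. t0 \<le> t \<and> t < T \<longrightarrow> C *v x t \<noteq> 0 \<and> u t = uhat (x t)) \<and> C *v x T = 0"
    by (rule regular_phase_exists[where ?x0.0=x0])
  have v: "v \<in> Linf {t0..b}" and vb: "gauge_norm (v t) \<le> \<rho>" for b t using vall by auto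
  define g where "g = past_forcing (\<lambda>t. v t + \<gamma> t) T"
  have gL: "g \<in> Linf {T..b}" for b
    unfolding g_def by (intro past_forcing_Linf Linf_add v disturbances_Linf T)
  obtain ut where utL: "\<And>b. ut \<in> Linf {T..b}"
    and ut: "\<And>b. AE s in lebesgue_on {T..b}. ut s = g s + volterra T ut s"
    by (rule neumann_series[OF T gL]) (blast intro: that)
  define u where "u t = (if t \<in> {..<T} then v t else ut t - \<gamma> t)" for t
  have u: "u \<in> Linf {t0..b}" for b
    unfolding u_def[abs_def]
  proof (rule Linf_if)
    show "v \<in> Linf ({t0..b} \<inter> {..<T})" by (rule Linf_mono[OF v[of b]]) auto
    have "(\<lambda>t. ut t - \<gamma> t) \<in> Linf {T..b}" by (intro Linf_diff utL disturbances_Linf)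
    then show "(\<lambda>t. ut t - \<gamma> t) \<in> Linf ({t0..b} - {..<T})" by (rule Linf_mono) auto
  qed auto
  have h: "0-lipschitz_on UNIV (\<lambda>x :: real^'n. 0 :: real^'m)" by (rule lipschitz_onI) auto
  obtain x where "\<And>b. solves x0 b (\<lambda>t. 0 + u t) x" by (rule solves_exists[where ?x0.0=x0, OF h u]) (blast intro: that)
  then have x: "solves x0 b u x" for b by simp
  have pre: "\<And>t. t0 \<le> t \<Longrightarrow> t < T \<Longrightarrow> C *v x t \<noteq> 0 \<and> u t = uhat (x t)" and xT: "C *v x T = 0"
    using phase[rule_format, of u x] u x by (auto simp: u_def)
  have ident: "AE t in lebesgue_on {T..b}.
      sliding_balance u t" for b
    using ut[of b] good_times_from[OF T]
  proof eventually_elim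
    case (elim t)
    have "AE \<tau> in lebesgue. \<tau> \<notin> {T}" by (rule AE_not_in) auto
    then have vu: "AE \<tau> in lebesgue_on {t0..T}. u \<tau> + \<gamma> \<tau> = v \<tau> + \<gamma> \<tau>"
      by (subst AE_lebesgue_on_iff) (simp, rule eventually_mono, auto simp: u_def)
    have "volterra T (\<lambda>\<tau>. u \<tau> + \<gamma> \<tau>) t = volterra T ut t"
    proof -
      have "(LINT \<tau>:{T..t}|lebesgue. (C ** \<Phi> t \<tau> ** Bt) *v (u \<tau> + \<gamma> \<tau>)) =
          (LINT \<tau>:{T..t}|lebesgue. (C ** \<Phi> t \<tau> ** Bt) *v ut \<tau>)"
        by (rule set_lebesgue_integral_cong) (auto simp: u_def)
      then show ?thesis by (simp add: volterra_op_def)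
    qed
    then have "u t + \<gamma> t = past_forcing (\<lambda>t. v t + \<gamma> t) T t + volterra T (\<lambda>\<tau>. u \<tau> + \<gamma> \<tau>) t"
      using elim by (simp add: u_def g_def)
    moreover have "u t + \<gamma> t = past_forcing (\<lambda>t. v t + \<gamma> t) T t + volterra T (\<lambda>\<tau>. u \<tau> + \<gamma> \<tau>) t \<longleftrightarrow>
        sliding_balance u t"
      using elim by (intro sliding_identity_iff T Linf_add u disturbances_Linf vu) auto
    ultimately show ?case by blast
  qed
  have post: "C *v x t = 0" if t: "t \<ge> T" for t
  proof -
    have "N (C *v x t) = 0"
    proof (rule vanishing_persists[where T=T and b=t and V="\<lambda>t. N (C *v x t)"])
      show "continuous_on {T..t} (\<lambda>t. N (C *v x t))" by (rule continuous_output_norm[OF x T order_refl])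
      fix a c assume ac: "T \<le> a" "a \<le> c" "c \<le> t" and pos: "\<And>r. a < r \<Longrightarrow> r \<le> c \<Longrightarrow> 0 < N (C *v x r)"
      show "N (C *v x c) \<le> N (C *v x a)"
      proof (rule output_norm_nonincreasing[OF x[of c] u _ ac(2) order_refl pos])
        show "t0 \<le> a" using T ac by simp
        show "AE t in lebesgue_on {a..c}.
            sliding_balance u t"
          using ac by (intro AE_lebesgue_on_mono[OF ident[of c]]) auto
      qed
    qed (use t xT in auto)
    then show ?thesis by simp
  qed
  have gauge: "AE t in lebesgue_on {t0..b}. gauge_norm (u t) \<le> \<rho>" for b
    using vb by (intro sliding_control_within_gain[OF u T _ ident]) (auto simp: u_def)
  have "AE t in lebesgue_on {t0..}. gauge_norm (u t) \<le> \<rho> \<and> (C *v x t \<noteq> 0 \<longrightarrow> u t = uhat (x t))"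
  proof (rule AE_lebesgue_on_atLeast)
    fix b
    have "AE t in lebesgue_on {t0..b}. t \<in> {t0..b}" by (rule AE_Icc_mem)
    then show "AE t in lebesgue_on {t0..b}. gauge_norm (u t) \<le> \<rho> \<and> (C *v x t \<noteq> 0 \<longrightarrow> u t = uhat (x t))"
      using gauge[of b]
    proof eventually_elim
      case (elim t)
      then show ?case using pre[of t] post[of t] by (cases "t < T") auto
    qed
  qed
  then have "sliding_solution x0 u x" using u x by (simp add: sliding_solution_def)
  then show ?thesis by (rule that)
qed

section \<open>Dynamics on the sliding surface\<close>

lemma sliding_projector_apply: "sliding_projector B C *v z = z - B *v (D *v (C *v z))"
  by (simp add: sliding_projector_def matrix_vector_mult_diff_rdistrib matrix_vector_mul_assoc matrix_mul_assoc)

theorem sliding_projector_onto_kernel: "projector_onto (sliding_projector B C) {x. C *v x = 0}"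
proof -
  let ?\<Pi> = "sliding_projector B C"
  have ker: "C *v (?\<Pi> *v z) = 0" for z
    by (simp add: sliding_projector_apply matrix_vector_mult_diff_distrib)
  have fixed: "?\<Pi> *v z = z" if "C *v z = 0" for z
    using that by (simp add: sliding_projector_apply)
  have "?\<Pi> ** ?\<Pi> = ?\<Pi>"
    unfolding matrix_eq by (simp add: matrix_vector_mul_assoc[symmetric] fixed ker)
  moreover have "range (\<lambda>x. ?\<Pi> *v x) = {x. C *v x = 0}"
  proof
    show "range (\<lambda>x. ?\<Pi> *v x) \<subseteq> {x. C *v x = 0}" using ker by auto
    show "{x. C *v x = 0} \<subseteq> range (\<lambda>x. ?\<Pi> *v x)"
    proof
      fix z assume "z \<in> {x. C *v x = 0}"
      then have "z = ?\<Pi> *v z" by (simp add: fixed)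
      then show "z \<in> range (\<lambda>x. ?\<Pi> *v x)" by (rule range_eqI)
    qed
  qed
  ultimately show ?thesis by (simp add: projector_onto_def)
qed

text \<open>Eliminate the control with the balance on the surface: \<open>B (u + \<gamma>)\<close> cancels the component of
  disturbance and memory that the projector removes.\<close>

lemma sliding_dynamics:
  assumes s: "sliding_solution x0 u x" and T: "reaching_time t0 (\<lambda>t. C *v x t) T"
  shows "AE t in lebesgue_on {T..b}. (x has_vector_derivative
    (A *v x t + sliding_projector B C *v p t
      + (LINT \<tau>:{t0..t}|lebesgue. (sliding_projector B C ** \<Phi> t \<tau> ** Bt) *v (u \<tau> + \<gamma> \<tau>)))) (at t)"
proof -
  have u: "u \<in> Linf {t0..b}" and x: "solves x0 b u x" for b
    using s by (auto simp: sliding_solution_def)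
  have Tt: "t0 \<le> T" "\<And>t. t \<ge> T \<Longrightarrow> C *v x t = 0" using T by (auto simp: reaching_time_def)
  have "AE t in lebesgue_on {T..b}. (x has_vector_derivative rhs u x t) (at t)"
    using Tt by (intro AE_lebesgue_on_mono[OF solves_derivative_AE[OF x u]]) auto
  moreover have "AE t in lebesgue_on {T..b}. sliding_balance u t"
    by (rule sliding_phase_identity[OF x u Tt(1)]) (rule Tt(2))
  ultimately show ?thesis
    using good_times_from[OF Tt(1)]
  proof eventually_elim
    case (elim t)
    define c where "c = conv t0 (\<lambda>\<tau>. u \<tau> + \<gamma> \<tau>) t"
    have "D *v (C *v (B *v (u t + \<gamma> t)) + C *v p t + C *v c) = 0"
      using elim(2) by (simp add: c_def)
    then have "u t + \<gamma> t = - (D *v (C *v p t) + D *v (C *v c))"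
      by (simp only: matrix_vector_right_distrib D_CB eq_neg_iff_add_eq_0 add.assoc)
    then have "B *v (u t + \<gamma> t) = - (B *v (D *v (C *v p t)) + B *v (D *v (C *v c)))"
      by (simp only: matrix_vector_right_distrib[symmetric] vec.neg)
    moreover have "(LINT \<tau>:{t0..t}|lebesgue. (sliding_projector B C ** \<Phi> t \<tau> ** Bt) *v (u \<tau> + \<gamma> \<tau>)) = sliding_projector B C *v c"
      unfolding c_def using elim(3) by (intro LINT_matrix_conv Linf_add u disturbances_Linf) auto
    ultimately have "rhs u x t = A *v x t + sliding_projector B C *v p t
      + (LINT \<tau>:{t0..t}|lebesgue. (sliding_projector B C ** \<Phi> t \<tau> ** Bt) *v (u \<tau> + \<gamma> \<tau>))"
      by (simp add: rhs_def c_def[symmetric] sliding_projector_apply)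
    then show ?case using elim(1) by simp
  qed
qed

lemma equivalent_control_formula:
  assumes s: "sliding_solution x0 u x" and T: "reaching_time t0 (\<lambda>t. C *v x t) T"
    and utL: "\<And>b. ut \<in> Linf {T..b}"
    and ut: "\<And>b. AE s in lebesgue_on {T..b}. ut s = free_term C B Bt \<Phi> \<gamma> p uhat t0 T x s + volterra T ut s"
  shows "AE t in lebesgue_on {t0..}. u t = (if t < T then uhat (x t) else ut t - \<gamma> t)"
proof (rule AE_lebesgue_on_atLeast)
  fix b
  have u: "u \<in> Linf {t0..b}" for b using s by (auto simp: sliding_solution_def)
  have Tt: "t0 \<le> T" using T by (auto simp: reaching_time_def)
  have "AE t in lebesgue_on {T..b}. u t + \<gamma> t = ut t"
    using Tt by (intro volterra_solution_unique[OF Tt _ utL sliding_control_volterra(1)[OF s T] ut]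
        Linf_add disturbances_Linf Linf_Icc_mono[OF u]) auto
  then have "AE t in lebesgue. t \<in> {T..b} \<longrightarrow> u t + \<gamma> t = ut t" by (simp add: AE_lebesgue_on_iff)
  moreover have "AE t in lebesgue. t \<in> {t0..T} \<longrightarrow> u t = uhat (x t)"
    using sliding_control_volterra(2)[OF s T] by (simp add: AE_lebesgue_on_iff)
  ultimately have "AE t in lebesgue. t \<in> {t0..b} \<longrightarrow> u t = (if t < T then uhat (x t) else ut t - \<gamma> t)"
    by eventually_elim (auto simp: eq_diff_eq)
  then show "AE t in lebesgue_on {t0..b}. u t = (if t < T then uhat (x t) else ut t - \<gamma> t)"
    by (simp add: AE_lebesgue_on_iff)
qed

end

theorem corollary4:
  fixes A :: "real^'n^'n" and B Bt :: "real^'m^'n" and C :: "real^'n^'m"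
    and \<Phi> :: "real \<Rightarrow> real \<Rightarrow> real^'n^'n"
    and \<gamma> :: "real \<Rightarrow> real^'m" and p :: "real \<Rightarrow> real^'n"
    and t0 \<rho> M \<delta> :: real and x0 :: "real^'n"
    and P \<Lambda> :: "real^'m^'m"
  assumes "det (C ** B) \<noteq> 0"
    and "(\<lambda>(t, \<tau>). \<Phi> t \<tau>) \<in> borel_measurable (lebesgue_on {(t, \<tau>). t \<ge> \<tau>})"
    and "locally_ess_bounded_on {(t, \<tau>). t \<ge> \<tau>} (\<lambda>(t, \<tau>). \<Phi> t \<tau>)"
    and "\<gamma> \<in> Linf UNIV" and "p \<in> Linf UNIV"
    and "\<rho> > 0"
    and "C ** A = \<Lambda> ** C"
    and "pos_definite P"
    and "neg_semidefinite (transpose \<Lambda> ** P + P ** \<Lambda>)"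
    and "\<delta> > 0"
    and "esssup (lebesgue_on {t0..})
           (\<lambda>t. ereal (LINT \<tau>:{t0..t}|lebesgue.
              weighted_onorm P (C ** \<Phi> t \<tau> ** Bt ** matrix_inv (C ** B)))) \<le> ereal M"
    and "M < 1"
    and "AE t in lebesgue_on {t0..}.
           \<rho> \<ge> (weighted_norm P (C *v (B *v \<gamma> t + p t))
                 + (LINT \<tau>:{t0..t}|lebesgue. weighted_norm P ((C ** \<Phi> t \<tau> ** Bt) *v \<gamma> \<tau>))
                 + \<delta>) / (1 - M)"
  shows "\<exists>x. utkin_solution A B Bt \<Phi> \<gamma> p (feedback P \<rho> B C) t0 x0 x \<and>
    (\<forall>x'. utkin_solution A B Bt \<Phi> \<gamma> p (feedback P \<rho> B C) t0 x0 x' \<longrightarrow> (\<forall>t\<ge>t0. x' t = x t)) \<and>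
    (\<exists>T. reaching_time t0 (\<lambda>t. C *v x t) T \<and>
       T \<in> {t0..t0 + weighted_norm P (C *v x0) / \<delta>} \<and>
       (\<forall>t>T. Linf_bounded_linear {T<..<t} (volterra_op C B Bt \<Phi> T)) \<and>
       (\<exists>ut. (\<forall>t>T. Linf_sums {T<..<t}
                  (\<lambda>i. (volterra_op C B Bt \<Phi> T ^^ i)
                     (free_term C B Bt \<Phi> \<gamma> p (feedback P \<rho> B C) t0 T x)) ut) \<and>
          (\<forall>ueq. equivalent_control A B Bt \<Phi> \<gamma> p (feedback P \<rho> B C) t0 x ueq \<longrightarrow>
             (AE t in lebesgue_on {t0..}.
                ueq t = (if t < T then feedback P \<rho> B C (x t) else ut t - \<gamma> t)) \<and>
             (AE t in lebesgue_on {T..}.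
                (x has_vector_derivative
                  (A *v x t + sliding_projector B C *v p t
                    + (LINT \<tau>:{t0..t}|lebesgue.
                         (sliding_projector B C ** \<Phi> t \<tau> ** Bt) *v (ueq \<tau> + \<gamma> \<tau>)))) (at t)) \<and>
             (\<forall>t\<ge>T. 0 = C *v x t)))) \<and>
    projector_onto (sliding_projector B C) {x. C *v x = 0}"
proof -
  interpret sliding_mode_system P B C \<rho> \<Phi> A Bt \<gamma> p t0 M \<delta> \<Lambda>
    by unfold_locales (fact assms)+
  obtain u x where s: "sliding_solution x0 u x" by (rule sliding_solution_exists)
  note ux = sliding_solution_imp_utkin(2)[OF s]
  obtain T where T: "reaching_time t0 (\<lambda>t. C *v x t) T" "T \<in> {t0..t0 + weighted_norm P (C *v x0) / \<delta>}"
    by (rule sliding_solution_reaches[OF s])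
  have t0T: "t0 \<le> T" using T(2) by simp
  obtain ut where utL: "\<And>b. ut \<in> Linf {T..b}"
    and sums: "\<And>t. T < t \<Longrightarrow> Linf_sums {T<..<t}
      (\<lambda>i. (volterra_op C B Bt \<Phi> T ^^ i) (free_term C B Bt \<Phi> \<gamma> p (feedback P \<rho> B C) t0 T x)) ut"
    and ut: "\<And>b. AE s in lebesgue_on {T..b}.
      ut s = free_term C B Bt \<Phi> \<gamma> p (feedback P \<rho> B C) t0 T x s + volterra_op C B Bt \<Phi> T ut s"
    by (rule neumann_series[OF t0T free_term_Linf[OF s T(1)]]) (blast intro: that)
  have unique: "x' t = x t" if x': "utkin_solution A B Bt \<Phi> \<gamma> p (feedback P \<rho> B C) t0 x0 x'" and t: "t \<ge> t0" for x' t
  proof -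
    obtain u' where "equivalent_control A B Bt \<Phi> \<gamma> p (feedback P \<rho> B C) t0 x' u'"
      using x' by (auto simp: utkin_solution_def)
    from equivalent_control_imp_sliding_solution[OF x' this] s t show ?thesis
      by (rule sliding_solution_unique)
  qed
  have control: "(AE t in lebesgue_on {t0..}. ueq t = (if t < T then feedback P \<rho> B C (x t) else ut t - \<gamma> t)) \<and>
      (AE t in lebesgue_on {T..}. (x has_vector_derivative
          (A *v x t + sliding_projector B C *v p t
            + (LINT \<tau>:{t0..t}|lebesgue. (sliding_projector B C ** \<Phi> t \<tau> ** Bt) *v (ueq \<tau> + \<gamma> \<tau>)))) (at t)) \<and>
      (\<forall>t\<ge>T. 0 = C *v x t)"
    if "equivalent_control A B Bt \<Phi> \<gamma> p (feedback P \<rho> B C) t0 x ueq" for ueq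
  proof -
    have s': "sliding_solution x0 ueq x" by (rule equivalent_control_imp_sliding_solution[OF ux that])
    have "\<forall>t\<ge>T. 0 = C *v x t" using T(1) by (simp add: reaching_time_def)
    then show ?thesis
      using equivalent_control_formula[OF s' T(1) utL ut] AE_lebesgue_on_atLeast[OF sliding_dynamics[OF s' T(1)]]
      by blast
  qed
  show ?thesis
  proof (intro exI[of _ x] exI[of _ T] exI[of _ ut] conjI)
    show "\<forall>t>T. Linf_bounded_linear {T<..<t} (volterra_op C B Bt \<Phi> T)"
      by (intro allI impI volterra_op_bounded_linear[OF t0T])
  qed (intro allI impI ux unique T sums control sliding_projector_onto_kernel; assumption)+
qed

end
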